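(* Let $d\in\mathbb{N}$ and let $\xi,\xi_1,\xi_2,\ldots$ be i.i.d. random variables in $\mathbb{R}^d$ with $\mathbb{E}\xi=0$ and $\mathbb{E}[\|\xi\|^2]<\infty$. Let $\Sigma:=\mathbb{E}[\xi\xi^{\top}]$, $S_0:=0$, $S_n:=\sum_{i=1}^n\xi_i$, and let $\mathcal{W}_n,\mathcal{S}_n,\mathcal{V}_n$ be respectively the mean width, surface area and volume of $\operatorname{hull}\{S_0,\ldots,S_n\}$. Let $h_d:=\operatorname{hull}b_d[0,1]$ and let $v_d$ be the volume of $h_d$. Then, as $n\to\infty$, each of the following holds in the sense of convergence in distribution: $$n^{-1/2}\mathcal{W}_n\to\mathcal{W}(\Sigma^{1/2}h_d),$$ $$n^{-(d-1)/2}\mathcal{S}_n\to\mathcal{S}(\Sigma^{1/2}h_d),$$ $$n^{-d/2}\mathcal{V}_n\to\mathcal{V}(\Sigma^{1/2}h_d)=v_d\sqrt{\det\Sigma}.$$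
   Context: $\operatorname{hull}$ is the convex hull. $b_d$ is standard $d$-dimensional Brownian motion started at $0$ with continuous paths, $b_d[0,1]:=\{b_d(t):t\in[0,1]\}$, and $\Sigma^{1/2}$ is the nonnegative-definite symmetric square root of $\Sigma$, acting on sets pointwise. For a convex compact set $A\subset\mathbb{R}^d$ containing $0$: the support function is $h_A(x):=\sup_{y\in A}(x\cdot y)$; the mean width is $\mathcal{W}(A):=\int_{\mathbb{S}^{d-1}}h_A(e)\,de$ (integration over the unit sphere with respect to surface measure); the volume $\mathcal{V}(A)$ is the $d$-dimensional Lebesgue measure of $A$; the surface area is $\mathcal{S}(A):=\lim_{\varepsilon\downarrow0}\big(\mathcal{V}(A^{\varepsilon})-\mathcal{V}(A)\big)/\varepsilon$, where $A^{\varepsilon}:=\{x\in\mathbb{R}^d:\inf_{y\in A}\|x-y\|\le\varepsilon\}$ (the limit exists by the Steiner formula). *)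

theory Defs
  imports "HOL-Probability.Probability"
begin

subsection \<open>Convex bodies\<close>

definition support_function :: "'a::euclidean_space set \<Rightarrow> 'a \<Rightarrow> real" where
  "support_function A x = (SUP y\<in>A. x \<bullet> y)"

text \<open>
  Surface measure on the unit sphere, via the cone construction: the measure of a Borel subset
  \<open>E\<close> of the sphere is \<open>d\<close> times the volume of \<open>{r *\<^sub>R e | r e. 0 < r \<and> r \<le> 1 \<and> e \<in> E}\<close>. It is not
  normalised: the total mass is \<open>d\<close> times the volume of the unit ball. For \<open>d = 1\<close> it is counting
  measure on \<open>{-1, 1}\<close>.
\<close>

definition surface_measure :: "'a::euclidean_space measure" where
  "surface_measure = scale_measure (of_nat DIM('a))
     (distr (restrict_space lborel (cball 0 1 - {0})) (restrict_space borel (sphere 0 1))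
        (\<lambda>x. x /\<^sub>R norm x))"

definition mean_width :: "'a::euclidean_space set \<Rightarrow> real" where
  "mean_width A = (\<integral>e. support_function A e \<partial>surface_measure)"

definition vol :: "'a::euclidean_space set \<Rightarrow> real" where
  "vol A = measure lebesgue A"

definition surface_area :: "'a::euclidean_space set \<Rightarrow> real" where
  "surface_area A =
     Lim (at_right 0) (\<lambda>\<epsilon>. (vol {x. infdist x A \<le> \<epsilon>} - vol A) / \<epsilon>)"

subsection \<open>Matrices\<close>

definition psd_sqrt :: "real^'n^'n \<Rightarrow> real^'n^'n" where
  "psd_sqrt A =
     (THE B. transpose B = B \<and> (\<forall>x. 0 \<le> x \<bullet> (B *v x)) \<and> B ** B = A)"

subsection \<open>Probability\<close>

text \<open>The expectation of the matrix \<open>X X\<^sup>T\<close>, entrywise.\<close>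

definition second_moment_matrix :: "'a measure \<Rightarrow> ('a \<Rightarrow> real^'n) \<Rightarrow> real^'n^'n" where
  "second_moment_matrix M X = (\<chi> i j. \<integral>\<omega>. X \<omega> $ i * X \<omega> $ j \<partial>M)"

text \<open>
  Standard Brownian motion started at 0, with every path continuous. Only times \<open>t \<ge> 0\<close> matter.
  The stated density of an increment is that of the centred Gaussian law with covariance
  matrix \<open>(t - s) *\<^sub>R mat 1\<close>; the second argument of \<^const>\<open>normal_density\<close> is the standard deviation.
\<close>

definition standard_brownian_motion :: "'b measure \<Rightarrow> (real \<Rightarrow> 'b \<Rightarrow> real^'n) \<Rightarrow> bool" where
  "standard_brownian_motion N b \<longleftrightarrow>
     prob_space N \<and>
     (\<forall>t\<ge>0. b t \<in> borel_measurable N) \<and>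
     (\<forall>\<omega>\<in>space N. b 0 \<omega> = 0) \<and>
     (\<forall>\<omega>\<in>space N. continuous_on {0..} (\<lambda>t. b t \<omega>)) \<and>
     (\<forall>s t. 0 \<le> s \<and> s < t \<longrightarrow>
        distributed N lborel (\<lambda>\<omega>. b t \<omega> - b s \<omega>)
          (\<lambda>x. ennreal (\<Prod>i\<in>UNIV. normal_density 0 (sqrt (t - s)) (x $ i)))) \<and>
     (\<forall>(t :: nat \<Rightarrow> real) k. 0 \<le> t 0 \<and> (\<forall>i<k. t i \<le> t (Suc i)) \<longrightarrow>
        prob_space.indep_vars N (\<lambda>_. borel) (\<lambda>i \<omega>. b (t (Suc i)) \<omega> - b (t i) \<omega>) {..<k})"

text \<open>
  Measurability is part of the definition because \<^const>\<open>distr\<close> is meaningless for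
  non-measurable functions.
\<close>

definition converges_in_distribution ::
    "'a measure \<Rightarrow> (nat \<Rightarrow> 'a \<Rightarrow> real) \<Rightarrow> 'b measure \<Rightarrow> ('b \<Rightarrow> real) \<Rightarrow> bool" where
  "converges_in_distribution M X N Y \<longleftrightarrow>
     (\<forall>n. X n \<in> borel_measurable M) \<and> Y \<in> borel_measurable N \<and>
     weak_conv_m (\<lambda>n. distr M borel (X n)) (distr N borel Y)"

text \<open>
  In the sequence \<open>\<xi>\<close>, the steps of the walk are \<open>\<xi> 1, \<xi> 2, \<dots>\<close>, while \<open>\<xi> 0\<close> is the generic copy
  of the step, from which mean and covariance are computed.
\<close>

definition partial_sum :: "(nat \<Rightarrow> 'a \<Rightarrow> real^'n) \<Rightarrow> nat \<Rightarrow> 'a \<Rightarrow> real^'n" where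
  "partial_sum \<xi> n \<omega> = (\<Sum>i=1..n. \<xi> i \<omega>)"

definition walk_hull :: "(nat \<Rightarrow> 'a \<Rightarrow> real^'n) \<Rightarrow> nat \<Rightarrow> 'a \<Rightarrow> (real^'n) set" where
  "walk_hull \<xi> n \<omega> = convex hull ((\<lambda>k. partial_sum \<xi> k \<omega>) ` {0..n})"

definition brownian_hull :: "(real \<Rightarrow> 'b \<Rightarrow> real^'n) \<Rightarrow> 'b \<Rightarrow> (real^'n) set" where
  "brownian_hull b \<omega> = convex hull ((\<lambda>t. b t \<omega>) ` {0..1})"

end

theory Submission
  imports Defs
begin

text \<open>
  Adding a segment to a convex body changes the volume affinely in the length of the segment. Hence
  the volume of \<open>K + t Z\<close> is a polynomial in \<open>t\<close> for every zonotope \<open>Z\<close>, with increments that are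
  monotone in \<open>K\<close>, which gives a modulus of continuity of the volume in the Hausdorff metric. The ball
  is a limit of zonotopes, whence Steiner's formula; by interpolation the surface area is a linear
  combination of volumes of parallel bodies, so it is continuous as well.

  All three functionals are homogeneous and uniformly continuous on bounded families of convex
  bodies. So it suffices to sample the walk and the Brownian motion at \<open>m\<close> equidistant times, where
  the multidimensional central limit theorem (through smoothing by a small Gaussian) applies to the
  independent block increments; Ottaviani's inequality controls the walk between the sampling times.
\<close>

text \<open>Neither the space of convex bodies nor the space of paths carries a topology or a
  sigma-algebra here. Continuity of a functional is an \<epsilon>-\<delta> statement, uniform over
  the bodies in a fixed ball, and hull functionals enter only as real random variables: functions of
  finitely many random vectors, or pointwise limits of such.

  Interpolation needs a number of nodes that does not grow along the zonotopes approximating the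
  ball. The recursion over segments bounds the degree of the volume polynomial only by the number of
  segments; the growth of the volume at infinity bounds it by the dimension.

  \<open>\<Sigma>\<close> may be singular, so the Gaussian limit need not have a density. A small
  independent Gaussian supplies densities, which are expressed by characteristic functions and
  compared in L1.

  Chebyshev's inequality bounds the tail of one of m blocks only by a constant times 1/m, so a union
  bound over the blocks gains nothing. The second moment of the limit law improves this to o(1/m),
  which is why m is fixed before n tends to infinity.\<close>

section \<open>Lebesgue measure under linear maps\<close>

lemma measure_linear_image_shear:
  fixes S :: "(real^'n) set"
  assumes mn: "m \<noteq> n" and S: "S \<in> lmeasurable"
  defines "h \<equiv> \<lambda>v::real^'n. \<chi> i. if i = m then v $ m + v $ n else v $ i"
  shows "h ` S \<in> lmeasurable \<and> measure lebesgue (h ` S) = measure lebesgue S"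
proof -
  have lin: "linear h"
    unfolding h_def by (rule linearI) (auto simp: algebra_simps vec_eq_iff)
  have im: "measure lebesgue (h ` cbox a b) = 1 * measure lebesgue (cbox a b)" for a b
  proof (cases "cbox a b = {}")
    case False
    \<comment> \<open>\<open>measure_shear_interval\<close> wants the lower bound of the
      \<open>n\<close>-th coordinate to be nonnegative; this translation moves it to 0.\<close>
    define v where "v = - (a $ n) *\<^sub>R axis n (1::real)"
    have "measure lebesgue (h ` cbox a b) = measure lebesgue ((+) (h v) ` h ` cbox a b)"
      by (simp add: measure_translation)
    also have "(+) (h v) ` h ` cbox a b = h ` cbox (v + a) (v + b)"
      by (subst cbox_translation) (simp add: image_image linear_add[OF lin])
    also have "measure lebesgue \<dots> = measure lebesgue (cbox (v + a) (v + b))"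
      unfolding h_def using mn False
      by (intro measure_shear_interval) (simp_all add: cbox_translation, simp add: v_def)
    also have "\<dots> = measure lebesgue (cbox a b)"
      unfolding cbox_translation by (rule measure_translation)
    finally show ?thesis by simp
  qed simp
  show ?thesis
    using measure_linear_sufficient[OF lin S im] by simp
qed

lemma measure_linear_image_swap:
  fixes S :: "(real^'n) set" and m n :: 'n
  assumes S: "S \<in> lmeasurable"
  defines "h \<equiv> \<lambda>v::real^'n. \<chi> i. v $ Transposition.transpose m n i"
  shows "h ` S \<in> lmeasurable \<and> measure lebesgue (h ` S) = measure lebesgue S"
proof -
  have lin: "linear h"
    unfolding h_def by (rule linearI) (auto simp: algebra_simps vec_eq_iff)
  have hh: "h (h v) = v" for v by (simp add: h_def vec_eq_iff)
  have im: "measure lebesgue (h ` cbox a b) = 1 * measure lebesgue (cbox a b)" for a b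
  proof -
    have "h v \<in> cbox (h a) (h b)" if "v \<in> cbox a b" for v a b
      using that by (auto simp: h_def mem_box_cart)
    then have eq: "h ` cbox a b = cbox (h a) (h b)"
      by (smt (verit, ccfv_threshold) hh image_iff subset_antisym subsetI)
    \<comment> \<open>Swapping two coordinates permutes the side lengths of the box.\<close>
    have "(\<Prod>i\<in>UNIV. h b $ i - h a $ i) = (\<Prod>i\<in>UNIV. b $ i - a $ i)"
      using prod.permute[OF permutes_swap_id[of m UNIV n], of "\<lambda>i. b $ i - a $ i"]
      by (simp add: h_def o_def)
    moreover have "cbox (h a) (h b) = {} \<longleftrightarrow> cbox a b = {}"
      using eq by auto
    ultimately show ?thesis
      unfolding eq by (simp add: content_cbox_if_cart)
  qed
  show ?thesis
    using measure_linear_sufficient[OF lin S im] by simp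
qed

lemma det_matrix_shear:
  assumes "m \<noteq> (n::'n::finite)"
  shows "det (matrix (\<lambda>v::real^'n. \<chi> i. if i = m then v $ m + v $ n else v $ i)) = 1"
proof -
  have "matrix (\<lambda>v::real^'n. \<chi> i. if i = m then v $ m + v $ n else v $ i) =
        (\<chi> k. if k = m then row m (mat 1) + 1 *s row n (mat 1) else row k (mat 1))"
    by (auto simp: matrix_def vec_eq_iff row_def mat_def axis_def)
  then show ?thesis
    using det_row_operation[OF assms, of "mat 1" "1::real"] by simp
qed

text \<open>The library has these two facts only for well-ordered index types.\<close>

proposition
  fixes f :: "real^'n \<Rightarrow> real^'n"
  assumes "linear f" "S \<in> lmeasurable"
  shows lmeasurable_linear_image_cart: "f ` S \<in> lmeasurable"
    and measure_linear_image_cart: "measure lebesgue (f ` S) = \<bar>det (matrix f)\<bar> * measure lebesgue S"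
proof -
  define P where "P f \<longleftrightarrow> (\<forall>S\<in>lmeasurable. f ` S \<in> lmeasurable \<and>
      measure lebesgue (f ` S) = \<bar>det (matrix f)\<bar> * measure lebesgue S)" for f :: "real^'n \<Rightarrow> real^'n"
  have "P f"
  \<comment> \<open>Every linear map is composed of maps with a vanishing coordinate, diagonal maps,
    swaps and shears. The formula survives composition because determinants multiply.\<close>
  proof (rule induct_linear_elementary[OF \<open>linear f\<close>])
    fix f g :: "real^'n \<Rightarrow> real^'n" assume *: "linear f" "linear g" "P f" "P g"
    show "P (f \<circ> g)"
      unfolding P_def
    proof
      fix S :: "(real^'n) set" assume S: "S \<in> lmeasurable"
      then have "g ` S \<in> lmeasurable" using * by (auto simp: P_def)
      then show "(f \<circ> g) ` S \<in> lmeasurable \<and>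
          measure lebesgue ((f \<circ> g) ` S) = \<bar>det (matrix (f \<circ> g))\<bar> * measure lebesgue S"
        using * S by (simp add: P_def image_comp[symmetric] matrix_compose det_mul abs_mult del: o_apply)
    qed
  next
    fix f :: "real^'n \<Rightarrow> real^'n" and i assume f: "linear f" and z: "\<And>x. f x $ i = 0"
    \<comment> \<open>A map with a vanishing coordinate misses an axis vector. So it is singular,
      and both sides of the formula are 0.\<close>
    have "\<not> surj f"
    proof
      assume "surj f"
      then obtain x where "f x = axis i 1" by (metis surjD)
      then show False using z[of x] by simp
    qed
    then have inj: "\<not> inj f" using linear_injective_imp_surjective[OF f] by blast
    then have d: "det (matrix f) = 0" using det_nz_iff_inj[OF f] by blast
    have "negligible (f ` S)" for S using negligible_linear_singular_image[OF f inj] .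
    then show "P f"
      using d by (auto simp: P_def negligible_imp_measurable negligible_imp_measure0)
  next
    fix c :: "'n \<Rightarrow> real"
    have "det (matrix (\<lambda>x::real^'n. \<chi> i. c i * x $ i)) = prod c UNIV"
      by (subst det_diagonal) (auto simp: matrix_def axis_def)
    then show "P (\<lambda>x. \<chi> i. c i * x $ i)"
      by (simp add: P_def measurable_stretch measure_stretch)
  next
    fix m n :: 'n assume "m \<noteq> n"
    let ?h = "\<lambda>v::real^'n. \<chi> i. v $ Transposition.transpose m n i"
    have "matrix ?h = (\<chi> i. (mat 1 :: real^'n^'n) $ Transposition.transpose m n i)"
      by (auto simp: matrix_def vec_eq_iff mat_def axis_def)
    then have "\<bar>det (matrix ?h)\<bar> = 1"
      using det_permute_rows[OF permutes_swap_id[of m UNIV n], of "mat 1 :: real^'n^'n"]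
      by (simp add: sign_swap_id abs_mult)
    then show "P ?h"
      using measure_linear_image_swap by (auto simp: P_def)
  next
    fix m n :: 'n assume "m \<noteq> n"
    then show "P (\<lambda>x. \<chi> i. if i = m then x $ m + x $ n else x $ i)"
      using measure_linear_image_shear by (auto simp: P_def det_matrix_shear)
  qed
  then show "f ` S \<in> lmeasurable" "measure lebesgue (f ` S) = \<bar>det (matrix f)\<bar> * measure lebesgue S"
    using assms by (auto simp: P_def)
qed

section \<open>Minkowski sums and volume\<close>

lemma compact_set_plus:
  fixes A B :: "'a::real_normed_vector set"
  assumes "compact A" "compact B"
  shows "compact (A + B)"
proof -
  have "A + B = {x + y | x y. x \<in> A \<and> y \<in> B}" by (auto simp: set_plus_def)
  then show ?thesis using compact_sums[OF assms] by simp
qed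

lemma set_plus_0_right [simp]: "A + {0::'a::monoid_add} = A"
  by (auto simp: set_plus_def)

lemma mem_plus_segment_iff:
  "x \<in> K + (\<lambda>r. r *\<^sub>R u) ` {a..b} \<longleftrightarrow> (\<exists>k r. k \<in> K \<and> a \<le> r \<and> r \<le> b \<and> x = k + r *\<^sub>R u)"
  by (force simp: set_plus_def)

lemma vol_nonneg: "0 \<le> vol A"
  by (simp add: vol_def)

lemma vol_mono: "A \<subseteq> B \<Longrightarrow> compact A \<Longrightarrow> compact B \<Longrightarrow> vol A \<le> vol B"
  unfolding vol_def by (rule measure_mono_fmeasurable) (auto intro: lmeasurable_compact fmeasurableD)

lemma vol_translation: "vol ((+) a ` A) = vol A"
  unfolding vol_def by (rule measure_translation)

lemma vol_scaleR: "0 \<le> c \<Longrightarrow> vol ((*\<^sub>R) c ` A) = c ^ DIM('a) * vol (A :: 'a::euclidean_space set)"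
  using measure_lebesgue_affine[of c 0 A] by (simp add: vol_def)

lemma vol_cball:
  assumes "0 \<le> r"
  shows "vol (cball 0 r :: 'a::euclidean_space set) = r ^ DIM('a) * vol (cball 0 1 :: 'a set)"
proof -
  have "(*\<^sub>R) r ` cball 0 1 = (cball 0 r :: 'a set)"
    using cball_scale[of r "0::'a" 1] assms by (cases "r = 0") (auto simp: image_constant_conv)
  then show ?thesis using vol_scaleR[OF assms, of "cball 0 1 :: 'a set"] by simp
qed

text \<open>Cauchy's functional equation, with monotonicity in place of continuity:
  \<open>real n * t\<close> lies between integers \<open>m\<close> and \<open>m + 1\<close>, so
  \<open>n * g t\<close> and \<open>n * t * g 1\<close> both lie between \<open>m * g 1\<close> and
  \<open>(m + 1) * g 1\<close>. They differ by at most \<open>g 1\<close> for every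
  \<open>n\<close>, which forces \<open>g t = t * g 1\<close>.\<close>

lemma additive_mono_imp_linear:
  fixes g :: "real \<Rightarrow> real"
  assumes add: "\<And>s t. 0 \<le> s \<Longrightarrow> 0 \<le> t \<Longrightarrow> g (s + t) = g s + g t"
    and mono: "\<And>s t. 0 \<le> s \<Longrightarrow> s \<le> t \<Longrightarrow> g s \<le> g t" and t: "0 \<le> t"
  shows "g t = t * g 1"
proof -
  have g0: "g 0 = 0" using add[of 0 0] by simp
  have mult: "g (real n * x) = real n * g x" if "0 \<le> x" for n x
    using that by (induction n) (auto simp: g0 add algebra_simps)
  have bound: "real n * \<bar>g t - t * g 1\<bar> \<le> g 1" for n
  proof -
    define m where "m = nat \<lfloor>real n * t\<rfloor>"
    have m: "real m \<le> real n * t" "real n * t \<le> real (Suc m)"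
      using t by (auto simp: m_def) linarith+
    have "real m * g 1 \<le> real n * g t" "real n * g t \<le> real (Suc m) * g 1"
      using mono[OF _ m(1)] mono[OF _ m(2)] mult[of 1 m] mult[of 1 "Suc m"] mult[OF t, of n] t by auto
    moreover have "real m * g 1 \<le> real n * t * g 1" "real n * t * g 1 \<le> real (Suc m) * g 1"
      using m mono[of 0 1] g0 by (auto intro!: mult_right_mono)
    ultimately have "\<bar>real n * g t - real n * t * g 1\<bar> \<le> g 1"
      by (simp add: algebra_simps abs_le_iff)
    moreover have "\<bar>real n * g t - real n * t * g 1\<bar> = real n * \<bar>g t - t * g 1\<bar>"
      by (metis abs_mult abs_of_nat mult.assoc right_diff_distrib)
    ultimately show ?thesis by simp
  qed
  have "\<bar>g t - t * g 1\<bar> \<le> 0"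
  proof (rule ccontr)
    assume "\<not> ?thesis"
    then obtain n where "real n * \<bar>g t - t * g 1\<bar> > g 1"
      using ex_less_of_nat_mult[of "\<bar>g t - t * g 1\<bar>"] by auto
    with bound[of n] show False by simp
  qed
  then show ?thesis by simp
qed

subsection \<open>Zonotopes\<close>

text \<open>Centred at 0, so that zonotopes are symmetric about the origin like the ball that they
  are to approximate; \<open>t\<close> is the half-length in units of \<open>u\<close>.\<close>

definition symseg :: "real \<Rightarrow> 'a::real_vector \<Rightarrow> 'a set" where
  "symseg t u = (\<lambda>r. r *\<^sub>R u) ` {-t..t}"

text \<open>One parameter dilates all generators at once. For \<open>t \<ge> 0\<close> the support
  function at \<open>x\<close> is
  \<open>t * (\<Sum>u\<leftarrow>us. \<bar>x \<bullet> u\<bar>)\<close>, which links zonotopes to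
  sums of absolute inner products.\<close>

definition zonotope :: "real \<Rightarrow> 'a::real_vector list \<Rightarrow> 'a set" where
  "zonotope t us = (\<Sum>u\<leftarrow>us. symseg t u)"

lemma zonotope_Nil [simp]: "zonotope t [] = {0}"
  by (simp add: zonotope_def)

lemma zonotope_Cons [simp]: "zonotope t (u # us) = symseg t u + zonotope t us"
  by (simp add: zonotope_def)

lemma compact_symseg: "compact (symseg t (u::'a::real_normed_vector))"
  unfolding symseg_def by (intro compact_continuous_image continuous_intros) auto

lemma convex_symseg: "convex (symseg t u)"
  unfolding symseg_def by (intro convex_linear_image) (auto intro: linearI scaleR_add_left)

lemma compact_zonotope: "compact (zonotope t (us::'a::real_normed_vector list))"
  by (induction us) (auto intro: compact_set_plus compact_symseg)

lemma convex_zonotope: "convex (zonotope t us)"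
  by (induction us) (auto intro: convex_set_plus convex_symseg)

lemma symseg_0 [simp]: "symseg 0 u = {0}"
  by (auto simp: symseg_def)

lemma zonotope_0 [simp]: "zonotope 0 us = {0}"
  by (induction us) auto

lemma zonotope_subset_cball:
  assumes "0 \<le> t"
  shows "zonotope t us \<subseteq> cball 0 (t * (\<Sum>u\<leftarrow>us. norm (u::'a::real_normed_vector)))"
proof (induction us)
  case (Cons u us)
  show ?case
  proof
    fix x assume "x \<in> zonotope t (u # us)"
    then obtain r z where x: "x = r *\<^sub>R u + z" "\<bar>r\<bar> \<le> t" "z \<in> zonotope t us"
      by (auto simp: set_plus_def symseg_def abs_le_iff)
    then have "norm z \<le> t * (\<Sum>u\<leftarrow>us. norm u)" using Cons by auto
    moreover have "norm (r *\<^sub>R u) \<le> t * norm u" using x(2) by (simp add: mult_right_mono)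
    ultimately show "x \<in> cball 0 (t * (\<Sum>u\<leftarrow>u # us. norm u))"
      using norm_triangle_ineq[of "r *\<^sub>R u" z] by (simp add: x(1) distrib_left)
  qed
qed simp

text \<open>Growing a convex body by a further piece of a segment adds a translate of what the first
  piece added; so the volume is affine in the length of the segment.\<close>

lemma set_plus_segment_Diff:
  fixes K :: "'a::real_normed_vector set"
  assumes K: "convex K" and st: "0 \<le> s" "0 \<le> t"
  defines "seg \<equiv> \<lambda>t u. (\<lambda>r. r *\<^sub>R u) ` {0..t}"
  shows "(K + seg (s + t) u) - (K + seg t u) = (+) (t *\<^sub>R u) ` ((K + seg s u) - K)" (is "?L = ?R")
proof (intro set_eqI iffI)
  fix x assume x: "x \<in> ?L"
  then have "x \<in> K + seg (s + t) u" by simp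
  then obtain k r where r: "k \<in> K" "x = k + r *\<^sub>R u" "0 \<le> r" "r \<le> s + t"
    unfolding seg_def mem_plus_segment_iff by blast
  have "t < r"
  proof (rule ccontr)
    assume "\<not> t < r"
    then have "x \<in> K + seg t u" unfolding seg_def mem_plus_segment_iff using r by (intro exI[of _ k] exI[of _ r]) auto
    with x show False by simp
  qed
  \<comment> \<open>Since \<open>x\<close> uses more than \<open>t\<close> of the segment, sliding
    back by \<open>t *\<^sub>R u\<close> stays in \<open>K + seg s u\<close>; landing in
    \<open>K\<close> itself would put \<open>x\<close> into \<open>K + seg t u\<close>.\<close>
  define y where "y = k + (r - t) *\<^sub>R u"
  have xy: "x = t *\<^sub>R u + y" by (simp add: y_def r algebra_simps)
  have "y \<in> K + seg s u"
    unfolding seg_def mem_plus_segment_iff using r \<open>t < r\<close>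
    by (intro exI[of _ k] exI[of _ "r - t"]) (auto simp: y_def)
  moreover have "y \<notin> K"
  proof
    assume "y \<in> K"
    then have "x \<in> K + seg t u"
      unfolding seg_def mem_plus_segment_iff using st
      by (intro exI[of _ y] exI[of _ t]) (auto simp: xy)
    with x show False by simp
  qed
  ultimately show "x \<in> ?R" using xy by auto
next
  fix x assume "x \<in> ?R"
  then obtain y where y: "x = t *\<^sub>R u + y" "y \<in> K + seg s u" "y \<notin> K" by blast
  then obtain k r where kr: "k \<in> K" "y = k + r *\<^sub>R u" "0 \<le> r" "r \<le> s"
    unfolding seg_def mem_plus_segment_iff by blast
  have r: "k \<in> K" "x = t *\<^sub>R u + (k + r *\<^sub>R u)" "0 \<le> r" "r \<le> s" and notin: "k + r *\<^sub>R u \<notin> K"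
    using y kr by auto
  have "x = k + (r + t) *\<^sub>R u" by (simp add: r algebra_simps)
  then have 1: "x \<in> K + seg (s + t) u"
    unfolding seg_def mem_plus_segment_iff using r st
    by (intro exI[of _ k] exI[of _ "r + t"]) auto
  have "x \<notin> K + seg t u"
  proof
    assume "x \<in> K + seg t u"
    then obtain k' r' where r': "k' \<in> K" "x = k' + r' *\<^sub>R u" "0 \<le> r'" "r' \<le> t"
      unfolding seg_def mem_plus_segment_iff by blast
    have k': "k' = k + (t + r - r') *\<^sub>R u" using r(2) r'(2) by (simp add: algebra_simps)
    show False
    proof (cases "t + r - r' = 0")
      case True
      then have "r = 0" using r r' by simp
      then show False using notin r by simp
    next
      case False
      then have p: "t + r - r' > 0" using r r' by simp
      \<comment> \<open>\<open>k + r *\<^sub>R u\<close> lies on the line segment from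
        \<open>k\<close> to \<open>k'\<close>, because \<open>r' \<le> t\<close> gives
        \<open>r \<le> t + r - r'\<close>. Convexity then puts it into \<open>K\<close>, which was
        excluded.\<close>
      define w where "w = r / (t + r - r')"
      have l: "0 \<le> w" "w \<le> 1" using p r r' by (auto simp: w_def field_simps)
      have "(1 - w) *\<^sub>R k + w *\<^sub>R k' = k + (w * (t + r - r')) *\<^sub>R u"
        by (simp add: k' algebra_simps)
      also have "\<dots> = k + r *\<^sub>R u" using p by (simp add: w_def)
      finally show False
        using notin convexD_alt[OF K r(1) r'(1) l] by simp
    qed
  qed
  with 1 show "x \<in> ?L" by simp
qed

text \<open>The gain in volume \<open>g\<close> is additive in the length by
  \<open>set_plus_segment_Diff\<close> and translation invariance, and monotone by inclusion, hence
  linear. A symmetric segment of half-length \<open>t\<close> is a translate of the one-sided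
  segment of length \<open>2 * t\<close>.\<close>

lemma vol_plus_symseg:
  fixes K :: "'a::euclidean_space set"
  assumes K: "compact K" "convex K" and t: "0 \<le> t"
  shows "vol (K + symseg t u) = vol K + t * (vol (K + symseg 1 u) - vol K)"
proof -
  define seg where "seg t = (\<lambda>r. r *\<^sub>R u) ` {0..t}" for t
  have cseg: "compact (seg t)" for t
    unfolding seg_def by (intro compact_continuous_image continuous_intros) auto
  have cK: "compact (K + seg t)" for t using K cseg compact_set_plus by blast
  define g where "g t = vol (K + seg t) - vol K" for t
  have sub: "K + seg s \<subseteq> K + seg t" if "s \<le> t" for s t
    using that by (intro set_plus_mono2) (auto simp: seg_def)
  have add: "g (s + t) = g s + g t" if st: "0 \<le> s" "0 \<le> t" for s t
  proof -
    have K0: "K \<subseteq> K + seg s" using st by (force simp: set_plus_def seg_def)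
    have "vol (K + seg (s + t)) - vol (K + seg t) = measure lebesgue ((K + seg (s + t)) - (K + seg t))"
      unfolding vol_def using st
      by (intro measurable_measure_Diff[symmetric] sub fmeasurableD lmeasurable_compact cK) auto
    also have "\<dots> = measure lebesgue ((K + seg s) - K)"
      unfolding seg_def set_plus_segment_Diff[OF K(2) st] by (rule measure_translation)
    also have "\<dots> = vol (K + seg s) - vol K"
      unfolding vol_def by (intro measurable_measure_Diff K0 fmeasurableD lmeasurable_compact cK K)
    finally show ?thesis by (simp add: g_def)
  qed
  have lin: "g t = t * g 1" if "0 \<le> t" for t
    by (rule additive_mono_imp_linear[where g = g, OF add _ that]) (simp_all add: g_def vol_mono[OF sub cK cK])
  have g: "g (2 * t) = 2 * t * g 1" "g 2 = 2 * g 1" using lin[of "2 * t"] lin[of 2] t by simp_all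
  have *: "vol (K + symseg t u) = vol (K + seg (2 * t))" if "0 \<le> t" for t
  proof -
    have "K + symseg t u = (+) (- t *\<^sub>R u) ` (K + seg (2 * t))"
    proof (intro set_eqI iffI)
      fix x assume "x \<in> K + symseg t u"
      then obtain k r where *: "k \<in> K" "x = k + r *\<^sub>R u" "-t \<le> r" "r \<le> t"
        unfolding symseg_def mem_plus_segment_iff by blast
      then have "x = - t *\<^sub>R u + (k + (r + t) *\<^sub>R u)" by (simp add: algebra_simps)
      moreover have "k + (r + t) *\<^sub>R u \<in> K + seg (2 * t)"
        using * by (intro set_plus_intro) (auto simp: seg_def)
      ultimately show "x \<in> (+) (- t *\<^sub>R u) ` (K + seg (2 * t))" by blast
    next
      fix x assume "x \<in> (+) (- t *\<^sub>R u) ` (K + seg (2 * t))"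
      then obtain y where y: "x = - t *\<^sub>R u + y" "y \<in> K + seg (2 * t)" by blast
      then obtain k r where *: "k \<in> K" "y = k + r *\<^sub>R u" "0 \<le> r" "r \<le> 2 * t"
        unfolding seg_def mem_plus_segment_iff by blast
      have "x = k + (r - t) *\<^sub>R u" unfolding y * by (simp add: algebra_simps)
      moreover have "(r - t) *\<^sub>R u \<in> symseg t u" using * by (auto simp: symseg_def)
      ultimately show "x \<in> K + symseg t u" using * by (simp add: set_plus_intro)
    qed
    then show ?thesis by (simp add: vol_translation del: scaleR_minus_left)
  qed
  have "vol (K + symseg t u) = vol K + g (2 * t)" "vol (K + symseg 1 u) = vol K + g 2"
    using *[OF t] *[of 1] by (auto simp: g_def)
  then show ?thesis using g by simp
qed

text \<open>\<open>K\<close> is arbitrary in the induction because the slope along the next segment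
  is a difference of two volumes, one of which has \<open>K + symseg 1 u\<close> in place of
  \<open>K\<close>.\<close>

lemma poly_vol_plus_zonotope:
  fixes K :: "'a::euclidean_space set"
  assumes "compact K" "convex K"
  shows "\<exists>p. \<forall>t\<ge>0. vol (K + zonotope t us) = poly p t"
  using assms
proof (induction us arbitrary: K)
  case Nil
  then show ?case by (auto intro!: exI[of _ "[:vol K:]"])
next
  case (Cons u us)
  obtain p where p: "\<And>t. t \<ge> 0 \<Longrightarrow> vol (K + zonotope t us) = poly p t"
    using Cons by meson
  obtain q where q: "\<And>t. t \<ge> 0 \<Longrightarrow> vol ((K + symseg 1 u) + zonotope t us) = poly q t"
    using Cons.IH[of "K + symseg 1 u"] Cons.prems
    by (meson compact_set_plus compact_symseg convex_set_plus convex_symseg)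
  have "vol (K + zonotope t (u # us)) = poly (p + [:0, 1:] * (q - p)) t" if "t \<ge> 0" for t
  proof -
    have "vol (K + zonotope t (u # us)) = vol ((K + zonotope t us) + symseg t u)"
      by (simp add: ac_simps)
    also have "\<dots> = vol (K + zonotope t us) +
        t * (vol ((K + zonotope t us) + symseg 1 u) - vol (K + zonotope t us))"
      using Cons.prems that
      by (intro vol_plus_symseg compact_set_plus convex_set_plus compact_zonotope convex_zonotope)
    also have "(K + zonotope t us) + symseg 1 u = (K + symseg 1 u) + zonotope t us"
      by (simp add: ac_simps)
    finally show ?thesis using p[OF that] q[OF that] by simp
  qed
  then show ?case by blast
qed

text \<open>Divided by \<open>t ^ degree p\<close>, the polynomial tends to its leading coefficient;
  if the degree exceeded \<open>d\<close>, the growth bound would force this limit to be 0.\<close>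

lemma degree_le_of_growth:
  fixes p :: "real poly"
  assumes "\<And>t. t \<ge> 0 \<Longrightarrow> \<bar>poly p t\<bar> \<le> C * (1 + t) ^ d"
  shows "degree p \<le> d"
proof (rule ccontr)
  assume "\<not> degree p \<le> d"
  then have deg: "d < degree p" by simp
  have "((\<lambda>t. poly p t / t ^ degree p) \<longlongrightarrow> lead_coeff p) at_top"
    using poly_divide_tendsto_aux[of p] at_top_le_at_infinity tendsto_mono by blast
  moreover have "((\<lambda>t. poly p t / t ^ degree p) \<longlongrightarrow> 0) at_top"
  proof (rule Lim_null_comparison)
    show "\<forall>\<^sub>F t in at_top. norm (poly p t / t ^ degree p) \<le> (\<bar>C\<bar> * 2 ^ d) * (1 / t)"
      using eventually_ge_at_top[of 1]
    proof eventually_elim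
      case (elim t)
      have "\<bar>poly p t\<bar> \<le> \<bar>C\<bar> * (1 + t) ^ d"
        using assms[of t] elim
        by (smt (verit) mult_right_mono zero_le_power abs_ge_self)
      also have "\<dots> \<le> \<bar>C\<bar> * (2 * t) ^ d"
        using elim by (intro mult_left_mono power_mono) auto
      also have "\<dots> = \<bar>C\<bar> * 2 ^ d * t ^ d" by (simp add: power_mult_distrib)
      finally have "\<bar>poly p t\<bar> * t \<le> \<bar>C\<bar> * 2 ^ d * t ^ Suc d"
        using elim by (simp add: mult.assoc mult_right_mono)
      also have "\<dots> \<le> \<bar>C\<bar> * 2 ^ d * t ^ degree p"
        using elim deg by (intro mult_left_mono power_increasing) auto
      finally show ?case using elim by (simp add: field_simps)
    qed
    have "((\<lambda>t::real. 1 / t) \<longlongrightarrow> 0) at_top"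
      using tendsto_inverse_0_at_top[OF filterlim_ident] by (simp add: inverse_eq_divide)
    from tendsto_mult_left[OF this, of "\<bar>C\<bar> * 2 ^ d"]
    show "((\<lambda>t. (\<bar>C\<bar> * 2 ^ d) * (1 / t)) \<longlongrightarrow> 0) at_top" by simp
  qed
  ultimately have "lead_coeff p = 0" using tendsto_unique by force
  then show False using deg by simp
qed

text \<open>Inclusion in a ball of radius \<open>(1 + t) * L\<close> limits the growth in
  \<open>t\<close>, so the bound on the degree is the same for all lists of generators.\<close>

lemma poly_vol_plus_zonotope_degree:
  fixes K :: "'a::euclidean_space set"
  assumes K: "compact K" "convex K"
  shows "\<exists>p. degree p \<le> DIM('a) \<and> (\<forall>t\<ge>0. vol (K + zonotope t us) = poly p t)"
proof -
  obtain p where p: "\<And>t. t \<ge> 0 \<Longrightarrow> vol (K + zonotope t us) = poly p t"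
    using poly_vol_plus_zonotope[OF K] by blast
  obtain R where R: "R > 0" "\<And>x. x \<in> K \<Longrightarrow> norm x \<le> R"
    using compact_imp_bounded[OF K(1)] unfolding bounded_pos by blast
  define L where "L = R + (\<Sum>u\<leftarrow>us. norm u)"
  have L: "R \<le> L" "(\<Sum>u\<leftarrow>us. norm u) \<le> L" "0 < L"
    using R(1) sum_list_nonneg[of "map norm us"] unfolding L_def by force+
  have "\<bar>poly p t\<bar> \<le> (L ^ DIM('a) * vol (cball 0 1 :: 'a set)) * (1 + t) ^ DIM('a)" if t: "t \<ge> 0" for t
  proof -
    have "K + zonotope t us \<subseteq> cball 0 ((1 + t) * L)"
    proof
      fix x assume "x \<in> K + zonotope t us"
      then obtain k z where x: "x = k + z" "k \<in> K" "z \<in> zonotope t us" by (meson set_plus_elim)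
      have "norm z \<le> t * (\<Sum>u\<leftarrow>us. norm u)" using zonotope_subset_cball[OF t, of us] x by auto
      also have "\<dots> \<le> t * L" using L t by (simp add: mult_left_mono)
      finally have "norm x \<le> L + t * L"
        using x R(2)[of k] L norm_triangle_ineq[of k z] by simp
      then show "x \<in> cball 0 ((1 + t) * L)" by (simp add: algebra_simps)
    qed
    then have "vol (K + zonotope t us) \<le> vol (cball 0 ((1 + t) * L) :: 'a set)"
      by (intro vol_mono compact_set_plus K compact_zonotope) auto
    also have "\<dots> = (L ^ DIM('a) * vol (cball 0 1 :: 'a set)) * (1 + t) ^ DIM('a)"
      using t L by (subst vol_cball) (auto simp: power_mult_distrib)
    finally show ?thesis using p[OF t] vol_nonneg[of "K + zonotope t us"] by simp
  qed
  then have "degree p \<le> DIM('a)" by (rule degree_le_of_growth)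
  then show ?thesis using p by blast
qed

text \<open>Along one segment both volumes are affine in its length, and
  \<open>A + symseg s u \<subseteq> B + symseg s u\<close> for every \<open>s \<ge> 0\<close>; a
  larger slope for \<open>A\<close> would violate this for large \<open>s\<close>. The zonotope is
  then built up segment by segment.\<close>

lemma vol_plus_zonotope_diff_mono:
  fixes A B :: "'a::euclidean_space set"
  assumes "compact A" "convex A" "compact B" "convex B" "A \<subseteq> B" and t: "0 \<le> t"
  shows "vol (A + zonotope t us) - vol A \<le> vol (B + zonotope t us) - vol B"
proof (induction us)
  case Nil then show ?case by simp
next
  case (Cons u us)
  have *: "vol (A + symseg t u) - vol A \<le> vol (B + symseg t u) - vol B"
    if A: "compact A" "convex A" and B: "compact B" "convex B" and AB: "A \<subseteq> B" for A B :: "'a set"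
  proof -
    define a b where "a = vol (A + symseg 1 u) - vol A" and "b = vol (B + symseg 1 u) - vol B"
    have le: "vol A + s * a \<le> vol B + s * b" if "s \<ge> 0" for s
    proof -
      have "vol (A + symseg s u) \<le> vol (B + symseg s u)"
        using A B AB by (intro vol_mono set_plus_mono2 compact_set_plus compact_symseg) auto
      then show ?thesis using vol_plus_symseg[OF A that, of u] vol_plus_symseg[OF B that, of u]
        by (simp add: a_def b_def)
    qed
    have "a \<le> b"
    proof (rule ccontr)
      assume "\<not> a \<le> b"
      then obtain n where n: "real n * (a - b) > vol B - vol A"
        using ex_less_of_nat_mult[of "a - b" "vol B - vol A"] by auto
      then show False using le[of "real n"] by (simp add: algebra_simps)
    qed
    then show ?thesis
      using vol_plus_symseg[OF A t, of u] vol_plus_symseg[OF B t, of u] t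
      by (simp add: a_def b_def mult_left_mono)
  qed
  have "vol ((A + zonotope t us) + symseg t u) - vol (A + zonotope t us)
      \<le> vol ((B + zonotope t us) + symseg t u) - vol (B + zonotope t us)"
    using assms by (intro * compact_set_plus convex_set_plus compact_zonotope convex_zonotope set_plus_mono2) auto
  then show ?case using Cons by (simp add: ac_simps)
qed

text \<open>The zonotope of the basis vectors is the coordinate cube; this crude cover of the ball
  suffices for a modulus of continuity of the volume.\<close>

lemma cball_subset_zonotope:
  assumes bs: "set bs = (Basis::'a::euclidean_space set)" "distinct bs"
  shows "cball 0 t \<subseteq> zonotope t bs"
proof
  fix x :: 'a assume x: "x \<in> cball 0 t"
  have "(\<Sum>b\<leftarrow>cs. (x \<bullet> b) *\<^sub>R b) \<in> zonotope t cs" if "set cs \<subseteq> Basis" for cs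
    using that
  proof (induction cs)
    case (Cons c cs)
    have "\<bar>x \<bullet> c\<bar> \<le> t" using Basis_le_norm[of c x] Cons x by simp
    then have "(x \<bullet> c) *\<^sub>R c \<in> symseg t c" by (auto simp: symseg_def abs_le_iff)
    then show ?case using Cons by auto
  qed simp
  from this[of bs] bs have "(\<Sum>b\<leftarrow>bs. (x \<bullet> b) *\<^sub>R b) \<in> zonotope t bs" by simp
  moreover have "(\<Sum>b\<leftarrow>bs. (x \<bullet> b) *\<^sub>R b) = x"
    using bs by (simp add: sum_list_distinct_conv_sum_set euclidean_representation)
  ultimately show "x \<in> zonotope t bs" by simp
qed

subsection \<open>Functionals of convex bodies\<close>

text \<open>For nonempty convex bodies in the ball of radius \<open>R\<close>, the two inclusions
  with \<open>\<delta>\<close> say that the Hausdorff distance is at most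
  \<open>\<delta>\<close>.\<close>

definition bodies_close :: "real \<Rightarrow> real \<Rightarrow> 'a::euclidean_space set \<Rightarrow> 'a set \<Rightarrow> bool" where
  "bodies_close R \<delta> A B \<longleftrightarrow> compact A \<and> convex A \<and> A \<noteq> {} \<and> compact B \<and> convex B \<and> B \<noteq> {} \<and>
     A \<subseteq> cball 0 R \<and> B \<subseteq> cball 0 R \<and> A \<subseteq> B + cball 0 \<delta> \<and> B \<subseteq> A + cball 0 \<delta>"

text \<open>\<open>\<delta>\<close> depends on \<open>R\<close> and \<open>\<epsilon>\<close> only,
  never on a particular body. This gives one estimate for random bodies on the whole event that they
  stay in a fixed ball.\<close>

definition hausdorff_uniform :: "('a::euclidean_space set \<Rightarrow> real) \<Rightarrow> bool" where
  "hausdorff_uniform \<Phi> \<longleftrightarrow>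
     (\<forall>R>0. \<forall>\<epsilon>>0. \<exists>\<delta>>0. \<forall>A B. bodies_close R \<delta> A B \<longrightarrow> \<bar>\<Phi> A - \<Phi> B\<bar> \<le> \<epsilon>)"

lemma hausdorff_uniformD:
  assumes "hausdorff_uniform \<Phi>" "0 < R" "0 < \<epsilon>"
  obtains \<delta> where "\<delta> > 0" "\<And>A B. bodies_close R \<delta> A B \<Longrightarrow> \<bar>\<Phi> A - \<Phi> B\<bar> \<le> \<epsilon>"
  using assms unfolding hausdorff_uniform_def by blast

text \<open>Because increments are monotone, enlarging a body inside the ball of radius
  \<open>R\<close> by the cube of size \<open>\<delta>\<close> adds no more volume than enlarging
  that ball. The latter gain is a polynomial in \<open>\<delta>\<close> that vanishes at 0.\<close>

lemma hausdorff_uniform_vol: "hausdorff_uniform (vol :: 'a::euclidean_space set \<Rightarrow> real)"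
  unfolding hausdorff_uniform_def
proof (intro allI impI)
  fix R \<epsilon> :: real assume R: "0 < R" and e: "0 < \<epsilon>"
  obtain bs where bs: "set bs = (Basis::'a set)" "distinct bs"
    using finite_distinct_list[OF finite_Basis] by blast
  obtain p where p: "\<And>t. t \<ge> 0 \<Longrightarrow> vol (cball (0::'a) R + zonotope t bs) = poly p t"
    using poly_vol_plus_zonotope[of "cball (0::'a) R" bs] by auto
  have p0: "poly p 0 = vol (cball (0::'a) R)"
    using p[of 0] by simp
  have "isCont (poly p) 0" by simp
  then obtain d where d: "d > 0" "\<And>t. \<bar>t\<bar> < d \<Longrightarrow> \<bar>poly p t - poly p 0\<bar> < \<epsilon>"
    using e unfolding continuous_at_eps_delta by (auto simp: dist_real_def)
  define \<delta> where "\<delta> = d / 2"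
  have \<delta>: "\<delta> > 0" "poly p \<delta> - poly p 0 \<le> \<epsilon>" using d(1) d(2)[of \<delta>] by (auto simp: \<delta>_def abs_less_iff)
  have *: "vol A \<le> vol B + \<epsilon>"
    if "compact A" "compact B" "convex B" "B \<subseteq> cball 0 R" "A \<subseteq> B + cball 0 \<delta>" for A B :: "'a set"
  proof -
    have "A \<subseteq> B + zonotope \<delta> bs"
      using that(5) set_plus_mono2[OF order_refl cball_subset_zonotope[OF bs, of \<delta>], of B] by blast
    then have "vol A \<le> vol (B + zonotope \<delta> bs)"
      using that by (intro vol_mono compact_set_plus compact_zonotope)
    also have "\<dots> \<le> vol B + (vol (cball 0 R + zonotope \<delta> bs) - vol (cball (0::'a) R))"
      using vol_plus_zonotope_diff_mono[of B "cball 0 R" \<delta> bs] that \<delta> by simp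
    also have "\<dots> \<le> vol B + \<epsilon>" using p[of \<delta>] p0 \<delta> by simp
    finally show ?thesis .
  qed
  have "\<bar>vol A - vol B\<bar> \<le> \<epsilon>" if "bodies_close R \<delta> A B" for A B :: "'a set"
    using *[of A B] *[of B A] that unfolding bodies_close_def by simp
  then show "\<exists>\<delta>>0. \<forall>A B::'a set. bodies_close R \<delta> A B \<longrightarrow> \<bar>vol A - vol B\<bar> \<le> \<epsilon>"
    using \<delta>(1) by blast
qed

subsection \<open>The ball as a limit of zonotopes\<close>

text \<open>The preimage of a box is its image under the inverse, which is again orthogonal and so
  has a determinant of modulus 1; values on boxes determine the measure.\<close>

lemma lborel_distr_orthogonal:
  fixes f :: "real^'n \<Rightarrow> real^'n"
  assumes f: "orthogonal_transformation f"
  shows "distr lborel borel f = lborel"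
proof (rule lborel_eqI[symmetric])
  have lin: "linear f" using f by (rule orthogonal_transformation_linear)
  have meas[measurable]: "f \<in> borel_measurable borel"
    using lin by (intro borel_measurable_continuous_onI linear_continuous_on)
      (simp add: linear_conv_bounded_linear)
  define g where "g = inv f"
  have g: "orthogonal_transformation g" using f by (simp add: g_def orthogonal_transformation_inv)
  have bij: "bij f" using f by (rule orthogonal_transformation_bij)
  fix l u :: "real^'n" assume lu: "\<And>b. b \<in> Basis \<Longrightarrow> l \<bullet> b \<le> u \<bullet> b"
  have vim: "f -` box l u = g ` box l u"
    using bij by (simp add: g_def bij_vimage_eq_inv_image)
  have "emeasure (distr lborel borel f) (box l u) = emeasure lborel (f -` box l u)"
    by (subst emeasure_distr) auto
  also have "\<dots> = emeasure lebesgue (g ` box l u)"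
  proof -
    have "f -` box l u \<in> sets lborel" using measurable_sets_borel[OF meas, of "box l u"] by simp
    then show ?thesis by (simp add: vim)
  qed
  also have "\<dots> = ennreal (measure lebesgue (g ` box l u))"
    using lmeasurable_linear_image_cart[of g "box l u"] g
    by (simp add: emeasure_eq_measure2 orthogonal_transformation_linear)
  also have "measure lebesgue (g ` box l u) = measure lebesgue (box l u)"
    using measure_linear_image_cart[of g "box l u"] g
    by (simp add: orthogonal_transformation_linear)
  also have "\<dots> = (\<Prod>b\<in>Basis. (u - l) \<bullet> b)"
    using lu by (simp add: measure_lborel_box_eq)
  finally show "emeasure (distr lborel borel f) (box l u) = (\<Prod>b\<in>Basis. (u - l) \<bullet> b)" .
qed simp

lemma integrable_lborel_bounded_set:
  fixes f :: "'a::euclidean_space \<Rightarrow> real"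
  assumes "A \<in> sets borel" "A \<subseteq> cball 0 R" "f \<in> borel_measurable borel" "\<And>y. y \<in> A \<Longrightarrow> \<bar>f y\<bar> \<le> B"
  shows "integrable lborel (\<lambda>y. indicat_real A y * f y)"
proof (rule integrableI_bounded_set[where A = A and B = B])
  have "emeasure lborel A \<le> emeasure lborel (cball (0::'a) R)"
    using assms by (intro emeasure_mono) auto
  also have "\<dots> < \<infinity>" by (rule emeasure_lborel_cball_finite)
  finally show "emeasure lborel A < \<infinity>" .
qed (use assms in \<open>auto simp: indicator_def abs_mult\<close>)

text \<open>The average of \<open>\<bar>x \<bullet> y\<bar>\<close> over the ball is invariant under rotations of \<open>y\<close>.\<close>

lemma integral_abs_inner_ball:
  obtains c where "c > 0" "\<And>x::real^'n. (\<integral>y. indicator (cball 0 1) y * \<bar>x \<bullet> y\<bar> \<partial>lborel) = c * norm x"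
proof -
  define \<rho> where "\<rho> x = (\<integral>y. indicator (cball 0 1) y * \<bar>x \<bullet> y\<bar> \<partial>lborel)" for x :: "real^'n"
  have inv: "\<rho> (f x) = \<rho> x" if f: "orthogonal_transformation f" for f x
  proof -
    have lin: "linear f" using f by (rule orthogonal_transformation_linear)
    have meas[measurable]: "f \<in> borel_measurable borel"
      using lin by (intro borel_measurable_continuous_onI linear_continuous_on)
        (simp add: linear_conv_bounded_linear)
    have "\<rho> (f x) = (\<integral>y. indicator (cball 0 1) y * \<bar>f x \<bullet> y\<bar> \<partial>distr lborel borel f)"
      by (simp add: \<rho>_def lborel_distr_orthogonal[OF f])
    also have "\<dots> = (\<integral>y. indicator (cball 0 1) (f y) * \<bar>f x \<bullet> f y\<bar> \<partial>lborel)"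
    proof (rule integral_distr)
      show "(\<lambda>y. indicat_real (cball 0 1) y * \<bar>f x \<bullet> y\<bar>) \<in> borel_measurable borel"
        by (intro borel_measurable_times borel_measurable_indicator borel_measurable_abs
            borel_measurable_inner) auto
    qed simp
    also have "\<dots> = \<rho> x"
      using f by (simp add: \<rho>_def orthogonal_transformation_def orthogonal_transformation_norm[OF f] indicator_def)
    finally show ?thesis .
  qed
  obtain e :: "real^'n" where e: "norm e = 1" using vector_choose_size[of 1] by auto
  have scale: "\<rho> (c *\<^sub>R x) = c * \<rho> x" if "c \<ge> 0" for c x
  proof -
    have "\<rho> (c *\<^sub>R x) = (\<integral>y. c * (indicator (cball 0 1) y * \<bar>x \<bullet> y\<bar>) \<partial>lborel)"
      using that unfolding \<rho>_def by (intro Bochner_Integration.integral_cong) (auto simp: abs_mult)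
    then show ?thesis by (simp add: \<rho>_def)
  qed
  \<comment> \<open>Some orthogonal map carries \<open>norm x *\<^sub>R e\<close> to
    \<open>x\<close>, so the integral depends on \<open>norm x\<close> alone, and it does so
    linearly.\<close>
  have 1: "\<rho> x = \<rho> e * norm x" for x
  proof -
    obtain f where f: "orthogonal_transformation f" "f (norm x *\<^sub>R e) = x"
      using orthogonal_transformation_exists[of "norm x *\<^sub>R e" x] e by auto
    have "\<rho> x = \<rho> (norm x *\<^sub>R e)" using inv[OF f(1), of "norm x *\<^sub>R e"] f(2) by simp
    then show ?thesis using scale[of "norm x" e] by simp
  qed
  \<comment> \<open>Positivity of the constant: the ball of radius 1/4 about
    \<open>e /\<^sub>R 2\<close> lies in the unit ball, and on it \<open>e \<bullet> y\<close>
    differs from 1/2 by at most 1/4.\<close>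
  have "0 < (1/4) * measure lborel (ball (e /\<^sub>R 2) (1/4))"
    by (simp add: content_ball_pos)
  also have "\<dots> = (\<integral>y. (1/4) * indicator (ball (e /\<^sub>R 2) (1/4)) y \<partial>lborel)"
    by simp
  also have "\<dots> \<le> \<rho> e"
    unfolding \<rho>_def
  proof (rule integral_mono)
    show "integrable lborel (\<lambda>y. 1/4 * indicat_real (ball (e /\<^sub>R 2) (1 / 4)) y)"
      using emeasure_lborel_ball_finite[of "e /\<^sub>R 2" "1/4"]
      by (intro integrable_mult_right integrable_real_indicator) auto
    show "integrable lborel (\<lambda>y. indicat_real (cball 0 1) y * \<bar>e \<bullet> y\<bar>)"
    proof (rule integrable_lborel_bounded_set[where R = 1 and B = 1])
      fix y :: "real^'n" assume "y \<in> cball 0 1"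
      then show "\<bar>\<bar>e \<bullet> y\<bar>\<bar> \<le> 1" using Cauchy_Schwarz_ineq2[of e y] e by simp
    qed auto
    fix y :: "real^'n"
    show "1/4 * indicat_real (ball (e /\<^sub>R 2) (1/4)) y \<le> indicat_real (cball 0 1) y * \<bar>e \<bullet> y\<bar>"
    proof (cases "y \<in> ball (e /\<^sub>R 2) (1/4)")
      case True
      then have n: "norm (y - e /\<^sub>R 2) < 1/4" by (simp add: dist_norm norm_minus_commute)
      have "norm y \<le> norm (y - e /\<^sub>R 2) + norm (e /\<^sub>R 2)"
        using norm_triangle_ineq[of "y - e /\<^sub>R 2" "e /\<^sub>R 2"] by simp
      then have "norm y \<le> 1" using n e by simp
      moreover have "\<bar>e \<bullet> (y - e /\<^sub>R 2)\<bar> \<le> 1/4"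
        using Cauchy_Schwarz_ineq2[of e "y - e /\<^sub>R 2"] e n by simp
      moreover have "e \<bullet> (y - e /\<^sub>R 2) = e \<bullet> y - 1/2"
        using e by (simp add: inner_diff_right flip: power2_norm_eq_inner)
      ultimately have "norm y \<le> 1" "1/4 \<le> \<bar>e \<bullet> y\<bar>" by linarith+
      then show ?thesis using True by simp
    qed simp
  qed
  finally have "\<rho> e > 0" .
  then show ?thesis using 1 that[of "\<rho> e"] unfolding \<rho>_def by blast
qed

text \<open>A Riemann sum: cut \<open>A\<close> into pieces lying in balls of radius
  \<open>\<eta>\<close> and replace \<open>y\<close> by the centre \<open>c\<close> on each piece. A
  piece of mass \<open>w\<close> becomes the generator \<open>w *\<^sub>R c\<close>, with error at
  most \<open>\<eta> * norm x * w\<close>; the masses add up to that of \<open>A\<close>.\<close>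

lemma integral_abs_inner_discretise:
  fixes A :: "'a::euclidean_space set"
  assumes "A \<in> sets borel" "A \<subseteq> cball 0 1" "A \<subseteq> (\<Union>c\<in>set cs. ball c \<eta>)"
  shows "\<exists>us. \<forall>x. \<bar>(\<integral>y. indicator A y * \<bar>x \<bullet> y\<bar> \<partial>lborel) - (\<Sum>u\<leftarrow>us. \<bar>x \<bullet> u\<bar>)\<bar>
      \<le> \<eta> * norm x * measure lborel A"
  using assms
proof (induction cs arbitrary: A)
  case Nil
  then show ?case by (auto intro!: exI[of _ "[]"])
next
  case (Cons c cs)
  define B where "B = A \<inter> ball c \<eta>"
  define C where "C = A - ball c \<eta>"
  have sets[measurable]: "B \<in> sets borel" "C \<in> sets borel" using Cons.prems by (auto simp: B_def C_def)
  have sub: "B \<subseteq> cball 0 1" "C \<subseteq> cball 0 1" "C \<subseteq> (\<Union>c\<in>set cs. ball c \<eta>)"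
    using Cons.prems by (auto simp: B_def C_def)
  obtain us where us: "\<And>x. \<bar>(\<integral>y. indicator C y * \<bar>x \<bullet> y\<bar> \<partial>lborel) - (\<Sum>u\<leftarrow>us. \<bar>x \<bullet> u\<bar>)\<bar>
      \<le> \<eta> * norm x * measure lborel C"
    using Cons.IH[OF sets(2) sub(2,3)] by blast
  have int: "integrable lborel (\<lambda>y. indicat_real D y * \<bar>x \<bullet> y\<bar>)"
    if "D \<in> sets borel" "D \<subseteq> cball 0 1" for D and x :: 'a
  proof (rule integrable_lborel_bounded_set[where R = 1 and B = "norm x"])
    fix y assume "y \<in> D"
    then have "norm y \<le> 1" using that by auto
    then show "\<bar>\<bar>x \<bullet> y\<bar>\<bar> \<le> norm x"
      using Cauchy_Schwarz_ineq2[of x y] mult_left_mono[of "norm y" 1 "norm x"] by simp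
  qed (use that in auto)
  have fin: "emeasure lborel D < \<infinity>" if "D \<in> sets borel" "D \<subseteq> cball 0 1" for D :: "'a set"
  proof -
    have "emeasure lborel D \<le> emeasure lborel (cball (0::'a) 1)" using that by (intro emeasure_mono) auto
    also have "\<dots> < \<infinity>" by (rule emeasure_lborel_cball_finite)
    finally show ?thesis .
  qed
  have mA: "measure lborel A = measure lborel B + measure lborel C"
  proof -
    have "A = B \<union> C" "B \<inter> C = {}" by (auto simp: B_def C_def)
    moreover have "measure lborel (B \<union> C) = measure lborel B + measure lborel C" if "B \<inter> C = {}"
      using fin[OF sets(1) sub(1)] fin[OF sets(2) sub(2)]
that
      by (intro measure_Union) auto
    ultimately show ?thesis by simp
  qed
  define w where "w = measure lborel B"
  have "\<bar>(\<integral>y. indicator A y * \<bar>x \<bullet> y\<bar> \<partial>lborel) - (\<Sum>u\<leftarrow>(w *\<^sub>R c) # us. \<bar>x \<bullet> u\<bar>)\<bar>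
      \<le> \<eta> * norm x * measure lborel A" for x
  proof -
    have "(\<integral>y. indicator A y * \<bar>x \<bullet> y\<bar> \<partial>lborel) =
        (\<integral>y. indicator B y * \<bar>x \<bullet> y\<bar> + indicator C y * \<bar>x \<bullet> y\<bar> \<partial>lborel)"
      by (intro Bochner_Integration.integral_cong) (auto simp: B_def C_def indicator_def)
    also have "\<dots> = (\<integral>y. indicator B y * \<bar>x \<bullet> y\<bar> \<partial>lborel) + (\<integral>y. indicator C y * \<bar>x \<bullet> y\<bar> \<partial>lborel)"
      by (intro Bochner_Integration.integral_add int sets sub)
    finally have split: "(\<integral>y. indicator A y * \<bar>x \<bullet> y\<bar> \<partial>lborel) =
        (\<integral>y. indicator B y * \<bar>x \<bullet> y\<bar> \<partial>lborel) + (\<integral>y. indicator C y * \<bar>x \<bullet> y\<bar> \<partial>lborel)" .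
    have ib: "integrable lborel (indicat_real B)"
      using fin[OF sets(1) sub(1)] by (intro integrable_real_indicator) auto
    have xw: "\<bar>x \<bullet> (w *\<^sub>R c)\<bar> = (\<integral>y. indicator B y * \<bar>x \<bullet> c\<bar> \<partial>lborel)"
      by (simp add: w_def abs_mult)
    have "\<bar>(\<integral>y. indicator B y * \<bar>x \<bullet> y\<bar> \<partial>lborel) - \<bar>x \<bullet> (w *\<^sub>R c)\<bar>\<bar> =
        \<bar>\<integral>y. indicator B y * \<bar>x \<bullet> y\<bar> - indicator B y * \<bar>x \<bullet> c\<bar> \<partial>lborel\<bar>"
      unfolding xw using ib
      by (subst Bochner_Integration.integral_diff[OF int[OF sets(1) sub(1)]]) auto
    also have "\<dots> \<le> (\<integral>y. \<eta> * norm x * indicator B y \<partial>lborel)"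
    proof (rule order_trans[OF integral_abs_bound integral_mono])
      show "integrable lborel (\<lambda>y. \<bar>indicat_real B y * \<bar>x \<bullet> y\<bar> - indicat_real B y * \<bar>x \<bullet> c\<bar>\<bar>)"
        using ib by (intro integrable_abs Bochner_Integration.integrable_diff int sets sub) auto
      show "integrable lborel (\<lambda>y. \<eta> * norm x * indicat_real B y)" using ib by auto
      fix y
      show "\<bar>indicat_real B y * \<bar>x \<bullet> y\<bar> - indicat_real B y * \<bar>x \<bullet> c\<bar>\<bar> \<le> \<eta> * norm x * indicat_real B y"
      proof (cases "y \<in> B")
        case True
        have "\<bar>\<bar>x \<bullet> y\<bar> - \<bar>x \<bullet> c\<bar>\<bar> \<le> \<bar>x \<bullet> (y - c)\<bar>" by (simp add: inner_diff_right)
        also have "\<dots> \<le> norm x * norm (y - c)" by (rule Cauchy_Schwarz_ineq2)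
        also have "\<dots> \<le> norm x * \<eta>"
          using True by (intro mult_left_mono) (auto simp: B_def dist_norm norm_minus_commute)
        finally show ?thesis using True by (simp add: mult.commute)
      qed simp
    qed
    also have "\<dots> = \<eta> * norm x * measure lborel B" by simp
    finally show ?thesis using us[of x] unfolding split mA by (simp add: distrib_left)
  qed
  then show ?case by blast
qed

text \<open>\<open>norm x\<close> is the support function of the unit ball and the sum is that of
  \<open>zonotope 1 us\<close>. So this is the approximation of the ball by zonotopes, obtained by
  discretising the rotation invariant integral of \<open>\<bar>x \<bullet> y\<bar>\<close>.\<close>

lemma norm_approx_sum_abs_inner:
  assumes "0 < \<epsilon>"
  obtains us :: "(real^'n) list" where "\<And>x. \<bar>(\<Sum>u\<leftarrow>us. \<bar>x \<bullet> u\<bar>) - norm x\<bar> \<le> \<epsilon> * norm x"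
proof -
  obtain c where c: "c > 0" "\<And>x::real^'n. (\<integral>y. indicator (cball 0 1) y * \<bar>x \<bullet> y\<bar> \<partial>lborel) = c * norm x"
    using integral_abs_inner_ball by blast
  define V where "V = measure lborel (cball (0::real^'n) 1)"
  have V: "V > 0" by (simp add: V_def content_cball_pos)
  \<comment> \<open>Chosen so that the discretisation error \<open>\<eta> * norm x * V\<close>,
    divided by \<open>c\<close>, equals \<open>\<epsilon> * norm x\<close>.\<close>
  define \<eta> where "\<eta> = c * \<epsilon> / V"
  have \<eta>: "\<eta> > 0" using c V assms by (simp add: \<eta>_def)
  obtain C where C: "finite C" "cball (0::real^'n) 1 \<subseteq> (\<Union>c\<in>C. ball c \<eta>)"
    using seq_compact_imp_totally_bounded[of "cball (0::real^'n) 1"] \<eta>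
    by (auto simp: compact_eq_seq_compact_metric[symmetric])
  obtain cs where cs: "set cs = C" using finite_list[OF C(1)] by blast
  have C': "cball (0::real^'n) 1 \<subseteq> (\<Union>c\<in>set cs. ball c \<eta>)" using C cs by simp
  obtain us where us: "\<And>x::real^'n. \<bar>(\<integral>y. indicator (cball 0 1) y * \<bar>x \<bullet> y\<bar> \<partial>lborel) - (\<Sum>u\<leftarrow>us. \<bar>x \<bullet> u\<bar>)\<bar>
      \<le> \<eta> * norm x * V"
    using integral_abs_inner_discretise[OF borel_closed[OF closed_cball] order_refl C'] unfolding V_def by blast
  have "\<bar>(\<Sum>u\<leftarrow>map (\<lambda>u. u /\<^sub>R c) us. \<bar>x \<bullet> u\<bar>) - norm x\<bar> \<le> \<epsilon> * norm x" for x
  proof -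
    have "(\<Sum>u\<leftarrow>map (\<lambda>u. u /\<^sub>R c) us. \<bar>x \<bullet> u\<bar>) = (\<Sum>u\<leftarrow>us. \<bar>x \<bullet> u\<bar>) / c"
      using c by (induction us) (auto simp: abs_mult field_simps)
    then have "c * \<bar>(\<Sum>u\<leftarrow>map (\<lambda>u. u /\<^sub>R c) us. \<bar>x \<bullet> u\<bar>) - norm x\<bar> = \<bar>c * ((\<Sum>u\<leftarrow>us. \<bar>x \<bullet> u\<bar>) / c - norm x)\<bar>"
      using c(1) by (simp add: abs_mult)
    also have "c * ((\<Sum>u\<leftarrow>us. \<bar>x \<bullet> u\<bar>) / c - norm x) = (\<Sum>u\<leftarrow>us. \<bar>x \<bullet> u\<bar>) - c * norm x"
      using c(1) by (simp add: right_diff_distrib)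
    also have "\<bar>\<dots>\<bar> \<le> \<eta> * norm x * V" using us[of x] unfolding c(2) by (simp add: abs_minus_commute)
    also have "\<dots> = c * (\<epsilon> * norm x)" using V by (simp add: \<eta>_def)
    finally show ?thesis using c(1) by simp
  qed
  then show ?thesis using that by blast
qed

lemma inner_zonotope_le:
  fixes us :: "'a::real_inner list"
  assumes "z \<in> zonotope t us"
  shows "x \<bullet> z \<le> t * (\<Sum>u\<leftarrow>us. \<bar>x \<bullet> u\<bar>)"
  using assms
proof (induction us arbitrary: z)
  case (Cons u us)
  then obtain s v where z: "z = s + v" "s \<in> symseg t u" "v \<in> zonotope t us"
    using set_plus_elim by (metis zonotope_Cons)
  then obtain r where "s = r *\<^sub>R u" "r \<in> {-t..t}" unfolding symseg_def by blast
  then have r: "s = r *\<^sub>R u" "\<bar>r\<bar> \<le> t" by (auto simp: abs_le_iff)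
  have "x \<bullet> s \<le> \<bar>r\<bar> * \<bar>x \<bullet> u\<bar>" by (simp add: r flip: abs_mult)
  also have "\<dots> \<le> t * \<bar>x \<bullet> u\<bar>" using r by (simp add: mult_right_mono)
  finally show ?case using Cons.IH[OF z(3)] by (simp add: z(1) inner_add_right distrib_left)
qed simp

text \<open>The coefficient \<open>- t * sgn (x \<bullet> u)\<close> makes the contribution of every
  generator minimal. The minimum is what the separation argument needs, where the zonotope lies on
  the upper side of the hyperplane.\<close>

lemma inner_zonotope_attained:
  fixes us :: "'a::real_inner list"
  assumes "0 \<le> t"
  shows "\<exists>z\<in>zonotope t us. x \<bullet> z = - t * (\<Sum>u\<leftarrow>us. \<bar>x \<bullet> u\<bar>)"
proof (induction us)
  case (Cons u us)
  then obtain z where z: "z \<in> zonotope t us" "x \<bullet> z = - t * (\<Sum>u\<leftarrow>us. \<bar>x \<bullet> u\<bar>)" by blast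
  define s where "s = (- t * sgn (x \<bullet> u)) *\<^sub>R u"
  have "s \<in> symseg t u"
    unfolding s_def symseg_def using assms by (intro imageI) (auto simp: sgn_if)
  then have "s + z \<in> zonotope t (u # us)" using z by (simp add: set_plus_intro)
  moreover have "x \<bullet> (s + z) = - t * (\<Sum>u\<leftarrow>u # us. \<bar>x \<bullet> u\<bar>)"
    by (simp add: s_def inner_add_right z(2) algebra_simps abs_sgn)
  ultimately show ?case by blast
qed simp

text \<open>Comparison of support functions. For the outer inclusion a point \<open>z\<close> is
  tested against itself; for the inner one, a point outside the zonotope is separated from it, and
  the normal of the hyperplane violates the lower bound on the support function.\<close>

lemma zonotope_approx_ball:
  fixes us :: "'a::euclidean_space list"
  assumes us: "\<And>x. \<bar>(\<Sum>u\<leftarrow>us. \<bar>x \<bullet> u\<bar>) - norm x\<bar> \<le> \<epsilon> * norm x" and t: "0 \<le> t"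
  shows "zonotope t us \<subseteq> cball 0 (t * (1 + \<epsilon>))" and "cball 0 (t * (1 - \<epsilon>)) \<subseteq> zonotope t us"
proof -
  have bnd: "(1 - \<epsilon>) * norm x \<le> (\<Sum>u\<leftarrow>us. \<bar>x \<bullet> u\<bar>)" "(\<Sum>u\<leftarrow>us. \<bar>x \<bullet> u\<bar>) \<le> (1 + \<epsilon>) * norm x" for x
    using us[of x] by (simp_all add: algebra_simps abs_le_iff)
  show "zonotope t us \<subseteq> cball 0 (t * (1 + \<epsilon>))"
  proof
    fix z assume z: "z \<in> zonotope t us"
    have "norm z * norm z \<le> t * (\<Sum>u\<leftarrow>us. \<bar>z \<bullet> u\<bar>)"
      using inner_zonotope_le[OF z, of z] by (simp add: dot_square_norm power2_eq_square)
    also have "\<dots> \<le> t * ((1 + \<epsilon>) * norm z)" using bnd t by (intro mult_left_mono)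
    finally have *: "norm z * norm z \<le> (t * (1 + \<epsilon>)) * norm z" by (simp add: mult.assoc)
    \<comment> \<open>A unit vector in the hypothesis shows the sign of \<open>\<epsilon>\<close>,
      which the case \<open>z = 0\<close> requires.\<close>
    have e: "\<epsilon> \<ge> 0" 
    proof -
      obtain e :: 'a where "norm e = 1" using vector_choose_size[of 1] by auto
      then show ?thesis using us[of e] by simp
    qed
    have "norm z \<le> t * (1 + \<epsilon>)"
    proof (cases "z = 0")
      case True then show ?thesis using t e by simp
    next
      case False then show ?thesis using * by simp
    qed
    then show "z \<in> cball 0 (t * (1 + \<epsilon>))" by simp
  qed
  show "cball 0 (t * (1 - \<epsilon>)) \<subseteq> zonotope t us"
  proof (rule subsetI, rule ccontr)
    fix p assume p: "p \<in> cball 0 (t * (1 - \<epsilon>))" "p \<notin> zonotope t us"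
    obtain a b where ab: "a \<bullet> p < b" "\<And>z. z \<in> zonotope t us \<Longrightarrow> b < a \<bullet> z"
      using separating_hyperplane_closed_point[OF convex_zonotope compact_imp_closed[OF compact_zonotope] p(2)]
      by blast
    obtain z where z: "z \<in> zonotope t us" "a \<bullet> z = - t * (\<Sum>u\<leftarrow>us. \<bar>a \<bullet> u\<bar>)"
      using inner_zonotope_attained[OF t] by blast
    have "t * ((1 - \<epsilon>) * norm a) \<le> t * (\<Sum>u\<leftarrow>us. \<bar>a \<bullet> u\<bar>)" using bnd t by (intro mult_left_mono)
    also have "\<dots> < - (a \<bullet> p)" using ab z by fastforce
    also have "\<dots> \<le> norm a * norm p" using Cauchy_Schwarz_ineq2[of a p] by simp
    also have "\<dots> \<le> norm a * (t * (1 - \<epsilon>))" using p by (intro mult_left_mono) auto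
    finally show False by (simp add: mult.assoc mult.left_commute mult.commute)
  qed
qed

lemma cball_plus_cball:
  assumes "0 \<le> r" "0 \<le> s"
  shows "cball 0 r + cball 0 s = (cball 0 (r + s) :: 'a::real_normed_vector set)"
proof (intro set_eqI iffI)
  fix x :: 'a assume "x \<in> cball 0 r + cball 0 s"
  then obtain a b where "x = a + b" "a \<in> cball 0 r" "b \<in> cball 0 s" by (meson set_plus_elim)
  then show "x \<in> cball 0 (r + s)" using norm_triangle_ineq[of a b] by simp
next
  fix x :: 'a assume x: "x \<in> cball 0 (r + s)"
  show "x \<in> cball 0 r + cball 0 s"
  proof (cases "r + s = 0")
    case True
    then have "r = 0" "s = 0" using assms by auto
    then show ?thesis using x by simp
  next
    case False
    then have p: "r + s > 0" using assms by auto
    have "x = (r / (r + s)) *\<^sub>R x + (s / (r + s)) *\<^sub>R x"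
      using p by (simp flip: scaleR_add_left add_divide_distrib)
    moreover have "(q / (r + s)) *\<^sub>R x \<in> cball 0 q" if "q \<ge> 0" for q
    proof -
      have "q / (r + s) * norm x \<le> q / (r + s) * (r + s)" using x p that by (intro mult_left_mono) auto
      then show ?thesis using p that by simp
    qed
    ultimately show ?thesis using assms by (metis set_plus_intro)
  qed
qed

subsection \<open>Steiner's formula\<close>

definition lagrange_basis :: "nat \<Rightarrow> nat \<Rightarrow> real poly" where
  "lagrange_basis d j = (\<Prod>i\<in>{..d} - {j}. smult (1 / (real j - real i)) [:- real i, 1:])"

lemma degree_lagrange_basis: "j \<le> d \<Longrightarrow> degree (lagrange_basis d j) \<le> d"
proof -
  assume "j \<le> d"
  have "degree (lagrange_basis d j) \<le> (\<Sum>i\<in>{..d} - {j}. degree (smult (1 / (real j - real i)) [:- real i, 1:]))"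
    unfolding lagrange_basis_def by (rule degree_prod_sum_le[unfolded o_def]) simp
  also have "\<dots> \<le> (\<Sum>i\<in>{..d} - {j}. 1)"
    by (intro sum_mono order_trans[OF degree_smult_le]) simp
  also have "\<dots> = d" using \<open>j \<le> d\<close> by simp
  finally show ?thesis .
qed

lemma poly_lagrange_basis:
  assumes "i \<le> d" "j \<le> d"
  shows "poly (lagrange_basis d j) (real i) = (if i = j then 1 else 0)"
proof (cases "i = j")
  case True
  have "poly (lagrange_basis d j) (real i) = (\<Prod>k\<in>{..d} - {j}. 1)"
    unfolding lagrange_basis_def poly_prod using True by (intro prod.cong refl) (auto simp flip: diff_divide_distrib)
  then show ?thesis using True by simp
next
  case False
  then have "i \<in> {..d} - {j}" using assms by simp
  then have "poly (lagrange_basis d j) (real i) = 0"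
    unfolding lagrange_basis_def poly_prod by (intro prod_zero) auto
  then show ?thesis using False by simp
qed

text \<open>The weights depend on \<open>d\<close> only. Hence an identity between values of volume
  polynomials survives pointwise limits, with no control of the coefficients.\<close>

lemma lagrange_interpolation:
  assumes "degree p \<le> d"
  shows "p = (\<Sum>j\<le>d. smult (poly p (real j)) (lagrange_basis d j))" (is "p = ?q")
proof (rule poly_eqI_degree[where A = "real ` {..d}"])
  have card: "card (real ` {..d}) = Suc d" by (simp add: card_image)
  show "degree p < card (real ` {..d})" using assms card by simp
  have "degree ?q \<le> d"
    by (intro degree_sum_le order_trans[OF degree_smult_le] degree_lagrange_basis) auto
  then show "degree ?q < card (real ` {..d})" using card by simp
  fix x assume "x \<in> real ` {..d}"
  then obtain i where i: "i \<le> d" "x = real i" by auto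
  have "poly ?q x = (\<Sum>j\<le>d. poly p (real j) * (if i = j then 1 else 0))"
    unfolding poly_sum using i by (intro sum.cong) (auto simp: poly_lagrange_basis)
  also have "\<dots> = (\<Sum>j\<le>d. if i = j then poly p (real j) else 0)" by (intro sum.cong) auto
  finally show "poly p x = poly ?q x" using i by simp
qed

lemma vol_plus_zonotope_tendsto:
  fixes K :: "(real^'n) set" and us :: "nat \<Rightarrow> (real^'n) list"
  assumes K: "compact K" "convex K" "K \<noteq> {}" and t: "0 \<le> t"
    and us: "\<And>k x. \<bar>(\<Sum>u\<leftarrow>us k. \<bar>x \<bullet> u\<bar>) - norm x\<bar> \<le> (1 / real (Suc k)) * norm x"
  shows "(\<lambda>k. vol (K + zonotope t (us k))) \<longlonglongrightarrow> vol (K + cball 0 t)"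
proof (rule LIMSEQ_I)
  fix e :: real assume e: "0 < e"
  obtain R where R: "R > 0" "\<And>x. x \<in> K \<Longrightarrow> norm x \<le> R"
    using compact_imp_bounded[OF K(1)] unfolding bounded_pos by blast
  \<comment> \<open>\<open>K\<close> contributes \<open>R\<close>, and the approximating zonotopes
    stay within radius \<open>t * (1 + \<eta>) \<le> 2 * t\<close>.\<close>
  define R' where "R' = R + 2 * t + 1"
  have "R' > 0" "e / 2 > 0" using R t e by (auto simp: R'_def)
  then obtain \<delta> where \<delta>: "\<delta> > 0" and unif: "\<And>A B::(real^'n) set. bodies_close R' \<delta> A B \<Longrightarrow> \<bar>vol A - vol B\<bar> \<le> e / 2"
    using hausdorff_uniformD[OF hausdorff_uniform_vol] by blast
  obtain N where N: "t / real (Suc N) \<le> \<delta>"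
  proof -
    obtain N where "real (Suc N) * \<delta> > t"
      using ex_less_of_nat_mult[OF \<delta>, of t] by (metis mult.commute lessI less_trans mult_strict_right_mono of_nat_less_iff \<delta>)
    then show ?thesis by (intro that[of N]) (simp add: field_simps)
  qed
  have "norm (vol (K + zonotope t (us k)) - vol (K + cball 0 t)) < e" if "k \<ge> N" for k
  proof -
    define \<eta> where "\<eta> = 1 / real (Suc k)"
    have \<eta>: "0 < \<eta>" "\<eta> \<le> 1" by (auto simp: \<eta>_def)
    have "t / real (Suc k) \<le> t / real (Suc N)" using that t by (intro divide_left_mono) auto
    then have t\<eta>: "0 \<le> t * \<eta>" "t * \<eta> \<le> \<delta>" using N t \<eta> by (auto simp: \<eta>_def)
    note Z = zonotope_approx_ball[OF us[of _ k, folded \<eta>_def] t]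
    have cb: "cball 0 (t * \<eta>) \<subseteq> (cball 0 \<delta> :: (real^'n) set)" using t\<eta> by auto
    have "zonotope t (us k) \<subseteq> cball 0 t + cball 0 (t * \<eta>)"
      using Z(1) t t\<eta> by (simp add: cball_plus_cball distrib_left)
    then have 1: "K + zonotope t (us k) \<subseteq> (K + cball 0 t) + cball 0 \<delta>"
      unfolding add.assoc by (meson cb order_refl order_trans set_plus_mono2)
    \<comment> \<open>The ball of radius \<open>t * (1 - \<eta>)\<close> lies in the zonotope; what
      remains has width \<open>t * \<eta>\<close>, which is within the tolerance
      \<open>\<delta>\<close>.\<close>
    have "cball 0 t = cball 0 (t * (1 - \<eta>)) + cball (0::real^'n) (t * \<eta>)"
      using mult_left_mono[OF \<eta>(2) t] t\<eta> by (subst cball_plus_cball) (auto simp: algebra_simps)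
    also have "\<dots> \<subseteq> zonotope t (us k) + cball 0 (t * \<eta>)" using Z(2) by (intro set_plus_mono2) auto
    finally have 2: "K + cball 0 t \<subseteq> (K + zonotope t (us k)) + cball 0 \<delta>"
      unfolding add.assoc by (meson cb order_refl order_trans set_plus_mono2)
    have KR: "K \<subseteq> cball 0 R" using R by auto
    have "K + zonotope t (us k) \<subseteq> cball 0 R + cball 0 (t * (1 + \<eta>))"
      using KR Z(1) by (rule set_plus_mono2)
    also have "\<dots> \<subseteq> cball 0 R'"
      using R(1) t t\<eta> \<eta> mult_left_mono[OF \<eta>(2) t] by (subst cball_plus_cball) (auto simp: R'_def distrib_left)
    finally have 3: "K + zonotope t (us k) \<subseteq> cball 0 R'" .
    have "K + cball 0 t \<subseteq> cball 0 R + cball 0 t"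
      using KR by (intro set_plus_mono2) auto
    also have "\<dots> \<subseteq> cball 0 R'"
      using R(1) t by (subst cball_plus_cball) (auto simp: R'_def)
    finally have 4: "K + cball 0 t \<subseteq> cball 0 R'" .
    have "0 \<in> cball 0 (t * (1 - \<eta>))" using t \<eta> by simp
    then have "0 \<in> zonotope t (us k)" using Z(2) by blast
    then have ne: "K + zonotope t (us k) \<noteq> {}" "K + cball 0 t \<noteq> {}"
      using K(3) t set_plus_intro[of _ K 0 "zonotope t (us k)"] set_plus_intro[of _ K 0 "cball 0 t"]
      by auto
    have "\<bar>vol (K + zonotope t (us k)) - vol (K + cball 0 t)\<bar> \<le> e / 2"
      using K ne unfolding bodies_close_def
      by (intro unif[unfolded bodies_close_def] conjI 1 2 3 4 compact_set_plus convex_set_plus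
          compact_zonotope convex_zonotope) auto
    then show ?thesis using e by simp
  qed
  then show "\<exists>no. \<forall>k\<ge>no. norm (vol (K + zonotope t (us k)) - vol (K + cball 0 t)) < e" by blast
qed

text \<open>Defined by interpolation rather than through intrinsic volumes: every coefficient is
  then visibly a fixed linear combination of volumes of parallel bodies and inherits their
  continuity.\<close>

definition steiner_poly :: "(real^'n) set \<Rightarrow> real poly" where
  "steiner_poly K = (\<Sum>j\<le>CARD('n). smult (vol (K + cball 0 (real j))) (lagrange_basis CARD('n) j))"

text \<open>For zonotopes, interpolation at \<open>CARD('n) + 1\<close> nodes is exact by the degree
  bound. The nodes are the same for all of them, so both sides of the identity pass to the limit as
  the zonotopes tend to the ball.\<close>

theorem steiner_formula:
  fixes K :: "(real^'n) set"
  assumes K: "compact K" "convex K" "K \<noteq> {}" and t: "0 \<le> t"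
  shows "vol (K + cball 0 t) = poly (steiner_poly K) t"
proof -
  let ?d = "CARD('n)"
  have "\<exists>us::(real^'n) list. \<forall>x. \<bar>(\<Sum>u\<leftarrow>us. \<bar>x \<bullet> u\<bar>) - norm x\<bar> \<le> (1 / real (Suc k)) * norm x" for k
    using norm_approx_sum_abs_inner[of "1 / real (Suc k)"] by (metis of_nat_0_less_iff zero_less_Suc zero_less_divide_1_iff)
  then obtain us :: "nat \<Rightarrow> (real^'n) list"
    where us: "\<And>k x. \<bar>(\<Sum>u\<leftarrow>us k. \<bar>x \<bullet> u\<bar>) - norm x\<bar> \<le> (1 / real (Suc k)) * norm x"
    by metis
  have interp: "vol (K + zonotope t (us k)) =
      (\<Sum>j\<le>?d. vol (K + zonotope (real j) (us k)) * poly (lagrange_basis ?d j) t)" for k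
  proof -
    obtain p where p: "degree p \<le> ?d" "\<And>t. t \<ge> 0 \<Longrightarrow> vol (K + zonotope t (us k)) = poly p t"
      using poly_vol_plus_zonotope_degree[OF K(1,2), of "us k"] by auto
    have "poly p t = (\<Sum>j\<le>?d. poly p (real j) * poly (lagrange_basis ?d j) t)"
      by (subst lagrange_interpolation[OF p(1)]) (simp add: poly_sum)
    then show ?thesis using p(2) t by simp
  qed
  have "(\<lambda>k. vol (K + zonotope t (us k))) \<longlonglongrightarrow> vol (K + cball 0 t)"
    by (rule vol_plus_zonotope_tendsto[OF K t us])
  moreover have "(\<lambda>k. vol (K + zonotope t (us k))) \<longlonglongrightarrow>
      (\<Sum>j\<le>?d. vol (K + cball 0 (real j)) * poly (lagrange_basis ?d j) t)"
    unfolding interp by (intro tendsto_intros vol_plus_zonotope_tendsto K us) auto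
  ultimately have "vol (K + cball 0 t) = (\<Sum>j\<le>?d. vol (K + cball 0 (real j)) * poly (lagrange_basis ?d j) t)"
    by (rule LIMSEQ_unique)
  then show ?thesis by (simp add: steiner_poly_def poly_sum)
qed

section \<open>Surface area as a derivative of the Steiner polynomial\<close>

lemma infdist_le_eq_plus_cball:
  fixes K :: "'a::euclidean_space set"
  assumes "compact K" "K \<noteq> {}" "0 \<le> \<epsilon>"
  shows "{x. infdist x K \<le> \<epsilon>} = K + cball 0 \<epsilon>"
proof (intro set_eqI iffI)
  fix x assume "x \<in> {x. infdist x K \<le> \<epsilon>}"
  moreover obtain y where y: "y \<in> K" "infdist x K = dist x y"
    using infdist_attains_inf[OF compact_imp_closed[OF assms(1)] assms(2)] by blast
  ultimately have "x - y \<in> cball 0 \<epsilon>" by (simp add: dist_norm norm_minus_commute)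
  from set_plus_intro[OF y(1) this] show "x \<in> K + cball 0 \<epsilon>" by simp
next
  fix x assume "x \<in> K + cball 0 \<epsilon>"
  then obtain y z where "x = y + z" "y \<in> K" "z \<in> cball 0 \<epsilon>" by (meson set_plus_elim)
  then show "x \<in> {x. infdist x K \<le> \<epsilon>}"
    using infdist_le[of y K x] by (auto simp: dist_norm)
qed

text \<open>Volumes of parallel bodies agree with the Steiner polynomial at nonnegative radii, so
  the one-sided difference quotient has the derivative at 0 as its limit; the radius 0 itself yields
  \<open>vol K\<close>.\<close>

lemma surface_area_eq:
  fixes K :: "(real^'n) set"
  assumes K: "compact K" "convex K" "K \<noteq> {}"
  shows "surface_area K = poly (pderiv (steiner_poly K)) 0"
proof -
  have K0: "K + cball 0 0 = K" by simp
  have "((\<lambda>\<epsilon>. (poly (steiner_poly K) \<epsilon> - poly (steiner_poly K) 0) / \<epsilon>) \<longlongrightarrow> poly (pderiv (steiner_poly K)) 0) (at 0)"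
    using poly_DERIV[of "steiner_poly K" 0] by (simp add: DERIV_def)
  then have lim: "((\<lambda>\<epsilon>. (poly (steiner_poly K) \<epsilon> - poly (steiner_poly K) 0) / \<epsilon>) \<longlongrightarrow> poly (pderiv (steiner_poly K)) 0) (at_right 0)"
    by (rule filterlim_mono) (auto simp: at_le)
  have "((\<lambda>\<epsilon>. (vol {x. infdist x K \<le> \<epsilon>} - vol K) / \<epsilon>) \<longlongrightarrow> poly (pderiv (steiner_poly K)) 0) (at_right 0)"
  proof (rule Lim_transform_eventually[OF lim])
    show "\<forall>\<^sub>F \<epsilon> in at_right 0. (poly (steiner_poly K) \<epsilon> - poly (steiner_poly K) 0) / \<epsilon>
        = (vol {x. infdist x K \<le> \<epsilon>} - vol K) / \<epsilon>"
      using eventually_at_right_less[of 0]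
    proof eventually_elim
      case (elim \<epsilon>)
      then show ?case
        using steiner_formula[OF K, of \<epsilon>] steiner_formula[OF K, of 0] K0
          infdist_le_eq_plus_cball[OF K(1,3), of \<epsilon>] by simp
    qed
  qed
  then show ?thesis unfolding surface_area_def by (intro tendsto_Lim) auto
qed

section \<open>Uniform continuity and homogeneity of the surface area\<close>

lemma hausdorff_uniform_add_const_cball:
  fixes \<Phi> :: "'a::euclidean_space set \<Rightarrow> real"
  assumes \<Phi>: "hausdorff_uniform \<Phi>" and r: "0 \<le> r"
  shows "hausdorff_uniform (\<lambda>K. \<Phi> (K + cball 0 r))"
  unfolding hausdorff_uniform_def
proof (intro allI impI)
  fix R \<epsilon> :: real assume "0 < R" "0 < \<epsilon>"
  then have "0 < R + r" using r by simp
  then obtain \<delta> where \<delta>: "\<delta> > 0" and unif: "\<And>A B::'a set. bodies_close (R + r) \<delta> A B \<Longrightarrow> \<bar>\<Phi> A - \<Phi> B\<bar> \<le> \<epsilon>"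
    using hausdorff_uniformD[OF \<Phi>] \<open>0 < \<epsilon>\<close> by blast
  have sub: "A + cball 0 r \<subseteq> cball 0 (R + r)" if "A \<subseteq> cball 0 R" for A :: "'a set"
    using set_plus_mono2[OF that order_refl, of "cball 0 r"] r \<open>0 < R\<close> by (simp add: cball_plus_cball)
  have sub2: "A + cball 0 r \<subseteq> (B + cball 0 r) + cball 0 \<delta>" if "A \<subseteq> B + cball 0 \<delta>" for A B :: "'a set"
    using set_plus_mono2[OF that order_refl, of "cball 0 r"] by (simp add: ac_simps)
  have ne: "A + cball 0 r \<noteq> {}" if A: "A \<noteq> {}" for A :: "'a set"
  proof -
    obtain x where "x \<in> A" using A by blast
    then have "x + 0 \<in> A + cball 0 r" using r by (intro set_plus_intro) auto
    then show ?thesis by blast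
  qed
  show "\<exists>\<delta>>0. \<forall>A B. bodies_close R \<delta> A B \<longrightarrow> \<bar>\<Phi> (A + cball 0 r) - \<Phi> (B + cball 0 r)\<bar> \<le> \<epsilon>"
    using \<delta> by (intro exI[of _ \<delta>] conjI allI impI unif)
      (auto simp: bodies_close_def intro!: compact_set_plus convex_set_plus ne dest: sub sub2 subsetD)
qed

lemma hausdorff_uniform_const: "hausdorff_uniform (\<lambda>K. c)"
  unfolding hausdorff_uniform_def by (auto intro: exI[of _ 1])

lemma hausdorff_uniform_add:
  fixes \<Phi> \<Psi> :: "'a::euclidean_space set \<Rightarrow> real"
  assumes \<Phi>: "hausdorff_uniform \<Phi>" and \<Psi>: "hausdorff_uniform \<Psi>"
  shows "hausdorff_uniform (\<lambda>K. \<Phi> K + \<Psi> K)"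
  unfolding hausdorff_uniform_def
proof (intro allI impI)
  fix R \<epsilon> :: real assume R: "0 < R" and "0 < \<epsilon>"
  then have e: "\<epsilon> / 2 > 0" by simp
  obtain \<delta>1 where 1: "\<delta>1 > 0" "\<And>A B::'a set. bodies_close R \<delta>1 A B \<Longrightarrow> \<bar>\<Phi> A - \<Phi> B\<bar> \<le> \<epsilon> / 2"
    using hausdorff_uniformD[OF \<Phi> R e] by blast
  obtain \<delta>2 where 2: "\<delta>2 > 0" "\<And>A B::'a set. bodies_close R \<delta>2 A B \<Longrightarrow> \<bar>\<Psi> A - \<Psi> B\<bar> \<le> \<epsilon> / 2"
    using hausdorff_uniformD[OF \<Psi> R e] by blast
  define \<delta> where "\<delta> = min \<delta>1 \<delta>2"
  have sub: "A \<subseteq> B + cball 0 \<delta>1" "A \<subseteq> B + cball 0 \<delta>2" if "A \<subseteq> B + cball 0 \<delta>" for A B :: "'a set"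
    using that set_plus_mono2[OF order_refl, of "cball 0 \<delta>" "cball 0 \<delta>1" B]
      set_plus_mono2[OF order_refl, of "cball 0 \<delta>" "cball 0 \<delta>2" B]
    by (auto simp: \<delta>_def subset_iff)
  have "\<bar>\<Phi> A + \<Psi> A - (\<Phi> B + \<Psi> B)\<bar> \<le> \<epsilon>" if "bodies_close R \<delta> A B" for A B
  proof -
    have "bodies_close R \<delta>1 A B" "bodies_close R \<delta>2 A B"
      using that sub[of A B] sub[of B A] unfolding bodies_close_def by auto
    then show ?thesis using 1(2)[of A B] 2(2)[of A B] by linarith
  qed
  then show "\<exists>\<delta>>0. \<forall>A B. bodies_close R \<delta> A B \<longrightarrow> \<bar>\<Phi> A + \<Psi> A - (\<Phi> B + \<Psi> B)\<bar> \<le> \<epsilon>"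
    using 1(1) 2(1) by (intro exI[of _ \<delta>]) (auto simp: \<delta>_def)
qed

lemma hausdorff_uniform_mult_right:
  fixes \<Phi> :: "'a::euclidean_space set \<Rightarrow> real"
  assumes \<Phi>: "hausdorff_uniform \<Phi>"
  shows "hausdorff_uniform (\<lambda>K. \<Phi> K * c)"
  unfolding hausdorff_uniform_def
proof (intro allI impI)
  fix R \<epsilon> :: real assume R: "0 < R" and "0 < \<epsilon>"
  then have e: "\<epsilon> / (\<bar>c\<bar> + 1) > 0" by simp
  obtain \<delta> where 1: "\<delta> > 0" "\<And>A B::'a set. bodies_close R \<delta> A B \<Longrightarrow> \<bar>\<Phi> A - \<Phi> B\<bar> \<le> \<epsilon> / (\<bar>c\<bar> + 1)"
    using hausdorff_uniformD[OF \<Phi> R e] by blast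
  have *: "\<bar>\<Phi> A * c - \<Phi> B * c\<bar> \<le> \<epsilon>" if "\<bar>\<Phi> A - \<Phi> B\<bar> \<le> \<epsilon> / (\<bar>c\<bar> + 1)" for A B
  proof -
    have "\<bar>\<Phi> A * c - \<Phi> B * c\<bar> = \<bar>\<Phi> A - \<Phi> B\<bar> * \<bar>c\<bar>" by (simp flip: abs_mult left_diff_distrib)
    also have "\<dots> \<le> \<epsilon> / (\<bar>c\<bar> + 1) * (\<bar>c\<bar> + 1)" using that by (intro mult_mono) auto
    finally show ?thesis by simp
  qed
  show "\<exists>\<delta>>0. \<forall>A B. bodies_close R \<delta> A B \<longrightarrow> \<bar>\<Phi> A * c - \<Phi> B * c\<bar> \<le> \<epsilon>"
    using 1 by (intro exI[of _ \<delta>] conjI allI impI *) auto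
qed

lemma hausdorff_uniform_sum:
  "finite I \<Longrightarrow> (\<And>i. i \<in> I \<Longrightarrow> hausdorff_uniform (\<Phi> i)) \<Longrightarrow> hausdorff_uniform (\<lambda>K. \<Sum>i\<in>I. \<Phi> i K)"
  by (induction I rule: finite_induct) (auto intro: hausdorff_uniform_add hausdorff_uniform_const)

text \<open>Uniform continuity looks at nonempty compact convex sets alone, so
  \<open>surface_area\<close> may be replaced by the combination of volumes that represents it on
  those sets.\<close>

lemma hausdorff_uniform_cong:
  assumes "hausdorff_uniform \<Phi>" "\<And>K. compact K \<Longrightarrow> convex K \<Longrightarrow> K \<noteq> {} \<Longrightarrow> \<Phi> K = \<Psi> K"
  shows "hausdorff_uniform \<Psi>"
  unfolding hausdorff_uniform_def
proof (intro allI impI)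
  fix R \<epsilon> :: real assume "0 < R" "0 < \<epsilon>"
  then obtain \<delta> where "\<delta> > 0" "\<And>A B. bodies_close R \<delta> A B \<Longrightarrow> \<bar>\<Phi> A - \<Phi> B\<bar> \<le> \<epsilon>"
    using hausdorff_uniformD[OF assms(1)] by blast
  then show "\<exists>\<delta>>0. \<forall>A B. bodies_close R \<delta> A B \<longrightarrow> \<bar>\<Psi> A - \<Psi> B\<bar> \<le> \<epsilon>"
    using assms(2) unfolding bodies_close_def by (intro exI[of _ \<delta>]) metis
qed

lemma hausdorff_uniform_surface_area: "hausdorff_uniform (surface_area :: (real^'n) set \<Rightarrow> real)"
proof (rule hausdorff_uniform_cong)
  show "hausdorff_uniform (\<lambda>K::(real^'n) set. \<Sum>j\<le>CARD('n). vol (K + cball 0 (real j)) *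
      poly (pderiv (lagrange_basis CARD('n) j)) 0)"
    by (intro hausdorff_uniform_sum hausdorff_uniform_mult_right hausdorff_uniform_add_const_cball
        hausdorff_uniform_vol) auto
  fix K :: "(real^'n) set" assume K: "compact K" "convex K" "K \<noteq> {}"
  show "(\<Sum>j\<le>CARD('n). vol (K + cball 0 (real j)) * poly (pderiv (lagrange_basis CARD('n) j)) 0)
      = surface_area K"
    by (simp add: surface_area_eq[OF K] steiner_poly_def poly_sum pderiv_smult higher_pderiv_sum[where n = 1, simplified])
qed

lemma image_scaleR_plus:
  "(*\<^sub>R) c ` (A + B) = (*\<^sub>R) c ` A + (*\<^sub>R) c ` (B :: 'a::real_vector set)"
proof (intro set_eqI iffI)
  fix x assume "x \<in> (*\<^sub>R) c ` (A + B)"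
  then obtain w where w: "x = c *\<^sub>R w" "w \<in> A + B" by blast
  then obtain a b where "w = a + b" "a \<in> A" "b \<in> B" by (meson set_plus_elim)
  then show "x \<in> (*\<^sub>R) c ` A + (*\<^sub>R) c ` B"
    by (auto simp: w(1) scaleR_add_right intro!: set_plus_intro)
next
  fix x assume "x \<in> (*\<^sub>R) c ` A + (*\<^sub>R) c ` B"
  then obtain y z where yz: "x = y + z" "y \<in> (*\<^sub>R) c ` A" "z \<in> (*\<^sub>R) c ` B" by (meson set_plus_elim)
  then obtain a b where ab: "y = c *\<^sub>R a" "z = c *\<^sub>R b" "a \<in> A" "b \<in> B" by blast
  then have "x = c *\<^sub>R (a + b)" by (simp add: yz(1) scaleR_add_right)
  then show "x \<in> (*\<^sub>R) c ` (A + B)" using ab set_plus_intro by blast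
qed

text \<open>A parallel body of the dilate at radius \<open>t\<close> is the dilate of the parallel
  body at radius \<open>t / c\<close>. So the Steiner polynomial turns into
  \<open>c ^ CARD('n)\<close> times itself at \<open>t / c\<close>, and the chain rule takes away
  one factor \<open>c\<close>.\<close>

lemma surface_area_scaleR:
  fixes K :: "(real^'n) set"
  assumes K: "compact K" "convex K" "K \<noteq> {}" and c: "0 < c"
  shows "surface_area ((*\<^sub>R) c ` K) = c ^ (CARD('n) - 1) * surface_area K"
proof -
  have cK: "compact ((*\<^sub>R) c ` K)" "convex ((*\<^sub>R) c ` K)" "(*\<^sub>R) c ` K \<noteq> {}"
    using K by (auto intro: compact_scaling convex_scaling)
  define q where "q = smult (c ^ CARD('n)) (pcompose (steiner_poly K) [:0, 1 / c:])"
  have eq: "poly (steiner_poly ((*\<^sub>R) c ` K)) t = poly q t" if "t \<ge> 0" for t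
  proof -
    have "(*\<^sub>R) c ` K + cball 0 t = (*\<^sub>R) c ` (K + cball 0 (t / c))"
    proof -
      have "cball 0 t = (*\<^sub>R) c ` cball (0::real^'n) (t / c)" using c by (simp add: cball_scale)
      then show ?thesis by (simp add: image_scaleR_plus)
    qed
    then have "vol ((*\<^sub>R) c ` K + cball 0 t) = c ^ CARD('n) * vol (K + cball 0 (t / c))"
      using c by (simp add: vol_scaleR)
    then show ?thesis
      using steiner_formula[OF cK that] steiner_formula[OF K, of "t / c"] that c
      by (simp add: q_def poly_pcompose)
  qed
  have "steiner_poly ((*\<^sub>R) c ` K) = q"
  \<comment> \<open>Agreement is known for nonnegative arguments only; the integers from 0 up to the
    larger degree are enough points.\<close>
  proof (rule poly_eqI_degree[where A = "real ` {..max (degree (steiner_poly ((*\<^sub>R) c ` K))) (degree q)}"])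
    show "poly (steiner_poly ((*\<^sub>R) c ` K)) x = poly q x"
      if "x \<in> real ` {..max (degree (steiner_poly ((*\<^sub>R) c ` K))) (degree q)}" for x
      using that eq by auto
  qed (simp_all add: card_image)
  moreover have "c ^ CARD('n) * (1 / c) = c ^ (CARD('n) - 1)"
    using c power_minus_mult[of "CARD('n)" c] by (simp add: field_simps)
  ultimately show ?thesis
    using surface_area_eq[OF K] surface_area_eq[OF cK]
    by (simp add: q_def pderiv_smult pderiv_pcompose poly_pcompose pderiv_pCons)
qed

subsection \<open>Mean width\<close>

lemma bdd_above_inner_compact: "compact A \<Longrightarrow> bdd_above ((\<lambda>y. e \<bullet> y) ` A)"
  by (intro bounded_imp_bdd_above compact_imp_bounded compact_continuous_image continuous_intros)

lemma support_function_ge: "compact A \<Longrightarrow> y \<in> A \<Longrightarrow> e \<bullet> y \<le> support_function A e"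
  unfolding support_function_def by (intro cSUP_upper bdd_above_inner_compact)

lemma support_function_le:
  assumes A: "A \<noteq> {}" and B: "compact B" and sub: "A \<subseteq> B + cball 0 \<delta>"
  shows "support_function A e \<le> support_function B e + \<delta> * norm e"
  unfolding support_function_def[of A]
proof (rule cSUP_least[OF A])
  fix y assume "y \<in> A"
  then obtain b c where y: "y = b + c" "b \<in> B" "c \<in> cball 0 \<delta>" using sub by (meson set_plus_elim subsetD)
  have "e \<bullet> c \<le> norm e * norm c" by (rule norm_cauchy_schwarz)
  also have "\<dots> \<le> norm e * \<delta>" using y by (intro mult_left_mono) auto
  finally show "e \<bullet> y \<le> support_function B e + \<delta> * norm e"
    using support_function_ge[OF B y(2), of e] by (simp add: y(1) inner_add_right mult.commute)
qed

lemma abs_support_function_le: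
  assumes A: "compact A" "A \<noteq> {}" "A \<subseteq> cball 0 R"
  shows "\<bar>support_function A e\<bar> \<le> R * norm e"
proof -
  obtain y where y: "y \<in> A" using A by blast
  have bnd: "\<bar>e \<bullet> z\<bar> \<le> R * norm e" if "z \<in> A" for z
  proof -
    have "norm z \<le> R" using that A by auto
    then show ?thesis
      using Cauchy_Schwarz_ineq2[of e z] mult_left_mono[of "norm z" R "norm e"] by (simp add: mult.commute)
  qed
  have "support_function A e \<le> R * norm e"
    unfolding support_function_def using bnd by (intro cSUP_least[OF A(2)]) (auto simp: abs_le_iff)
  moreover have "- (R * norm e) \<le> support_function A e"
    using bnd[OF y] support_function_ge[OF A(1) y, of e] by (simp add: abs_le_iff)
  ultimately show ?thesis by (simp add: abs_le_iff)
qed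

text \<open>A supremum of linear functionals that are all \<open>R\<close>-Lipschitz is
  \<open>R\<close>-Lipschitz, hence continuous.\<close>

lemma borel_measurable_support_function:
  assumes A: "compact A" "A \<noteq> {}"
  shows "support_function A \<in> borel_measurable borel"
proof -
  obtain R where R: "R > 0" "\<And>x. x \<in> A \<Longrightarrow> norm x \<le> R"
    using compact_imp_bounded[OF A(1)] unfolding bounded_pos by blast
  have le: "support_function A x - support_function A y \<le> R * norm (x - y)" for x y
  proof -
    have "support_function A x \<le> support_function A y + R * norm (x - y)"
      unfolding support_function_def[of A x]
    proof (rule cSUP_least[OF A(2)])
      fix z assume z: "z \<in> A"
      have "x \<bullet> z = y \<bullet> z + (x - y) \<bullet> z" by (simp add: inner_diff_left)
      also have "\<dots> \<le> support_function A y + norm (x - y) * norm z"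
        by (intro add_mono support_function_ge A z norm_cauchy_schwarz)
      also have "\<dots> \<le> support_function A y + R * norm (x - y)"
        using R(2)[OF z] by (simp add: mult.commute[of _ "norm (x - y)"] mult_left_mono)
      finally show "x \<bullet> z \<le> support_function A y + R * norm (x - y)" .
    qed
    then show ?thesis by simp
  qed
  have "R-lipschitz_on UNIV (support_function A)"
  proof (rule lipschitz_onI)
    show "dist (support_function A x) (support_function A y) \<le> R * dist x y" for x y
      using le[of x y] le[of y x] by (simp add: dist_norm abs_le_iff norm_minus_commute)
  qed (use R in simp)
  then show ?thesis
    by (intro borel_measurable_continuous_onI lipschitz_on_continuous_on)
qed

lemma sets_surface_measure: "sets surface_measure = sets (restrict_space borel (sphere 0 1))"
  by (simp add: surface_measure_def)

lemma space_surface_measure: "space surface_measure = sphere 0 1"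
  using sets_eq_imp_space_eq[OF sets_surface_measure] by (simp add: space_restrict_space)

lemma finite_measure_surface_measure: "finite_measure (surface_measure :: 'a::euclidean_space measure)"
proof
  let ?M = "restrict_space lborel (cball 0 1 - {0}) :: 'a measure"
  have meas: "(\<lambda>x. x /\<^sub>R norm x) \<in> measurable ?M (restrict_space borel (sphere 0 1))"
  proof (rule measurable_restrict_space2)
    show "(\<lambda>x. x /\<^sub>R norm x) \<in> space ?M \<rightarrow> sphere 0 1"
      by (auto simp: space_restrict_space)
    show "(\<lambda>x. x /\<^sub>R norm x) \<in> measurable ?M borel"
      by (rule measurable_restrict_space1) simp
  qed
  have "emeasure ?M (space ?M) = emeasure lborel (cball (0::'a) 1 - {0})"
    by (subst emeasure_restrict_space) (auto simp: space_restrict_space)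
  also have "\<dots> \<le> emeasure lborel (cball (0::'a) 1)" by (intro emeasure_mono) auto
  also have "\<dots> < \<infinity>" by (rule emeasure_lborel_cball_finite)
  finally have fin: "emeasure ?M (space ?M) < \<infinity>" .
  have "emeasure (distr ?M (restrict_space borel (sphere 0 1)) (\<lambda>x. x /\<^sub>R norm x)) (sphere 0 1)
      \<le> emeasure ?M (space ?M)"
    using meas by (subst emeasure_distr) (auto intro!: emeasure_mono simp: space_restrict_space sets_restrict_space_iff)
  then have "emeasure (distr ?M (restrict_space borel (sphere 0 1)) (\<lambda>x. x /\<^sub>R norm x)) (sphere 0 1) < \<infinity>"
    using fin by (rule le_less_trans)
  then show "emeasure (surface_measure :: 'a measure) (space surface_measure) \<noteq> \<infinity>"
    unfolding space_surface_measure
    by (simp add: surface_measure_def ennreal_mult_eq_top_iff)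
qed

lemma integrable_support_function:
  fixes A :: "'a::euclidean_space set"
  assumes A: "compact A" "A \<noteq> {}"
  shows "integrable surface_measure (support_function A)"
proof -
  interpret finite_measure "surface_measure :: 'a measure" by (rule finite_measure_surface_measure)
  obtain R where R: "R > 0" "\<And>x. x \<in> A \<Longrightarrow> norm x \<le> R"
    using compact_imp_bounded[OF A(1)] unfolding bounded_pos by blast
  show ?thesis
  proof (rule integrable_const_bound[where B = R])
    show "AE x in surface_measure. norm (support_function A x) \<le> R"
    proof (rule AE_I2)
      fix x :: 'a assume "x \<in> space surface_measure"
      then have "norm x = 1" by (simp add: space_surface_measure)
      then show "norm (support_function A x) \<le> R"
        using abs_support_function_le[OF A, of R x] R by (simp add: subset_iff)
    qed
    have "support_function A \<in> borel_measurable (restrict_space borel (sphere 0 1))"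
      by (intro measurable_restrict_space1 borel_measurable_support_function A)
    then show "support_function A \<in> borel_measurable surface_measure"
      by (subst measurable_cong_sets[OF sets_surface_measure refl])
  qed
qed

lemma hausdorff_uniform_mean_width: "hausdorff_uniform (mean_width :: 'a::euclidean_space set \<Rightarrow> real)"
  unfolding hausdorff_uniform_def
proof (intro allI impI)
  fix R \<epsilon> :: real assume "0 < R" and e: "0 < \<epsilon>"
  interpret finite_measure "surface_measure :: 'a measure" by (rule finite_measure_surface_measure)
  define m where "m = measure (surface_measure :: 'a measure) (space surface_measure)"
  \<comment> \<open>\<open>m\<close> is the total mass of the sphere; adding 1 makes the quotient
    positive whatever \<open>m\<close> is, and \<open>\<delta> * m\<close> stays below
    \<open>\<epsilon>\<close>.\<close>
  define \<delta> where "\<delta> = \<epsilon> / (m + 1)"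
  have m: "m \<ge> 0" by (simp add: m_def)
  have \<delta>: "\<delta> > 0" using e m by (simp add: \<delta>_def)
  have *: "mean_width A \<le> mean_width B + \<epsilon>"
    if A: "compact A" "A \<noteq> {}" and B: "compact B" "B \<noteq> {}" and sub: "A \<subseteq> B + cball 0 \<delta>" for A B :: "'a set"
  proof -
    have "mean_width A \<le> (\<integral>e. support_function B e + \<delta> \<partial>surface_measure)"
      unfolding mean_width_def
    proof (rule integral_mono)
      fix x :: 'a assume "x \<in> space surface_measure"
      then have "norm x = 1" by (simp add: space_surface_measure)
      then show "support_function A x \<le> support_function B x + \<delta>"
        using support_function_le[OF A(2) B(1) sub, of x] by simp
    qed (use A B in \<open>auto intro!: integrable_support_function\<close>)
    also have "\<dots> = mean_width B + \<delta> * m"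
      using integrable_support_function[OF B] by (simp add: mean_width_def m_def mult.commute)
    also have "\<delta> * m \<le> \<epsilon>" using e m by (simp add: \<delta>_def field_simps)
    finally show ?thesis by simp
  qed
  show "\<exists>\<delta>>0. \<forall>A B::'a set. bodies_close R \<delta> A B \<longrightarrow> \<bar>mean_width A - mean_width B\<bar> \<le> \<epsilon>"
  proof (intro exI[of _ \<delta>] conjI allI impI \<delta>)
    fix A B :: "'a set" assume "bodies_close R \<delta> A B"
    then show "\<bar>mean_width A - mean_width B\<bar> \<le> \<epsilon>"
      using *[of A B] *[of B A] unfolding bodies_close_def by simp
  qed
qed

lemma mean_width_scaleR:
  fixes A :: "'a::euclidean_space set"
  assumes A: "compact A" "A \<noteq> {}" and c: "0 < c"
  shows "mean_width ((*\<^sub>R) c ` A) = c * mean_width A"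
proof -
  have "support_function ((*\<^sub>R) c ` A) e = c * support_function A e" for e
  proof (rule antisym)
    show "support_function ((*\<^sub>R) c ` A) e \<le> c * support_function A e"
      unfolding support_function_def[of "(*\<^sub>R) c ` A"] using A c
      by (intro cSUP_least) (auto intro!: support_function_ge)
    have "support_function A e \<le> support_function ((*\<^sub>R) c ` A) e / c"
      unfolding support_function_def[of A]
    proof (rule cSUP_least[OF A(2)])
      fix y assume "y \<in> A"
      then have "e \<bullet> (c *\<^sub>R y) \<le> support_function ((*\<^sub>R) c ` A) e"
        using A by (intro support_function_ge compact_scaling) auto
      then show "e \<bullet> y \<le> support_function ((*\<^sub>R) c ` A) e / c" using c by (simp add: field_simps)
    qed
    then show "c * support_function A e \<le> support_function ((*\<^sub>R) c ` A) e"
      using c by (simp add: field_simps)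
  qed
  then show ?thesis by (simp add: mean_width_def)
qed

subsection \<open>Hulls of nearby sets\<close>

lemma hull_subset_plus_cball:
  fixes X Y :: "'a::euclidean_space set"
  assumes "\<And>x. x \<in> X \<Longrightarrow> \<exists>y\<in>Y. dist x y \<le> \<delta>"
  shows "convex hull X \<subseteq> convex hull Y + cball 0 \<delta>"
proof (rule hull_minimal)
  show "convex (convex hull Y + cball 0 \<delta>)" by (intro convex_set_plus) auto
  show "X \<subseteq> convex hull Y + cball 0 \<delta>"
  proof
    fix x assume "x \<in> X"
    then obtain y where y: "y \<in> Y" "dist x y \<le> \<delta>" using assms by blast
    then have "x - y \<in> cball 0 \<delta>" by (simp add: dist_norm norm_minus_commute)
    from set_plus_intro[OF hull_inc[OF y(1)] this] show "x \<in> convex hull Y + cball 0 \<delta>" by simp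
  qed
qed

text \<open>Hulls are at least as close as the sets that generate them. Later estimates therefore
  compare samples and paths point by point and never look inside a hull.\<close>

lemma hausdorff_uniform_hull:
  fixes \<Phi> :: "'a::euclidean_space set \<Rightarrow> real"
  assumes "hausdorff_uniform \<Phi>" "0 < R" "0 < \<epsilon>"
  obtains \<delta> where "\<delta> > 0" "\<And>X Y. compact X \<Longrightarrow> X \<noteq> {} \<Longrightarrow> compact Y \<Longrightarrow> Y \<noteq> {} \<Longrightarrow>
      X \<subseteq> cball 0 R \<Longrightarrow> Y \<subseteq> cball 0 R \<Longrightarrow> (\<And>x. x \<in> X \<Longrightarrow> \<exists>y\<in>Y. dist x y \<le> \<delta>) \<Longrightarrow>
      (\<And>y. y \<in> Y \<Longrightarrow> \<exists>x\<in>X. dist x y \<le> \<delta>) \<Longrightarrow> \<bar>\<Phi> (convex hull X) - \<Phi> (convex hull Y)\<bar> \<le> \<epsilon>"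
proof -
  obtain \<delta> where 1: "\<delta> > 0" "\<And>A B::'a set. bodies_close R \<delta> A B \<Longrightarrow> \<bar>\<Phi> A - \<Phi> B\<bar> \<le> \<epsilon>"
    using hausdorff_uniformD[OF assms] by blast
  show ?thesis
  proof (rule that[OF 1(1)])
    fix X Y :: "'a set"
    assume *: "compact X" "X \<noteq> {}" "compact Y" "Y \<noteq> {}" "X \<subseteq> cball 0 R" "Y \<subseteq> cball 0 R"
      and xy: "\<And>x. x \<in> X \<Longrightarrow> \<exists>y\<in>Y. dist x y \<le> \<delta>" and yx: "\<And>y. y \<in> Y \<Longrightarrow> \<exists>x\<in>X. dist x y \<le> \<delta>"
    show "\<bar>\<Phi> (convex hull X) - \<Phi> (convex hull Y)\<bar> \<le> \<epsilon>"
    proof (rule 1(2))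
      have "convex hull X \<subseteq> convex hull Y + cball 0 \<delta>" using xy by (rule hull_subset_plus_cball)
      moreover have "convex hull Y \<subseteq> convex hull X + cball 0 \<delta>"
        using yx by (intro hull_subset_plus_cball) (metis dist_commute)
      moreover have "convex hull X \<subseteq> cball 0 R" "convex hull Y \<subseteq> cball 0 R"
        by (intro hull_minimal *(5) convex_cball, intro hull_minimal *(6) convex_cball)
      ultimately show "bodies_close R \<delta> (convex hull X) (convex hull Y)"
        using * by (simp add: bodies_close_def compact_convex_hull)
    qed
  qed
qed

subsection \<open>The square root of a positive semidefinite matrix\<close>

lemma symmetric_matrix_inner:
  fixes A :: "real^'n^'n"
  assumes "transpose A = A"
  shows "x \<bullet> (A *v y) = (A *v x) \<bullet> y"
  by (metis assms dot_lmul_matrix transpose_matrix_vector)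

text \<open>\<open>v\<close> maximises the quadratic form \<open>q\<close> on the unit sphere of
  \<open>W\<close>. The residual \<open>u = A *v v - q v *\<^sub>R v\<close> is orthogonal to
  \<open>v\<close> and lies in \<open>W\<close>; moving from \<open>v\<close> by
  \<open>t *\<^sub>R u\<close> would raise the form by \<open>2 * t * (u \<bullet> u)\<close> to
  first order, so \<open>u = 0\<close>.\<close>

lemma symmetric_eigenvector:
  fixes A :: "real^'n^'n"
  assumes sym: "transpose A = A" and W: "subspace W" "W \<noteq> {0}" and inv: "\<And>x. x \<in> W \<Longrightarrow> A *v x \<in> W"
  obtains v \<mu> where "v \<in> W" "norm v = 1" "A *v v = \<mu> *\<^sub>R v"
proof -
  define q where "q x = x \<bullet> (A *v x)" for x
  obtain w where w: "w \<in> W" "w \<noteq> 0" using W subspace_0 by blast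
  have "compact (sphere 0 1 \<inter> W)" using W(1) by (intro compact_Int_closed closed_subspace) auto
  moreover have "w /\<^sub>R norm w \<in> sphere 0 1 \<inter> W" using w W(1) by (simp add: subspace_scale)
  moreover have "continuous_on (sphere 0 1 \<inter> W) q"
    unfolding q_def by (intro continuous_intros linear_continuous_on) (simp add: matrix_vector_mul_bounded_linear)
  ultimately obtain v where v: "v \<in> sphere 0 1 \<inter> W" and max: "\<And>y. y \<in> sphere 0 1 \<inter> W \<Longrightarrow> q y \<le> q v"
    using continuous_attains_sup[of "sphere 0 1 \<inter> W" q] by blast
  have nv: "v \<bullet> v = 1" using v by (simp add: norm_eq_1)
  have le: "q y \<le> q v * (y \<bullet> y)" if "y \<in> W" for y
  proof (cases "y = 0")
    case True then show ?thesis by (simp add: q_def)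
  next
    case False
    then have "y /\<^sub>R norm y \<in> sphere 0 1 \<inter> W" using that W(1) by (simp add: subspace_scale)
    from max[OF this] have "q y / (norm y)\<^sup>2 \<le> q v"
      by (simp add: q_def matrix_vector_mult_scaleR power2_eq_square divide_simps)
    then show ?thesis using False by (simp add: divide_le_eq power2_norm_eq_inner)
  qed
  define u where "u = A *v v - q v *\<^sub>R v"
  have u: "u \<in> W" using v inv W(1) by (simp add: u_def subspace_diff subspace_scale)
  have uv: "u \<bullet> v = 0" using nv by (simp add: u_def inner_diff_left q_def inner_commute[of "A *v v"])
  have uAv: "u \<bullet> (A *v v) = u \<bullet> u"
    using uv by (simp add: u_def inner_diff_right)
  have key: "2 * t * (u \<bullet> u) \<le> t\<^sup>2 * (q v * (u \<bullet> u) - q u)" for t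
  proof -
    have "q (v + t *\<^sub>R u) = q v + 2 * t * (u \<bullet> u) + t\<^sup>2 * q u"
      using symmetric_matrix_inner[OF sym, of v u] uAv
      by (simp add: q_def matrix_vector_right_distrib matrix_vector_mult_scaleR inner_add_left inner_add_right
          power2_eq_square inner_commute algebra_simps)
    moreover have "(v + t *\<^sub>R u) \<bullet> (v + t *\<^sub>R u) = 1 + t\<^sup>2 * (u \<bullet> u)"
      using nv uv by (simp add: inner_add_left inner_add_right power2_eq_square inner_commute)
    moreover have "v + t *\<^sub>R u \<in> W" using v u W(1) by (simp add: subspace_add subspace_scale)
    ultimately show ?thesis using le[of "v + t *\<^sub>R u"] by (simp add: algebra_simps)
  qed
  have "u \<bullet> u = 0"
  proof (rule ccontr)
    assume "u \<bullet> u \<noteq> 0"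
    then have pos: "u \<bullet> u > 0" by simp
    define c where "c = \<bar>q v * (u \<bullet> u) - q u\<bar> + 1"
    have c: "c > 0" "q v * (u \<bullet> u) - q u \<le> c" by (auto simp: c_def)
    \<comment> \<open>With this choice \<open>t * c\<close> equals \<open>u \<bullet> u\<close>,
      whereas maximality demands at least \<open>2 * (u \<bullet> u)\<close>.\<close>
    define t where "t = (u \<bullet> u) / c"
    have t: "t > 0" using pos c by (simp add: t_def)
    have "t * (2 * (u \<bullet> u)) \<le> t * (t * c)"
      using key[of t] mult_left_mono[OF c(2), of "t\<^sup>2"] by (simp add: power2_eq_square mult.assoc mult.left_commute)
    then have "2 * (u \<bullet> u) \<le> t * c" using t by simp
    then show False using pos c by (simp add: t_def)
  qed
  then have "A *v v = q v *\<^sub>R v" by (simp add: u_def)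
  then show ?thesis using that[of v "q v"] v by simp
qed

text \<open>Completeness is encoded as the expansion of every vector, the form in which matrices are
  evaluated and compared below.\<close>

definition orthonormal_eigenbasis :: "real^'n^'n \<Rightarrow> (real^'n) set \<Rightarrow> (real^'n \<Rightarrow> real) \<Rightarrow> bool" where
  "orthonormal_eigenbasis A S \<mu> \<longleftrightarrow> finite S \<and> (\<forall>v\<in>S. \<forall>w\<in>S. v \<bullet> w = (if v = w then 1 else 0)) \<and>
    (\<forall>v\<in>S. A *v v = \<mu> v *\<^sub>R v) \<and> (\<forall>x. x = (\<Sum>v\<in>S. (v \<bullet> x) *\<^sub>R v))"

text \<open>Take an orthonormal system of eigenvectors of maximal size, which exists because sizes
  are bounded by the dimension. By symmetry its orthogonal complement is invariant under
  \<open>A\<close>, so a nonzero complement would contain one more unit eigenvector.\<close>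

lemma symmetric_spectral:
  fixes A :: "real^'n^'n"
  assumes sym: "transpose A = A"
  obtains S \<mu> where "orthonormal_eigenbasis A S \<mu>"
proof -
  define P where "P S \<longleftrightarrow> finite S \<and> pairwise orthogonal S \<and> (\<forall>v\<in>S. norm v = 1 \<and> (\<exists>\<mu>. A *v v = \<mu> *\<^sub>R v))" for S
  have "P {}" by (simp add: P_def)
  moreover have "card S < Suc CARD('n)" if "P S" for S :: "(real^'n) set"
  proof -
    have "independent S"
      using that by (intro pairwise_orthogonal_independent) (auto simp: P_def)
    then show ?thesis using independent_card_le[of S] by (simp add: less_Suc_eq_le)
  qed
  ultimately obtain S where S: "P S" and max: "\<And>T. P T \<Longrightarrow> card T \<le> card S"
    using ex_has_greatest_nat[of P "{}" card] by metis
  then have fin: "finite S" by (simp add: P_def)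
  have on: "v \<bullet> w = (if v = w then 1 else 0)" if "v \<in> S" "w \<in> S" for v w
    using S that by (auto simp: P_def pairwise_def orthogonal_def norm_eq_1)
  define W where "W = {x. \<forall>v\<in>S. v \<bullet> x = 0}"
  have subW: "subspace W" by (auto simp: W_def subspace_def inner_add_right)
  have W0: "W = {0}"
  proof (rule ccontr)
    assume ne: "W \<noteq> {0}"
    have inv: "A *v x \<in> W" if "x \<in> W" for x
      using that S by (auto simp: W_def P_def symmetric_matrix_inner[OF sym])
    obtain v \<mu> where v: "v \<in> W" "norm v = 1" "A *v v = \<mu> *\<^sub>R v"
      using symmetric_eigenvector[OF sym subW ne inv] by blast
    have "v \<notin> S"
    proof
      assume "v \<in> S"
      then have "v \<bullet> v = 0" using v(1) by (simp add: W_def)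
      then show False using v(2) by simp
    qed
    have "pairwise orthogonal (insert v S)"
      using S v(1) by (auto simp: P_def pairwise_insert W_def orthogonal_def inner_commute)
    then have "P (insert v S)" using S v by (auto simp: P_def)
    then show False using max[of "insert v S"] \<open>v \<notin> S\<close> fin by simp
  qed
  obtain \<mu> where \<mu>: "\<And>v. v \<in> S \<Longrightarrow> A *v v = \<mu> v *\<^sub>R v"
    using S unfolding P_def by metis
  have "x = (\<Sum>v\<in>S. (v \<bullet> x) *\<^sub>R v)" for x
  proof -
    have "w \<bullet> (\<Sum>v\<in>S. (v \<bullet> x) *\<^sub>R v) = w \<bullet> x" if "w \<in> S" for w
    proof -
      have "w \<bullet> (\<Sum>v\<in>S. (v \<bullet> x) *\<^sub>R v) = (\<Sum>v\<in>S. if w = v then v \<bullet> x else 0)"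
        unfolding inner_sum_right using that by (intro sum.cong) (auto simp: on)
      then show ?thesis using that fin by simp
    qed
    then have "x - (\<Sum>v\<in>S. (v \<bullet> x) *\<^sub>R v) \<in> W" by (simp add: W_def inner_diff_right)
    then show ?thesis using W0 by simp
  qed
  then have "orthonormal_eigenbasis A S \<mu>"
    unfolding orthonormal_eigenbasis_def by (intro conjI fin allI ballI on \<mu>)
  then show ?thesis by (rule that)
qed

lemma psd_sqrt_exists:
  fixes A :: "real^'n^'n"
  assumes sym: "transpose A = A" and psd: "\<And>x. 0 \<le> x \<bullet> (A *v x)"
  shows "\<exists>B. transpose B = B \<and> (\<forall>x. 0 \<le> x \<bullet> (B *v x)) \<and> B ** B = A"
proof -
  obtain S \<mu> where basis: "orthonormal_eigenbasis A S \<mu>"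
    by (rule symmetric_spectral[OF sym])
  then have S: "finite S" and on: "\<And>v w. v \<in> S \<Longrightarrow> w \<in> S \<Longrightarrow> v \<bullet> w = (if v = w then 1 else 0)"
    and eig: "\<And>v. v \<in> S \<Longrightarrow> A *v v = \<mu> v *\<^sub>R v"
    unfolding orthonormal_eigenbasis_def by blast+
  have rep: "x = (\<Sum>v\<in>S. (v \<bullet> x) *\<^sub>R v)" for x
    using basis unfolding orthonormal_eigenbasis_def by blast
  have pos: "0 \<le> \<mu> v" if "v \<in> S" for v
    using psd[of v] eig[OF that] on[OF that that] by simp
  \<comment> \<open>The matrix of the sum over \<open>v\<close> of \<open>sqrt (\<mu> v)\<close>
    times the orthogonal projection onto the line of \<open>v\<close>.\<close>
  define B :: "real^'n^'n" where "B = (\<chi> i j. \<Sum>v\<in>S. sqrt (\<mu> v) * v $ i * v $ j)"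
  have B: "B *v x = (\<Sum>v\<in>S. (sqrt (\<mu> v) * (v \<bullet> x)) *\<^sub>R v)" for x
  proof -
    have "(B *v x) $ i = (\<Sum>v\<in>S. (sqrt (\<mu> v) * (v \<bullet> x)) *\<^sub>R v) $ i" for i
    proof -
      have "(B *v x) $ i = (\<Sum>j\<in>UNIV. \<Sum>v\<in>S. sqrt (\<mu> v) * v $ i * v $ j * x $ j)"
        by (simp add: B_def matrix_vector_mult_def sum_distrib_right)
      also have "\<dots> = (\<Sum>v\<in>S. \<Sum>j\<in>UNIV. sqrt (\<mu> v) * v $ i * v $ j * x $ j)" by (rule sum.swap)
      also have "\<dots> = (\<Sum>v\<in>S. (sqrt (\<mu> v) * (v \<bullet> x)) *\<^sub>R v) $ i"
        unfolding inner_vec_def sum_component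
        by (intro sum.cong refl) (simp add: sum_distrib_left sum_distrib_right mult.assoc mult.left_commute mult.commute)
      finally show ?thesis .
    qed
    then show ?thesis by (simp add: vec_eq_iff)
  qed
  have Bv: "B *v v = sqrt (\<mu> v) *\<^sub>R v" if "v \<in> S" for v
  proof -
    have "B *v v = (\<Sum>w\<in>S. if w = v then sqrt (\<mu> v) *\<^sub>R v else 0)"
      unfolding B using that by (intro sum.cong) (auto simp: on)
    then show ?thesis using that S by simp
  qed
  have "transpose B = B" by (simp add: B_def transpose_def vec_eq_iff mult.assoc mult.commute mult.left_commute)
  moreover have "0 \<le> x \<bullet> (B *v x)" for x
  proof -
    have "x \<bullet> (B *v x) = (\<Sum>v\<in>S. sqrt (\<mu> v) * (v \<bullet> x)\<^sup>2)"
      unfolding B inner_sum_right by (intro sum.cong) (auto simp: power2_eq_square inner_commute)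
    also have "\<dots> \<ge> 0" using pos by (intro sum_nonneg) auto
    finally show ?thesis .
  qed
  moreover have "B ** B = A"
  proof (subst matrix_eq, intro allI)
    fix x
    have lin: "M *v (\<Sum>v\<in>S. (v \<bullet> x) *\<^sub>R v) = (\<Sum>v\<in>S. (v \<bullet> x) *\<^sub>R (M *v v))" for M :: "real^'n^'n"
      by (simp add: linear_sum[OF matrix_vector_mul_linear] matrix_vector_mult_scaleR)
    have "(B ** B) *v v = A *v v" if "v \<in> S" for v
      using Bv[OF that] eig[OF that] pos[OF that]
      by (simp add: matrix_vector_mult_scaleR flip: matrix_vector_mul_assoc)
    then have "(\<Sum>v\<in>S. (v \<bullet> x) *\<^sub>R ((B ** B) *v v)) = (\<Sum>v\<in>S. (v \<bullet> x) *\<^sub>R (A *v v))"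
      by (intro sum.cong) auto
    then show "(B ** B) *v x = A *v x"
      unfolding lin[symmetric] rep[of x, symmetric] .
  qed
  ultimately show ?thesis by blast
qed

text \<open>With \<open>D = B - C\<close>, equality of the squares gives
  \<open>B ** D + D ** C = 0\<close>. On an eigenvector \<open>v\<close> of \<open>D\<close> with
  nonzero eigenvalue this makes the nonnegative numbers \<open>v \<bullet> (B *v v)\<close> and
  \<open>v \<bullet> (C *v v)\<close> vanish, hence also \<open>v \<bullet> (D *v v)\<close>, which
  is that eigenvalue.\<close>

lemma psd_sqrt_unique:
  fixes B C :: "real^'n^'n"
  assumes B: "transpose B = B" "\<And>x. 0 \<le> x \<bullet> (B *v x)"
    and C: "transpose C = C" "\<And>x. 0 \<le> x \<bullet> (C *v x)" and eq: "B ** B = C ** C"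
  shows "B = C"
proof -
  define D where "D = B - C"
  have symD: "transpose D = D" using B(1) C(1) by (simp add: D_def transpose_def vec_eq_iff)
  have Dv: "D *v x = B *v x - C *v x" for x by (simp add: D_def matrix_vector_mult_diff_rdistrib)
  obtain S \<mu> where basis: "orthonormal_eigenbasis D S \<mu>"
    by (rule symmetric_spectral[OF symD])
  then have S: "finite S" and on: "\<And>v w. v \<in> S \<Longrightarrow> w \<in> S \<Longrightarrow> v \<bullet> w = (if v = w then 1 else 0)"
    and eig: "\<And>v. v \<in> S \<Longrightarrow> D *v v = \<mu> v *\<^sub>R v"
    unfolding orthonormal_eigenbasis_def by blast+
  have rep: "x = (\<Sum>v\<in>S. (v \<bullet> x) *\<^sub>R v)" for x
    using basis unfolding orthonormal_eigenbasis_def by blast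
  have "\<mu> v = 0" if v: "v \<in> S" for v
  proof (rule ccontr)
    assume ne: "\<mu> v \<noteq> 0"
    have sq: "B *v (B *v v) = C *v (C *v v)" using eq by (simp add: matrix_vector_mul_assoc)
    have "v \<bullet> (B *v (D *v v)) + v \<bullet> (D *v (C *v v)) = 0"
      by (simp add: Dv matrix_vector_mult_diff_distrib inner_diff_right sq)
    moreover have "v \<bullet> (B *v (D *v v)) = \<mu> v * (v \<bullet> (B *v v))"
      by (simp add: eig[OF v] matrix_vector_mult_scaleR)
    moreover have "v \<bullet> (D *v (C *v v)) = \<mu> v * (v \<bullet> (C *v v))"
      by (simp add: symmetric_matrix_inner[OF symD] eig[OF v])
    ultimately have "\<mu> v * (v \<bullet> (B *v v) + v \<bullet> (C *v v)) = 0" by (simp add: distrib_left)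
    then have "v \<bullet> (B *v v) = 0" "v \<bullet> (C *v v) = 0"
      using ne B(2)[of v] C(2)[of v] by auto
    then have "v \<bullet> (D *v v) = 0" by (simp add: Dv inner_diff_right)
    then show False using ne on[OF v v] by (simp add: eig[OF v])
  qed
  then have "D *v x = 0" for x
    using linear_sum[OF matrix_vector_mul_linear, of D "\<lambda>v. (v \<bullet> x) *\<^sub>R v" S] rep[of x] eig
    by (simp add: matrix_vector_mult_scaleR)
  then have "D = 0" by (simp add: matrix_eq)
  then show ?thesis by (simp add: D_def)
qed

lemma
  fixes A :: "real^'n^'n"
  assumes sym: "transpose A = A" and psd: "\<And>x. 0 \<le> x \<bullet> (A *v x)"
  shows transpose_psd_sqrt: "transpose (psd_sqrt A) = psd_sqrt A"
    and psd_sqrt_square: "psd_sqrt A ** psd_sqrt A = A"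
proof -
  have "\<exists>!B. transpose B = B \<and> (\<forall>x. 0 \<le> x \<bullet> (B *v x)) \<and> B ** B = A"
    using psd_sqrt_exists[OF sym psd] psd_sqrt_unique by metis
  from theI'[OF this] show "transpose (psd_sqrt A) = psd_sqrt A" "psd_sqrt A ** psd_sqrt A = A"
    unfolding psd_sqrt_def by auto
qed

text \<open>The determinant of the root squares to \<open>det A\<close>, so its modulus, the factor
  by which volumes change, is \<open>sqrt (det A)\<close>.\<close>

lemma vol_psd_sqrt_image:
  fixes A :: "real^'n^'n"
  assumes sym: "transpose A = A" and psd: "\<And>x. 0 \<le> x \<bullet> (A *v x)" and K: "compact K"
  shows "vol ((*v) (psd_sqrt A) ` K) = vol K * sqrt (det A)"
proof -
  have "det A = det (psd_sqrt A) * det (psd_sqrt A)"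
    by (metis det_mul psd_sqrt_square[OF sym psd])
  then have "\<bar>det (psd_sqrt A)\<bar> = sqrt (det A)" by (simp add: real_sqrt_abs2)
  then show ?thesis
    using measure_linear_image_cart[OF matrix_vector_mul_linear, of K "psd_sqrt A"] K
    by (simp add: vol_def lmeasurable_compact matrix_of_matrix_vector_mul mult.commute)
qed

subsection \<open>Gaussian densities\<close>

text \<open>\<open>s\<close> is the standard deviation of each coordinate. The product form over
  \<open>Basis\<close> lets integrals factorise over the coordinates of
  \<open>lborel\<close>.\<close>

definition gauss_density :: "real \<Rightarrow> 'a::euclidean_space \<Rightarrow> real" where
  "gauss_density s x = (\<Prod>b\<in>Basis. normal_density 0 s (x \<bullet> b))"

lemma borel_measurable_gauss_density [measurable]: "gauss_density s \<in> borel_measurable borel"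
  unfolding gauss_density_def by measurable

lemma gauss_density_nonneg: "0 \<le> gauss_density s x"
  unfolding gauss_density_def by (intro prod_nonneg) auto

lemma nn_integral_gauss_density:
  assumes "0 < s"
  shows "(\<integral>\<^sup>+x. gauss_density s (x::'a::euclidean_space) \<partial>lborel) = 1"
proof -
  interpret prob_space "density lborel (normal_density 0 s)" using assms by (rule prob_space_normal_density)
  have 1: "(\<integral>\<^sup>+x. normal_density 0 s x \<partial>lborel) = 1"
    using emeasure_space_1 by (simp add: emeasure_density)
  have "(\<integral>\<^sup>+x. gauss_density s (x::'a) \<partial>lborel) = (\<integral>\<^sup>+x. (\<Prod>b\<in>Basis. ennreal (normal_density 0 s (x \<bullet> b))) \<partial>(lborel::'a measure))"
    by (simp add: gauss_density_def prod_ennreal)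
  also have "\<dots> = (\<Prod>b\<in>(Basis::'a set). (\<integral>\<^sup>+x. ennreal (normal_density 0 s x) \<partial>lborel))"
    by (rule nn_integral_lborel_prod) auto
  finally show ?thesis by (simp add: 1)
qed

lemma prob_space_gauss_density: "0 < s \<Longrightarrow> prob_space (density lborel (gauss_density s))"
  by (rule prob_spaceI) (simp add: emeasure_density nn_integral_gauss_density)

text \<open>Substituting \<open>s * x\<close> reduces the integral to the characteristic function of
  the standard normal law at \<open>u * s\<close>.\<close>

lemma iexp_normal_density:
  assumes s: "0 < s"
  shows "integrable lborel (\<lambda>x. iexp (u * x) * complex_of_real (normal_density 0 s x))"
    and "(\<integral>x. iexp (u * x) * complex_of_real (normal_density 0 s x) \<partial>lborel) = complex_of_real (exp (- (s\<^sup>2 * u\<^sup>2) / 2))"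
proof -
  interpret prob_space "density lborel (normal_density 0 s)" using s by (rule prob_space_normal_density)
  have 1: "(\<integral>\<^sup>+x. normal_density 0 s x \<partial>lborel) = 1"
    using emeasure_space_1 by (simp add: emeasure_density)
  show "integrable lborel (\<lambda>x. iexp (u * x) * complex_of_real (normal_density 0 s x))"
    by (rule integrableI_bounded) (simp_all add: norm_mult 1)
  have nd: "normal_density 0 s (s * x) = std_normal_density x / s" for x
    using s by (simp add: normal_density_def real_sqrt_mult power_mult_distrib divide_simps)
  have "(\<integral>x. iexp (u * x) * complex_of_real (normal_density 0 s x) \<partial>lborel) =
      s *\<^sub>R (\<integral>x. iexp (u * (0 + s * x)) * complex_of_real (normal_density 0 s (0 + s * x)) \<partial>lborel)"
    using s by (subst lborel_integral_real_affine[where c = s and t = 0]) auto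
  also have "\<dots> = (\<integral>x. s *\<^sub>R (iexp (u * (0 + s * x)) * complex_of_real (normal_density 0 s (0 + s * x))) \<partial>lborel)"
    by simp
  also have "\<dots> = (\<integral>x. std_normal_density x *\<^sub>R iexp ((u * s) * x) \<partial>lborel)"
  proof (intro Bochner_Integration.integral_cong refl)
    fix x
    show "s *\<^sub>R (iexp (u * (0 + s * x)) * complex_of_real (normal_density 0 s (0 + s * x))) =
        std_normal_density x *\<^sub>R iexp ((u * s) * x)"
      unfolding add_0 nd using s by (simp add: scaleR_conv_of_real mult_ac)
  qed
  also have "\<dots> = char std_normal_distribution (u * s)"
    by (simp add: char_def integral_density)
  also have "\<dots> = complex_of_real (exp (- (s\<^sup>2 * u\<^sup>2) / 2))"
    by (simp add: char_std_normal_distribution power_mult_distrib mult.commute)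
  finally show "(\<integral>x. iexp (u * x) * complex_of_real (normal_density 0 s x) \<partial>lborel) = complex_of_real (exp (- (s\<^sup>2 * u\<^sup>2) / 2))" .
qed

lemma iexp_gauss_density:
  fixes u :: "'a::euclidean_space"
  assumes s: "0 < s"
  shows "(\<integral>x. iexp (u \<bullet> x) * complex_of_real (gauss_density s x) \<partial>lborel) = complex_of_real (exp (- (s\<^sup>2 * (u \<bullet> u)) / 2))"
proof -
  interpret product_sigma_finite "\<lambda>_::'a. lborel :: real measure" ..
  define F where "F b y = iexp ((u \<bullet> b) * y) * complex_of_real (normal_density 0 s y)" for b y
  have eq: "iexp (u \<bullet> x) * complex_of_real (gauss_density s x) = (\<Prod>b\<in>Basis. F b (x \<bullet> b))" for x
  proof -
    have "iexp (u \<bullet> x) = (\<Prod>b\<in>Basis. iexp ((u \<bullet> b) * (x \<bullet> b)))"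
      by (subst euclidean_inner) (simp add: sum_distrib_left exp_sum)
    then show ?thesis by (simp add: F_def gauss_density_def prod.distrib)
  qed
  have "(\<integral>x. iexp (u \<bullet> x) * complex_of_real (gauss_density s x) \<partial>lborel) =
      (\<integral>x. (\<Prod>b\<in>Basis. F b (x \<bullet> b)) \<partial>distr (\<Pi>\<^sub>M b\<in>Basis. lborel) borel (\<lambda>f. \<Sum>b\<in>Basis. f b *\<^sub>R b))"
    unfolding eq lborel_eq[symmetric] ..
  also have "\<dots> = (\<integral>f. (\<Prod>b\<in>Basis. F b ((\<Sum>c\<in>Basis. f c *\<^sub>R c) \<bullet> b)) \<partial>(\<Pi>\<^sub>M b\<in>Basis. lborel))"
    by (rule integral_distr) (auto simp: F_def)
  also have "\<dots> = (\<integral>f. (\<Prod>b\<in>Basis. F b (f b)) \<partial>(\<Pi>\<^sub>M b\<in>Basis. lborel))"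
    by (simp cong: prod.cong)
  also have "\<dots> = (\<Prod>b\<in>Basis. integral\<^sup>L lborel (F b))"
  proof (rule product_integral_prod)
    show "integrable lborel (F b)" for b :: 'a
      unfolding F_def by (rule iexp_normal_density(1)[OF s])
  qed simp
  also have "\<dots> = (\<Prod>b\<in>Basis. complex_of_real (exp (- (s\<^sup>2 * (u \<bullet> b)\<^sup>2) / 2)))"
    unfolding F_def by (intro prod.cong refl iexp_normal_density[OF s])
  also have "\<dots> = complex_of_real (exp (\<Sum>b\<in>Basis. - (s\<^sup>2 * (u \<bullet> b)\<^sup>2) / 2))"
    by (simp add: exp_sum)
  also have "(\<Sum>b\<in>Basis. - (s\<^sup>2 * (u \<bullet> b)\<^sup>2) / 2) = - (s\<^sup>2 * (u \<bullet> u)) / 2"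
    by (subst euclidean_inner[of u u])
       (simp add: sum_distrib_left sum_divide_distrib sum_negf power2_eq_square)
  finally show ?thesis .
qed

lemma gauss_density_eq:
  fixes z :: "'a::euclidean_space"
  assumes s: "0 < s"
  shows "gauss_density s z = gauss_density s (0::'a) * exp (- (z \<bullet> z) / (2 * s\<^sup>2))"
proof -
  have "gauss_density s z = (\<Prod>b\<in>Basis. normal_density 0 s 0 * exp (- ((z \<bullet> b)\<^sup>2) / (2 * s\<^sup>2)))"
    unfolding gauss_density_def by (intro prod.cong) (auto simp: normal_density_def)
  also have "\<dots> = gauss_density s (0::'a) * exp (\<Sum>b\<in>Basis. - ((z \<bullet> b)\<^sup>2) / (2 * s\<^sup>2))"
    by (simp add: gauss_density_def prod.distrib exp_sum)
  also have "(\<Sum>b\<in>Basis. - ((z \<bullet> b)\<^sup>2) / (2 * s\<^sup>2)) = - (z \<bullet> z) / (2 * s\<^sup>2)"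
    by (subst euclidean_inner[of z z]) (simp add: sum_divide_distrib sum_negf power2_eq_square)
  finally show ?thesis .
qed


text \<open>Fourier self-duality of the Gaussian: up to its value at 0, the density with deviation
  \<open>s\<close> is the characteristic function of the Gaussian with deviation
  \<open>1 / s\<close>. This takes the place of a general inversion formula.\<close>

lemma gauss_density_inversion:
  fixes z :: "'a::euclidean_space"
  assumes s: "0 < s"
  shows "complex_of_real (gauss_density s z) = complex_of_real (gauss_density s (0::'a)) *
    (\<integral>u. iexp (z \<bullet> u) \<partial>density lborel (gauss_density (1 / s)))"
proof -
  have "(\<integral>u. iexp (z \<bullet> u) \<partial>density lborel (gauss_density (1 / s))) =
      (\<integral>u. iexp (z \<bullet> u) * complex_of_real (gauss_density (1 / s) u) \<partial>lborel)"
    by (subst integral_density) (auto simp: gauss_density_nonneg scaleR_conv_of_real mult.commute)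
  also have "\<dots> = complex_of_real (exp (- ((1 / s)\<^sup>2 * (z \<bullet> z)) / 2))"
    using s by (intro iexp_gauss_density) auto
  finally show ?thesis using gauss_density_eq[OF s, of z] by (simp add: power_divide)
qed

lemma integral_gauss_density_shift:
  fixes f :: "'a::euclidean_space \<Rightarrow> real"
  assumes s: "0 < s" and f[measurable]: "f \<in> borel_measurable borel"
  shows "(\<integral>y. f y * gauss_density s (y - x) \<partial>lborel) = (\<integral>w. f (x + s *\<^sub>R w) \<partial>density lborel (gauss_density 1))"
proof -
  have nd: "s * normal_density 0 s (s * y) = std_normal_density y" for y
    using s by (simp add: normal_density_def real_sqrt_mult power_mult_distrib divide_simps)
  have "s ^ DIM('a) * gauss_density s (s *\<^sub>R w) = gauss_density 1 w" for w :: 'a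
  proof -
    have "s ^ DIM('a) * gauss_density s (s *\<^sub>R w) = (\<Prod>b\<in>(Basis::'a set). s * normal_density 0 s (s * (w \<bullet> b)))"
      by (simp add: gauss_density_def prod.distrib)
    then show ?thesis unfolding nd gauss_density_def .
  qed
  then have gd: "\<bar>s\<bar> ^ DIM('a) * (f (x + s *\<^sub>R w) * gauss_density s (x + s *\<^sub>R w - x)) = f (x + s *\<^sub>R w) * gauss_density 1 w" for w :: 'a
    using s by (simp add: mult_ac)
  have "(\<integral>y. f y * gauss_density s (y - x) \<partial>lborel) =
      (\<integral>y. f y * gauss_density s (y - x) \<partial>density (distr lborel borel (\<lambda>w. x + s *\<^sub>R w)) (\<lambda>_. ennreal (\<bar>s\<bar> ^ DIM('a))))"
    using lborel_affine[of s x] s by simp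
  also have "\<dots> = (\<integral>w. \<bar>s\<bar> ^ DIM('a) * (f (x + s *\<^sub>R w) * gauss_density s (x + s *\<^sub>R w - x)) \<partial>lborel)"
    by (subst integral_density) (auto simp: integral_distr)
  also have "\<dots> = (\<integral>w. f (x + s *\<^sub>R w) \<partial>density lborel (gauss_density 1))"
    unfolding gd by (subst integral_density) (auto simp: gauss_density_nonneg mult.commute)
  finally show ?thesis .
qed

subsection \<open>Levy's continuity theorem in several dimensions\<close>

text \<open>Inf-convolution approximates a bounded continuous function from below by Lipschitz functions.\<close>

definition weak_lipschitz :: "(nat \<Rightarrow> 'a::euclidean_space measure) \<Rightarrow> 'a measure \<Rightarrow> bool" where
  "weak_lipschitz \<mu> \<nu> \<longleftrightarrow> (\<forall>(f::'a \<Rightarrow> real) B L. (\<forall>x. \<bar>f x\<bar> \<le> B) \<longrightarrow> L-lipschitz_on UNIV f \<longrightarrow>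
     (\<lambda>n. integral\<^sup>L (\<mu> n) f) \<longlonglongrightarrow> integral\<^sup>L \<nu> f)"

lemma lipschitz_borel_measurable:
  fixes f :: "'a::euclidean_space \<Rightarrow> real"
  shows "L-lipschitz_on UNIV f \<Longrightarrow> f \<in> borel_measurable borel"
  by (intro borel_measurable_continuous_onI lipschitz_on_continuous_on)

context
  fixes \<nu> :: "'a::euclidean_space measure" and s :: real
  assumes \<nu>: "prob_space \<nu>" and sets_\<nu> [measurable_cong]: "sets \<nu> = sets borel" and s: "0 < s"
begin

interpretation \<nu>: prob_space \<nu> by (rule \<nu>)

text \<open>The density of \<open>X + s Z\<close>, where \<open>X\<close> has law
  \<open>\<nu>\<close> and \<open>Z\<close> is an independent standard Gaussian. It exists even if
  \<open>\<nu>\<close> is singular.\<close>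

definition smoothed :: "'a \<Rightarrow> real" where
  "smoothed y = (\<integral>x. gauss_density s (y - x) \<partial>\<nu>)"

text \<open>Gaussian inversion under the integral, then Fubini. The measure \<open>\<nu>\<close> now
  enters through its characteristic function only, inside an integrand bounded by 1, which is the
  form for dominated convergence.\<close>

lemma smoothed_char:
  "complex_of_real (smoothed y) = complex_of_real (gauss_density s (0::'a)) *
     (\<integral>u. iexp (y \<bullet> u) * (\<integral>x. iexp ((- u) \<bullet> x) \<partial>\<nu>) \<partial>density lborel (gauss_density (1 / s)))"
proof -
  define \<gamma> where "\<gamma> = density (lborel::'a measure) (gauss_density (1 / s))"
  interpret \<gamma>: prob_space \<gamma> unfolding \<gamma>_def using s by (intro prob_space_gauss_density) simp
  have [measurable_cong]: "sets \<gamma> = sets borel" by (simp add: \<gamma>_def)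
  interpret P: pair_prob_space \<nu> \<gamma> ..
  have int: "integrable (\<nu> \<Otimes>\<^sub>M \<gamma>) (\<lambda>(x, u). iexp ((y - x) \<bullet> u))"
    by (rule P.integrable_const_bound[where B = 1]) (auto simp: split_beta)
  have "complex_of_real (smoothed y) = (\<integral>x. complex_of_real (gauss_density s (y - x)) \<partial>\<nu>)"
    by (simp add: smoothed_def)
  also have "\<dots> = complex_of_real (gauss_density s (0::'a)) * (\<integral>x. (\<integral>u. iexp ((y - x) \<bullet> u) \<partial>\<gamma>) \<partial>\<nu>)"
    unfolding \<gamma>_def by (subst gauss_density_inversion[OF s]) simp
  also have "(\<integral>x. (\<integral>u. iexp ((y - x) \<bullet> u) \<partial>\<gamma>) \<partial>\<nu>) = (\<integral>u. (\<integral>x. iexp ((y - x) \<bullet> u) \<partial>\<nu>) \<partial>\<gamma>)"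
    using P.Fubini_integral[OF int] by simp
  also have "\<dots> = (\<integral>u. iexp (y \<bullet> u) * (\<integral>x. iexp ((- u) \<bullet> x) \<partial>\<nu>) \<partial>\<gamma>)"
  proof (intro Bochner_Integration.integral_cong refl)
    fix u
    have "iexp ((y - x) \<bullet> u) = iexp (y \<bullet> u) * iexp ((- u) \<bullet> x)" for x
      by (simp add: inner_diff_left inner_commute flip: exp_add) (simp add: algebra_simps)
    then show "(\<integral>x. iexp ((y - x) \<bullet> u) \<partial>\<nu>) = iexp (y \<bullet> u) * (\<integral>x. iexp ((- u) \<bullet> x) \<partial>\<nu>)"
      by simp
  qed
  finally show ?thesis unfolding \<gamma>_def .
qed

lemma
  fixes f :: "'a \<Rightarrow> real"
  assumes f[measurable]: "f \<in> borel_measurable borel" and B: "\<And>x. \<bar>f x\<bar> \<le> B"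
  shows integrable_smoothed: "integrable lborel (\<lambda>y. f y * smoothed y)"
    and integral_smoothed: "(\<integral>y. f y * smoothed y \<partial>lborel) =
      (\<integral>x. (\<integral>w. f (x + s *\<^sub>R w) \<partial>density lborel (gauss_density 1)) \<partial>\<nu>)"
proof -
  have B0: "0 \<le> B" using B[of 0] by simp
  interpret P: pair_sigma_finite \<nu> "lborel :: 'a measure"
    by (intro pair_sigma_finite.intro \<nu>.sigma_finite_measure_axioms lborel.sigma_finite_measure_axioms)
  have g: "integrable lborel (\<lambda>y. gauss_density s (y - x))" "(\<integral>y. gauss_density s (y - x) \<partial>lborel) = 1" for x :: 'a
  proof -
    have "(\<integral>y. 1 * gauss_density s (y - x) \<partial>lborel) = (\<integral>w. 1 \<partial>density lborel (gauss_density 1 :: 'a \<Rightarrow> real))"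
      using s by (rule integral_gauss_density_shift) simp
    also have "\<dots> = 1" using prob_space.prob_space[OF prob_space_gauss_density[of 1]] by simp
    finally show *: "(\<integral>y. gauss_density s (y - x) \<partial>lborel) = 1" by simp
    \<comment> \<open>A function that is not integrable has Bochner integral 0, but this integral
      was just found to be 1.\<close>
    show "integrable lborel (\<lambda>y. gauss_density s (y - x))"
      by (rule ccontr) (use * in \<open>simp add: not_integrable_integral_eq\<close>)
  qed
  have bound: "\<bar>f y * gauss_density s (y - x)\<bar> \<le> B * gauss_density s (y - x)" for x y
    using B[of y] gauss_density_nonneg[of s "y - x"] by (simp add: abs_mult mult_right_mono)
  have fg: "integrable lborel (\<lambda>y. f y * gauss_density s (y - x))" for x
    by (rule Bochner_Integration.integrable_bound[where f = "\<lambda>y. B * gauss_density s (y - x)"])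
       (use g bound B0 in \<open>auto simp: gauss_density_nonneg\<close>)
  have int: "integrable (\<nu> \<Otimes>\<^sub>M lborel) (\<lambda>(x, y). f y * gauss_density s (y - x))"
  proof (rule P.Fubini_integrable)
    show "(\<lambda>(x, y). f y * gauss_density s (y - x)) \<in> borel_measurable (\<nu> \<Otimes>\<^sub>M lborel)" by measurable
    show "AE x in \<nu>. integrable lborel (\<lambda>y. case (x, y) of (x, y) \<Rightarrow> f y * gauss_density s (y - x))"
      using fg by simp
    show "integrable \<nu> (\<lambda>x. \<integral>y. norm (case (x, y) of (x, y) \<Rightarrow> f y * gauss_density s (y - x)) \<partial>lborel)"
    proof (rule \<nu>.integrable_const_bound[where B = B])
      show "AE x in \<nu>. norm (\<integral>y. norm (case (x, y) of (x, y) \<Rightarrow> f y * gauss_density s (y - x)) \<partial>lborel) \<le> B"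
      proof (rule AE_I2)
        fix x
        have "norm (\<integral>y. norm (f y * gauss_density s (y - x)) \<partial>lborel) = (\<integral>y. norm (f y * gauss_density s (y - x)) \<partial>lborel)"
          by (simp add: integral_nonneg)
        also have "\<dots> \<le> (\<integral>y. B * gauss_density s (y - x) \<partial>lborel)"
          using g fg bound by (intro integral_mono) auto
        also have "\<dots> = B" using g by simp
        finally show "norm (\<integral>y. norm (case (x, y) of (x, y) \<Rightarrow> f y * gauss_density s (y - x)) \<partial>lborel) \<le> B" by simp
      qed
    qed measurable
  qed
  have eq: "(\<integral>x. f y * gauss_density s (y - x) \<partial>\<nu>) = f y * smoothed y" for y
    by (simp add: smoothed_def)
  show "integrable lborel (\<lambda>y. f y * smoothed y)"
    using P.integrable_snd[OF int] unfolding eq .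
  have "(\<integral>y. f y * smoothed y \<partial>lborel) = (\<integral>x. (\<integral>y. f y * gauss_density s (y - x) \<partial>lborel) \<partial>\<nu>)"
    using P.Fubini_integral[OF int] unfolding eq by simp
  also have "\<dots> = (\<integral>x. (\<integral>w. f (x + s *\<^sub>R w) \<partial>density lborel (gauss_density 1)) \<partial>\<nu>)"
    by (subst integral_gauss_density_shift[OF s f]) simp
  finally show "(\<integral>y. f y * smoothed y \<partial>lborel) =
      (\<integral>x. (\<integral>w. f (x + s *\<^sub>R w) \<partial>density lborel (gauss_density 1)) \<partial>\<nu>)" .
qed

lemma smoothed_nonneg: "0 \<le> smoothed y"
  unfolding smoothed_def by (intro Bochner_Integration.integral_nonneg) (simp add: gauss_density_nonneg)

lemma smoothed_integral_1: "integrable lborel smoothed" "(\<integral>y. smoothed y \<partial>lborel) = 1"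
proof -
  interpret \<gamma>: prob_space "density (lborel::'a measure) (gauss_density 1)"
    by (intro prob_space_gauss_density) simp
  show "integrable lborel smoothed" using integrable_smoothed[of "\<lambda>_. 1" 1] by simp
  show "(\<integral>y. smoothed y \<partial>lborel) = 1"
    using integral_smoothed[of "\<lambda>_. 1" 1] \<gamma>.prob_space \<nu>.prob_space by simp
qed

end

text \<open>The masses agree, so the L1 distance is twice the integral of the positive part of
  \<open>q - p n\<close>, and that part is dominated by \<open>q\<close>.\<close>

lemma scheffe:
  fixes p :: "nat \<Rightarrow> 'a \<Rightarrow> real"
  assumes int: "\<And>n. integrable M (p n)" "integrable M q" and nn: "\<And>n x. 0 \<le> p n x" "\<And>x. 0 \<le> q x"
    and eq: "\<And>n. integral\<^sup>L M (p n) = integral\<^sup>L M q" and lim: "\<And>x. (\<lambda>n. p n x) \<longlonglongrightarrow> q x"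
  shows "(\<lambda>n. \<integral>x. \<bar>p n x - q x\<bar> \<partial>M) \<longlonglongrightarrow> 0"
proof -
  have [measurable]: "p n \<in> borel_measurable M" "q \<in> borel_measurable M" for n using int by auto
  have "(\<lambda>n. \<integral>x. max 0 (q x - p n x) \<partial>M) \<longlonglongrightarrow> (\<integral>x. 0 \<partial>M)"
  proof (rule integral_dominated_convergence[where w = q])
    show "AE x in M. (\<lambda>n. max 0 (q x - p n x)) \<longlonglongrightarrow> 0"
    proof (rule AE_I2)
      fix x
      have "(\<lambda>n. max 0 (q x - p n x)) \<longlonglongrightarrow> max 0 (q x - q x)" by (intro tendsto_intros lim)
      then show "(\<lambda>n. max 0 (q x - p n x)) \<longlonglongrightarrow> 0" by simp
    qed
    show "AE x in M. norm (max 0 (q x - p n x)) \<le> q x" for n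
      using nn by (intro AE_I2) (simp add: max_def)
  qed (use int in auto)
  then have "(\<lambda>n. 2 * (\<integral>x. max 0 (q x - p n x) \<partial>M)) \<longlonglongrightarrow> 2 * 0" by (intro tendsto_intros) simp
  moreover have "2 * (\<integral>x. max 0 (q x - p n x) \<partial>M) = (\<integral>x. \<bar>p n x - q x\<bar> \<partial>M)" for n
  proof -
    have "(\<integral>x. \<bar>p n x - q x\<bar> \<partial>M) = (\<integral>x. 2 * max 0 (q x - p n x) + (p n x - q x) \<partial>M)"
      by (intro Bochner_Integration.integral_cong) (auto simp: max_def)
    also have "\<dots> = 2 * (\<integral>x. max 0 (q x - p n x) \<partial>M) + (integral\<^sup>L M (p n) - integral\<^sup>L M q)"
      using int by (subst Bochner_Integration.integral_add) auto
    finally show ?thesis using eq by simp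
  qed
  ultimately show ?thesis by simp
qed

text \<open>The right-hand side does not mention \<open>\<nu>\<close>, so smoothing costs the same
  for every member of a sequence. The cap \<open>2 * B\<close> keeps the integrand bounded, whence
  the cost tends to 0 with \<open>s\<close> by dominated convergence.\<close>

lemma abs_integral_diff_gauss_shift_le:
  fixes f :: "'a::euclidean_space \<Rightarrow> real"
  assumes \<nu>: "prob_space \<nu>" "sets \<nu> = sets borel" and L: "L-lipschitz_on UNIV f" and B: "\<And>x. \<bar>f x\<bar> \<le> B" and s: "0 < s"
  shows "\<bar>(\<integral>x. (\<integral>w. f (x + s *\<^sub>R w) \<partial>density lborel (gauss_density 1)) \<partial>\<nu>) - integral\<^sup>L \<nu> f\<bar>
    \<le> (\<integral>w. min (2 * B) (L * s * norm w) \<partial>density lborel (gauss_density 1 :: 'a \<Rightarrow> real))"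
proof -
  interpret \<nu>: prob_space \<nu> by (rule \<nu>)
  note [measurable_cong] = \<nu>(2)
  define \<gamma> where "\<gamma> = density (lborel::'a measure) (gauss_density 1)"
  interpret \<gamma>: prob_space \<gamma> unfolding \<gamma>_def by (intro prob_space_gauss_density) simp
  have [measurable_cong]: "sets \<gamma> = sets borel" by (simp add: \<gamma>_def)
  have f[measurable]: "f \<in> borel_measurable borel" using L by (rule lipschitz_borel_measurable)
  have L0: "0 \<le> L" using L by (rule lipschitz_on_nonneg)
  have B0: "0 \<le> B" using B[of 0] by simp
  have if1: "integrable \<gamma> (\<lambda>w. f (x + s *\<^sub>R w))" for x
    using B by (intro \<gamma>.integrable_const_bound[where B = B]) auto
  have im: "integrable \<gamma> (\<lambda>w. min (2 * B) (L * s * norm w))"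
    using L0 B0 s by (intro \<gamma>.integrable_const_bound[where B = "2 * B"]) auto
  have *: "\<bar>(\<integral>w. f (x + s *\<^sub>R w) \<partial>\<gamma>) - f x\<bar> \<le> (\<integral>w. min (2 * B) (L * s * norm w) \<partial>\<gamma>)" for x
  proof -
    have "(\<integral>w. f (x + s *\<^sub>R w) \<partial>\<gamma>) - f x = (\<integral>w. f (x + s *\<^sub>R w) - f x \<partial>\<gamma>)"
      using if1 by (subst Bochner_Integration.integral_diff) (auto simp: \<gamma>.prob_space)
    also have "\<bar>\<dots>\<bar> \<le> (\<integral>w. \<bar>f (x + s *\<^sub>R w) - f x\<bar> \<partial>\<gamma>)" by (rule integral_abs_bound)
    also have "\<dots> \<le> (\<integral>w. min (2 * B) (L * s * norm w) \<partial>\<gamma>)"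
    proof (rule integral_mono)
      fix w
      have "\<bar>f (x + s *\<^sub>R w) - f x\<bar> \<le> L * (s * norm w)"
        using lipschitz_onD[OF L, of "x + s *\<^sub>R w" x] s by (simp add: dist_norm)
      moreover have "\<bar>f (x + s *\<^sub>R w) - f x\<bar> \<le> 2 * B"
        using B[of x] B[of "x + s *\<^sub>R w"] by linarith
      ultimately show "\<bar>f (x + s *\<^sub>R w) - f x\<bar> \<le> min (2 * B) (L * s * norm w)" by (simp add: mult.assoc)
    qed (use if1 im in auto)
    finally show ?thesis .
  qed
  have "integrable \<nu> (\<lambda>x. \<integral>w. f (x + s *\<^sub>R w) \<partial>\<gamma>)"
  proof (rule \<nu>.integrable_const_bound[where B = B])
    show "AE x in \<nu>. norm (\<integral>w. f (x + s *\<^sub>R w) \<partial>\<gamma>) \<le> B"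
    proof (rule AE_I2)
      fix x
      have "norm (\<integral>w. f (x + s *\<^sub>R w) \<partial>\<gamma>) \<le> (\<integral>w. norm (f (x + s *\<^sub>R w)) \<partial>\<gamma>)" by (rule integral_norm_bound)
      also have "\<dots> \<le> (\<integral>w. B \<partial>\<gamma>)" using if1 B by (intro integral_mono) auto
      finally show "norm (\<integral>w. f (x + s *\<^sub>R w) \<partial>\<gamma>) \<le> B" by (simp add: \<gamma>.prob_space)
    qed
  qed measurable
  moreover have "integrable \<nu> f" using B by (intro \<nu>.integrable_const_bound[where B = B]) auto
  ultimately have int: "integrable \<nu> (\<lambda>x. (\<integral>w. f (x + s *\<^sub>R w) \<partial>\<gamma>) - f x)"
    and diff: "(\<integral>x. (\<integral>w. f (x + s *\<^sub>R w) \<partial>\<gamma>) \<partial>\<nu>) - integral\<^sup>L \<nu> f = (\<integral>x. (\<integral>w. f (x + s *\<^sub>R w) \<partial>\<gamma>) - f x \<partial>\<nu>)"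
    by auto
  have "\<bar>(\<integral>x. (\<integral>w. f (x + s *\<^sub>R w) \<partial>\<gamma>) \<partial>\<nu>) - integral\<^sup>L \<nu> f\<bar> \<le> (\<integral>x. \<bar>(\<integral>w. f (x + s *\<^sub>R w) \<partial>\<gamma>) - f x\<bar> \<partial>\<nu>)"
    unfolding diff by (rule integral_abs_bound)
  also have "\<dots> \<le> (\<integral>x. (\<integral>w. min (2 * B) (L * s * norm w) \<partial>\<gamma>) \<partial>\<nu>)"
    using int * by (intro integral_mono) auto
  also have "\<dots> = (\<integral>w. min (2 * B) (L * s * norm w) \<partial>\<gamma>)" by (simp add: \<nu>.prob_space)
  finally show ?thesis unfolding \<gamma>_def .
qed

text \<open>At a fixed scale \<open>s\<close>, characteristic functions give pointwise convergence
  of the smoothed densities, and Scheffe's lemma turns this into convergence in L1, against which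
  \<open>f\<close> is merely bounded. Smoothing costs at most \<open>e s\<close> uniformly along the
  sequence, so \<open>s\<close> is chosen first and \<open>n\<close> afterwards.\<close>

theorem levy_continuity_lipschitz:
  fixes \<mu> :: "nat \<Rightarrow> 'a::euclidean_space measure"
  assumes \<mu>: "\<And>n. prob_space (\<mu> n)" "\<And>n. sets (\<mu> n) = sets borel" and \<nu>: "prob_space \<nu>" "sets \<nu> = sets borel"
    and char: "\<And>u. (\<lambda>n. \<integral>x. iexp (u \<bullet> x) \<partial>\<mu> n) \<longlonglongrightarrow> (\<integral>x. iexp (u \<bullet> x) \<partial>\<nu>)"
  shows "weak_lipschitz \<mu> \<nu>"
  unfolding weak_lipschitz_def
proof (intro allI impI)
  fix f :: "'a \<Rightarrow> real" and B L assume "\<forall>x. \<bar>f x\<bar> \<le> B" and L: "L-lipschitz_on UNIV f"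
  then have B: "\<And>x. \<bar>f x\<bar> \<le> B" by blast
  have f[measurable]: "f \<in> borel_measurable borel" using L by (rule lipschitz_borel_measurable)
  have B0: "0 \<le> B" using B[of 0] by simp
  have L0: "0 \<le> L" using L by (rule lipschitz_on_nonneg)
  define \<gamma> where "\<gamma> = density (lborel::'a measure) (gauss_density 1)"
  interpret \<gamma>: prob_space \<gamma> unfolding \<gamma>_def by (intro prob_space_gauss_density) simp
  have [measurable_cong]: "sets \<gamma> = sets borel" by (simp add: \<gamma>_def)
  define J where "J s \<nu> = (\<integral>x. (\<integral>w. f (x + s *\<^sub>R w) \<partial>\<gamma>) \<partial>\<nu>)" for s and \<nu> :: "'a measure"
  define e where "e s = (\<integral>w. min (2 * B) (L * s * norm w) \<partial>\<gamma>)" for s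
  have conv: "(\<lambda>n. J s (\<mu> n)) \<longlonglongrightarrow> J s \<nu>" if s: "0 < s" for s
  proof -
    define G where "G = density (lborel::'a measure) (gauss_density (1 / s))"
    interpret G: prob_space G unfolding G_def using s by (intro prob_space_gauss_density) simp
    have [measurable_cong]: "sets G = sets borel" by (simp add: G_def)
    have cm: "(\<lambda>u. \<integral>x. iexp ((- u) \<bullet> x) \<partial>\<rho>) \<in> borel_measurable borel"
      if "prob_space \<rho>" "sets \<rho> = sets borel" for \<rho> :: "'a measure"
    proof -
      interpret \<rho>: prob_space \<rho> by fact
      note [measurable_cong] = that(2)
      show ?thesis by measurable
    qed
    have lim: "(\<lambda>n. smoothed (\<mu> n) s y) \<longlonglongrightarrow> smoothed \<nu> s y" for y
    proof -
      have "(\<lambda>n. \<integral>u. iexp (y \<bullet> u) * (\<integral>x. iexp ((- u) \<bullet> x) \<partial>\<mu> n) \<partial>G) \<longlonglongrightarrow>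
          (\<integral>u. iexp (y \<bullet> u) * (\<integral>x. iexp ((- u) \<bullet> x) \<partial>\<nu>) \<partial>G)"
      proof (rule integral_dominated_convergence[where w = "\<lambda>_. 1"])
        show "AE u in G. (\<lambda>n. iexp (y \<bullet> u) * (\<integral>x. iexp ((- u) \<bullet> x) \<partial>\<mu> n)) \<longlonglongrightarrow> iexp (y \<bullet> u) * (\<integral>x. iexp ((- u) \<bullet> x) \<partial>\<nu>)"
          by (intro AE_I2 tendsto_intros char)
        show "AE u in G. norm (iexp (y \<bullet> u) * (\<integral>x. iexp ((- u) \<bullet> x) \<partial>\<mu> n)) \<le> 1" for n
        proof (rule AE_I2)
          fix u
          interpret \<mu>: prob_space "\<mu> n" by fact
          have "norm (\<integral>x. iexp ((- u) \<bullet> x) \<partial>\<mu> n) \<le> (\<integral>x. norm (iexp ((- u) \<bullet> x)) \<partial>\<mu> n)"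
            by (rule integral_norm_bound)
          then show "norm (iexp (y \<bullet> u) * (\<integral>x. iexp ((- u) \<bullet> x) \<partial>\<mu> n)) \<le> 1"
            by (simp add: norm_mult \<mu>.prob_space)
        qed
        show "(\<lambda>u. iexp (y \<bullet> u) * (\<integral>x. iexp ((- u) \<bullet> x) \<partial>\<nu>)) \<in> borel_measurable G"
          using cm[OF \<nu>] by simp
        show "(\<lambda>u. iexp (y \<bullet> u) * (\<integral>x. iexp ((- u) \<bullet> x) \<partial>\<mu> n)) \<in> borel_measurable G" for n
          using cm[OF \<mu>] by simp
      qed simp
      then have "(\<lambda>n. complex_of_real (smoothed (\<mu> n) s y)) \<longlonglongrightarrow> complex_of_real (smoothed \<nu> s y)"
        unfolding smoothed_char[OF \<mu> s] smoothed_char[OF \<nu> s] G_def by (intro tendsto_intros)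
      then show ?thesis by (simp add: tendsto_of_real_iff)
    qed
    have sch: "(\<lambda>n. \<integral>y. \<bar>smoothed (\<mu> n) s y - smoothed \<nu> s y\<bar> \<partial>lborel) \<longlonglongrightarrow> 0"
      by (rule scheffe) (simp_all add: lim smoothed_integral_1 \<mu> \<nu> s smoothed_nonneg)
    have "(\<lambda>n. J s (\<mu> n) - J s \<nu>) \<longlonglongrightarrow> 0"
    proof (rule Lim_null_comparison)
      show "\<forall>\<^sub>F n in sequentially. norm (J s (\<mu> n) - J s \<nu>) \<le> B * (\<integral>y. \<bar>smoothed (\<mu> n) s y - smoothed \<nu> s y\<bar> \<partial>lborel)"
      proof (intro always_eventually allI)
        fix n
        have "J s (\<mu> n) - J s \<nu> = (\<integral>y. f y * smoothed (\<mu> n) s y \<partial>lborel) - (\<integral>y. f y * smoothed \<nu> s y \<partial>lborel)"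
          unfolding J_def \<gamma>_def
          by (simp only: integral_smoothed[OF \<mu> s f B] integral_smoothed[OF \<nu> s f B])
        also have "\<dots> = (\<integral>y. f y * smoothed (\<mu> n) s y - f y * smoothed \<nu> s y \<partial>lborel)"
          by (intro Bochner_Integration.integral_diff[symmetric] integrable_smoothed[OF \<mu> s f B] integrable_smoothed[OF \<nu> s f B])
        also have "norm \<dots> \<le> (\<integral>y. norm (f y * smoothed (\<mu> n) s y - f y * smoothed \<nu> s y) \<partial>lborel)"
          by (rule integral_norm_bound)
        also have "\<dots> \<le> (\<integral>y. B * \<bar>smoothed (\<mu> n) s y - smoothed \<nu> s y\<bar> \<partial>lborel)"
        proof (rule integral_mono)
          fix y
          show "norm (f y * smoothed (\<mu> n) s y - f y * smoothed \<nu> s y) \<le> B * \<bar>smoothed (\<mu> n) s y - smoothed \<nu> s y\<bar>"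
            using B[of y] by (simp add: abs_mult mult_right_mono flip: right_diff_distrib)
        qed (use smoothed_integral_1[OF \<mu> s] smoothed_integral_1[OF \<nu> s]
               integrable_smoothed[OF \<mu> s f B] integrable_smoothed[OF \<nu> s f B] in auto)
        finally show "norm (J s (\<mu> n) - J s \<nu>) \<le> B * (\<integral>y. \<bar>smoothed (\<mu> n) s y - smoothed \<nu> s y\<bar> \<partial>lborel)" by simp
      qed
      show "(\<lambda>n. B * (\<integral>y. \<bar>smoothed (\<mu> n) s y - smoothed \<nu> s y\<bar> \<partial>lborel)) \<longlonglongrightarrow> 0"
        using tendsto_mult_left[OF sch, of B] by simp
    qed
    then show ?thesis by (simp add: LIM_zero_iff)
  qed
  have e: "(\<lambda>k. e (1 / real (Suc k))) \<longlonglongrightarrow> 0"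
  proof -
    have "(\<lambda>k. \<integral>w. min (2 * B) (L * (1 / real (Suc k)) * norm w) \<partial>\<gamma>) \<longlonglongrightarrow> (\<integral>w. 0 \<partial>\<gamma>)"
    proof (rule integral_dominated_convergence[where w = "\<lambda>_. 2 * B"])
      show "AE w in \<gamma>. (\<lambda>k. min (2 * B) (L * (1 / real (Suc k)) * norm w)) \<longlonglongrightarrow> 0"
      proof (rule AE_I2)
        fix w
        have "(\<lambda>k. 1 / real (Suc k)) \<longlonglongrightarrow> 0" using LIMSEQ_inverse_real_of_nat by (simp add: inverse_eq_divide)
        then have "(\<lambda>k. min (2 * B) (L * (1 / real (Suc k)) * norm w)) \<longlonglongrightarrow> min (2 * B) (L * 0 * norm w)"
          by (intro tendsto_intros)
        then show "(\<lambda>k. min (2 * B) (L * (1 / real (Suc k)) * norm w)) \<longlonglongrightarrow> 0" using B0 by simp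
      qed
    qed (use B0 L0 in auto)
    then show ?thesis by (simp add: e_def)
  qed
  show "(\<lambda>n. integral\<^sup>L (\<mu> n) f) \<longlonglongrightarrow> integral\<^sup>L \<nu> f"
  proof (rule LIMSEQ_I)
    fix r :: real assume r: "0 < r"
    then have "\<forall>\<^sub>F k in sequentially. e (1 / real (Suc k)) < r / 3"
      by (intro order_tendstoD(2)[OF e]) simp
    then obtain k where k: "e (1 / real (Suc k)) < r / 3"
      using eventually_happens'[OF sequentially_bot] by blast
    define s where "s = 1 / real (Suc k)"
    have s: "0 < s" by (simp add: s_def)
    obtain N where N: "\<And>n. n \<ge> N \<Longrightarrow> norm (J s (\<mu> n) - J s \<nu>) < r / 3"
      using LIMSEQ_D[OF conv[OF s], of "r / 3"] r by auto
    have "norm (integral\<^sup>L (\<mu> n) f - integral\<^sup>L \<nu> f) < r" if "n \<ge> N" for n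
    proof -
      have "\<bar>J s (\<mu> n) - integral\<^sup>L (\<mu> n) f\<bar> \<le> e s" "\<bar>J s \<nu> - integral\<^sup>L \<nu> f\<bar> \<le> e s"
        unfolding J_def e_def \<gamma>_def
        by (rule abs_integral_diff_gauss_shift_le[OF \<mu> L B s], rule abs_integral_diff_gauss_shift_le[OF \<nu> L B s])
      moreover have "e s < r / 3" using k by (simp add: s_def)
      ultimately show ?thesis using N[OF that] unfolding real_norm_def by linarith
    qed
    then show "\<exists>no. \<forall>n\<ge>no. norm (integral\<^sup>L (\<mu> n) f - integral\<^sup>L \<nu> f) < r" by blast
  qed
qed

subsection \<open>Weak convergence of finite products\<close>

text \<open>A pseudometric on all sequences that sees the first \<open>m\<close> coordinates only.
  One type thus serves every \<open>m\<close>, which permits induction on \<open>m\<close>, and the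
  \<open>undefined\<close> entries outside the index set of a product measure do no harm.\<close>

definition coord_dist :: "nat \<Rightarrow> (nat \<Rightarrow> 'a::metric_space) \<Rightarrow> (nat \<Rightarrow> 'a) \<Rightarrow> real" where
  "coord_dist m x y = (\<Sum>j<m. dist (x j) (y j))"

definition coord_continuous :: "nat \<Rightarrow> ((nat \<Rightarrow> 'a::metric_space) \<Rightarrow> real) \<Rightarrow> bool" where
  "coord_continuous m F \<longleftrightarrow> (\<forall>x. \<forall>\<epsilon>>0. \<exists>\<delta>>0. \<forall>y. coord_dist m x y < \<delta> \<longrightarrow> \<bar>F y - F x\<bar> < \<epsilon>)"

text \<open>One inequality for all ordered pairs amounts to the two-sided condition, and it passes
  directly through suprema, infima and integrals.\<close>

definition coord_lipschitz :: "nat \<Rightarrow> real \<Rightarrow> ((nat \<Rightarrow> 'a::metric_space) \<Rightarrow> real) \<Rightarrow> bool" where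
  "coord_lipschitz m L F \<longleftrightarrow> 0 \<le> L \<and> (\<forall>x y. F x \<le> F y + L * coord_dist m x y)"

lemma coord_dist_nonneg: "0 \<le> coord_dist m x y"
  unfolding coord_dist_def by (intro sum_nonneg) auto

lemma coord_dist_commute: "coord_dist m x y = coord_dist m y x"
  unfolding coord_dist_def by (simp add: dist_commute)

lemma coord_dist_self [simp]: "coord_dist m x x = 0"
  by (simp add: coord_dist_def)

lemma coord_dist_triangle: "coord_dist m x z \<le> coord_dist m x y + coord_dist m y z"
  unfolding coord_dist_def by (simp add: dist_triangle sum_mono flip: sum.distrib)

lemma coord_lipschitz_abs: "coord_lipschitz m L F \<Longrightarrow> \<bar>F x - F y\<bar> \<le> L * coord_dist m x y"
  unfolding coord_lipschitz_def by (smt (verit) coord_dist_commute)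

lemma coord_lipschitz_imp_continuous:
  assumes F: "coord_lipschitz m L F"
  shows "coord_continuous m F"
  unfolding coord_continuous_def
proof (intro allI impI)
  fix x and \<epsilon> :: real assume e: "0 < \<epsilon>"
  have L: "0 \<le> L" using F by (simp add: coord_lipschitz_def)
  have "\<bar>F y - F x\<bar> < \<epsilon>" if "coord_dist m x y < \<epsilon> / (L + 1)" for y
  proof -
    have "\<bar>F y - F x\<bar> \<le> L * coord_dist m y x" by (rule coord_lipschitz_abs[OF F])
    also have "\<dots> \<le> L * (\<epsilon> / (L + 1))" using that L by (intro mult_left_mono) (auto simp: coord_dist_commute)
    also have "\<dots> < \<epsilon>" using e L by (simp add: field_simps)
    finally show ?thesis .
  qed
  then show "\<exists>\<delta>>0. \<forall>y. coord_dist m x y < \<delta> \<longrightarrow> \<bar>F y - F x\<bar> < \<epsilon>"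
    using e L by (intro exI[of _ "\<epsilon> / (L + 1)"]) auto
qed

lemma coord_continuous_imp_continuous_on:
  fixes F :: "(nat \<Rightarrow> 'a::metric_space) \<Rightarrow> real"
  assumes F: "coord_continuous m F"
  shows "continuous_on UNIV F"
proof (rule continuous_at_imp_continuous_on, rule ballI)
  fix x :: "nat \<Rightarrow> 'a"
  have "((\<lambda>y. y j) \<longlongrightarrow> x j) (at x)" for j
  proof -
    have "continuous_on UNIV (\<lambda>y::nat \<Rightarrow> 'a. y j)" by (rule continuous_on_product_coordinates)
    then show ?thesis unfolding continuous_on_def by blast
  qed
  then have "((\<lambda>y. coord_dist m x y) \<longlongrightarrow> coord_dist m x x) (at x)"
    unfolding coord_dist_def by (intro tendsto_intros)
  then have lim: "((\<lambda>y. coord_dist m x y) \<longlongrightarrow> 0) (at x)" by simp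
  show "isCont F x"
    unfolding isCont_def
  proof (rule tendstoI)
    fix e :: real assume "0 < e"
    then obtain \<delta> where \<delta>: "\<delta> > 0" "\<And>y. coord_dist m x y < \<delta> \<Longrightarrow> \<bar>F y - F x\<bar> < e"
      using F unfolding coord_continuous_def by meson
    from order_tendstoD(2)[OF lim \<delta>(1)] show "\<forall>\<^sub>F y in at x. dist (F y) (F x) < e"
      by eventually_elim (use \<delta>(2) in \<open>simp add: dist_real_def\<close>)
  qed
qed

text \<open>A map into a countable product is Borel measurable as soon as its coordinates are. On
  the space of \<open>PiM I M\<close> the coordinates outside \<open>I\<close> have the constant
  value \<open>undefined\<close>.\<close>

lemma borel_measurable_continuous_PiM:
  fixes F :: "(nat \<Rightarrow> 'a::second_countable_topology) \<Rightarrow> real"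
  assumes F: "continuous_on UNIV F" and M: "\<And>j. sets (M j) = sets borel"
  shows "F \<in> borel_measurable (PiM I M)"
proof -
  note [measurable_cong] = M
  have "(\<lambda>x::nat \<Rightarrow> 'a. x) \<in> borel_measurable (PiM I M)"
  proof (rule measurable_coordinatewise_then_product)
    fix j
    show "(\<lambda>x. x j) \<in> borel_measurable (PiM I M)"
    proof (cases "j \<in> I")
      case True then show ?thesis by measurable
    next
      case False
      have "(\<lambda>_. undefined) \<in> borel_measurable (PiM I M)" by simp
      moreover have "x j = undefined" if "x \<in> space (PiM I M)" for x
        using that False by (auto simp: space_PiM PiE_def extensional_def)
      ultimately show ?thesis
        using measurable_cong[of "PiM I M" "\<lambda>x. x j" "\<lambda>_. undefined" borel] by simp
    qed
  qed
  from measurable_compose[OF this borel_measurable_continuous_onI[OF F]] show ?thesis .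
qed

lemma integrable_PiM_bounded:
  fixes F :: "(nat \<Rightarrow> 'a::second_countable_topology) \<Rightarrow> real"
  assumes F: "continuous_on UNIV F" "\<And>x. \<bar>F x\<bar> \<le> B" and M: "\<And>j. prob_space (M j)" "\<And>j. sets (M j) = sets borel"
  shows "integrable (PiM I M) F"
proof -
  interpret prob_space "PiM I M" using M(1) by (rule prob_space_PiM)
  show ?thesis using F(2) by (intro integrable_const_bound[where B = B] borel_measurable_continuous_PiM F(1) M(2)) auto
qed

text \<open>Induction on \<open>m\<close>, integrating out the last coordinate. The inner integrals
  \<open>S (\<mu> n m)\<close> and the outer measures vary with \<open>n\<close> at the same time,
  so pointwise convergence of the former is not enough. The tail supremum \<open>G N\<close> of
  their errors is one bounded Lipschitz function for all \<open>n \<ge> N\<close>: the induction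
  hypothesis applies to it, and its integral under the limit law tends to 0 with growing
  \<open>N\<close>.\<close>

lemma tendsto_integral_PiM_lipschitz:
  fixes F :: "(nat \<Rightarrow> 'a::euclidean_space) \<Rightarrow> real"
  assumes \<mu>: "\<And>n j. prob_space (\<mu> n j)" "\<And>n j. sets (\<mu> n j) = sets borel"
    and \<nu>: "\<And>j. prob_space (\<nu> j)" "\<And>j. sets (\<nu> j) = sets borel"
    and conv: "\<And>j. weak_lipschitz (\<lambda>n. \<mu> n j) (\<nu> j)"
    and F: "coord_lipschitz m L F" "\<And>x. \<bar>F x\<bar> \<le> B"
  shows "(\<lambda>n. \<integral>x. F x \<partial>PiM {..<m} (\<mu> n)) \<longlonglongrightarrow> (\<integral>x. F x \<partial>PiM {..<m} \<nu>)"
  using F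
proof (induction m arbitrary: F L B)
  case 0
  \<comment> \<open>With no coordinate to depend on, \<open>F\<close> is constant.\<close>
  have F0: "F x = F y" for x y
    using coord_lipschitz_abs[OF 0(1), of x y] by (simp add: coord_dist_def)
  have "(\<integral>x. F x \<partial>PiM {..<0} M) = F (\<lambda>_. undefined)" if "\<And>j. prob_space (M j)" for M :: "nat \<Rightarrow> 'a measure"
  proof -
    interpret prob_space "PiM {..<0} M" using that by (rule prob_space_PiM)
    have "(\<integral>x. F x \<partial>PiM {..<0} M) = (\<integral>x. F (\<lambda>_. undefined) \<partial>PiM {..<0} M)"
      by (intro Bochner_Integration.integral_cong refl F0)
    then show ?thesis using prob_space by simp
  qed
  then show ?case using \<mu>(1) \<nu>(1) by simp
next
  case (Suc m)
  note lip = Suc.prems(1) and B = Suc.prems(2)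
  have L: "0 \<le> L" using lip by (simp add: coord_lipschitz_def)
  have B0: "0 \<le> B" using B[of "\<lambda>_. 0"] by simp
  define S where "S M x = (\<integral>y. F (x(m := y)) \<partial>M)" for x and M :: "'a measure"
  have lipy: "L-lipschitz_on UNIV (\<lambda>y. F (x(m := y)))" for x
  proof (rule lipschitz_onI)
    fix y z
    have eq: "coord_dist (Suc m) (x(m := y)) (x(m := z)) = dist y z" by (simp add: coord_dist_def)
    show "dist (F (x(m := y))) (F (x(m := z))) \<le> L * dist y z"
      unfolding dist_real_def eq[symmetric] by (rule coord_lipschitz_abs[OF lip])
  qed (rule L)
  have cd: "coord_dist (Suc m) (x(m := z)) (y(m := z)) = coord_dist m x y" for x y :: "nat \<Rightarrow> 'a" and z
    by (simp add: coord_dist_def)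
  have S: "coord_lipschitz m L (S M)" "\<bar>S M x\<bar> \<le> B" if M: "prob_space M" "sets M = sets borel" for M x
  proof -
    interpret M: prob_space M by (rule M)
    have [measurable]: "(\<lambda>y. F (x(m := y))) \<in> borel_measurable M" for x
      using lipschitz_borel_measurable[OF lipy] M(2) by (simp cong: measurable_cong_sets)
    have int: "integrable M (\<lambda>y. F (x(m := y)))" for x
      using B by (intro M.integrable_const_bound[where B = B]) auto
    have "\<bar>S M x\<bar> \<le> (\<integral>y. \<bar>F (x(m := y))\<bar> \<partial>M)" unfolding S_def by (rule integral_abs_bound)
    also have "\<dots> \<le> (\<integral>y. B \<partial>M)" using int B by (intro integral_mono) auto
    finally show "\<bar>S M x\<bar> \<le> B" by (simp add: M.prob_space)
    have "S M x \<le> S M y + L * coord_dist m x y" for x y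
    proof -
      have "S M x \<le> (\<integral>z. F (y(m := z)) + L * coord_dist m x y \<partial>M)"
        unfolding S_def
      proof (rule integral_mono)
        show "F (x(m := z)) \<le> F (y(m := z)) + L * coord_dist m x y" for z
          using lip cd[of x z y] unfolding coord_lipschitz_def by metis
      qed (use int in auto)
      also have "\<dots> = S M y + L * coord_dist m x y" using int by (simp add: S_def M.prob_space)
      finally show ?thesis .
    qed
    then show "coord_lipschitz m L (S M)" using L by (simp add: coord_lipschitz_def)
  qed
  note S\<mu> = S[OF \<mu>(1,2)] and S\<nu> = S[OF \<nu>(1,2)]
  have Slim: "(\<lambda>n. S (\<mu> n m) x) \<longlonglongrightarrow> S (\<nu> m) x" for x
    unfolding S_def using B by (intro conv[of m, unfolded weak_lipschitz_def, rule_format, OF _ lipy[of x]])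
  define D where "D k x = \<bar>S (\<mu> k m) x - S (\<nu> m) x\<bar>" for k x
  define G where "G N x = (SUP k\<in>{N..}. D k x)" for N x
  have D_le: "D k x \<le> 2 * B" for k x
    using S\<mu>(2)[of k m x] S\<nu>(2)[of m x] unfolding D_def by linarith
  have bdd: "bdd_above ((\<lambda>k. D k x) ` {N..})" for N x by (intro bdd_aboveI[of _ "2 * B"]) (auto simp: D_le)
  have D_le_G: "D k x \<le> G N x" if "N \<le> k" for k N x
    unfolding G_def using that by (intro cSUP_upper bdd) auto
  have D0: "0 \<le> D k x" for k x by (simp add: D_def)
  have G0: "0 \<le> G N x" for N x using order_trans[OF D0 D_le_G[OF order_refl]] .
  have G_le: "G N x \<le> 2 * B" for N x unfolding G_def by (intro cSUP_least D_le) auto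
  have G_abs: "\<bar>G N x\<bar> \<le> 2 * B" for N x using G0[of N x] G_le[of N x] by simp
  have Glip: "coord_lipschitz m (2 * L) (G N)" for N
    unfolding coord_lipschitz_def
  proof (intro conjI allI)
    fix x y
    show "G N x \<le> G N y + 2 * L * coord_dist m x y"
      unfolding G_def[of N x]
    proof (rule cSUP_least)
      fix k assume "k \<in> {N..}"
      then have "D k y \<le> G N y" by (intro D_le_G) simp
      then show "D k x \<le> G N y + 2 * L * coord_dist m x y"
        using coord_lipschitz_abs[OF S\<mu>(1)[of k m], of x y] coord_lipschitz_abs[OF S\<nu>(1)[of m], of x y]
        unfolding D_def by linarith
    qed simp
  qed (use L in simp)
  have Glim: "(\<lambda>N. G N x) \<longlonglongrightarrow> 0" for x
  proof (rule LIMSEQ_I)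
    fix r :: real assume "0 < r"
    then obtain N where N: "\<And>k. k \<ge> N \<Longrightarrow> norm (S (\<mu> k m) x - S (\<nu> m) x) < r / 2"
      using LIMSEQ_D[OF Slim[of x], of "r / 2"] by auto
    have "norm (G n x - 0) < r" if "n \<ge> N" for n
    proof -
      have "G n x \<le> r / 2"
        unfolding G_def
      proof (rule cSUP_least)
        fix k assume "k \<in> {n..}"
        then show "D k x \<le> r / 2" using N[of k] that by (simp add: D_def)
      qed simp
      then show ?thesis using G0[of n x] \<open>0 < r\<close> by simp
    qed
    then show "\<exists>no. \<forall>n\<ge>no. norm (G n x - 0) < r" by blast
  qed
  note cont = coord_continuous_imp_continuous_on[OF coord_lipschitz_imp_continuous]
  have intF: "(\<integral>x. F x \<partial>PiM {..<Suc m} M) = (\<integral>x. S (M m) x \<partial>PiM {..<m} M)"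
    if M: "\<And>j. prob_space (M j)" "\<And>j. sets (M j) = sets borel" for M :: "nat \<Rightarrow> 'a measure"
  proof -
    interpret product_prob_space M using M(1) by (intro product_prob_spaceI)
    show ?thesis
      unfolding lessThan_Suc S_def
      by (rule product_integral_insert) (auto intro!: integrable_PiM_bounded cont[OF lip] B M)
  qed
  have GN: "(\<lambda>N. \<integral>x. G N x \<partial>PiM {..<m} \<nu>) \<longlonglongrightarrow> 0"
  proof -
    interpret prob_space "PiM {..<m} \<nu>" using \<nu>(1) by (rule prob_space_PiM)
    have "(\<lambda>N. \<integral>x. G N x \<partial>PiM {..<m} \<nu>) \<longlonglongrightarrow> (\<integral>x. 0 \<partial>PiM {..<m} \<nu>)"
    proof (rule integral_dominated_convergence[where w = "\<lambda>_. 2 * B"])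
      show "AE x in PiM {..<m} \<nu>. (\<lambda>N. G N x) \<longlonglongrightarrow> 0" using Glim by simp
      show "AE x in PiM {..<m} \<nu>. norm (G N x) \<le> 2 * B" for N using G0 G_le by simp
      show "G N \<in> borel_measurable (PiM {..<m} \<nu>)" for N
        by (intro borel_measurable_continuous_PiM cont[OF Glip] \<nu>)
    qed auto
    then show ?thesis by simp
  qed
  have IH1: "(\<lambda>n. \<integral>x. S (\<nu> m) x \<partial>PiM {..<m} (\<mu> n)) \<longlonglongrightarrow> (\<integral>x. S (\<nu> m) x \<partial>PiM {..<m} \<nu>)"
    by (rule Suc.IH[OF S\<nu>(1) S\<nu>(2)])
  have IH2: "(\<lambda>n. \<integral>x. G N x \<partial>PiM {..<m} (\<mu> n)) \<longlonglongrightarrow> (\<integral>x. G N x \<partial>PiM {..<m} \<nu>)" for N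
    by (rule Suc.IH[OF Glip G_abs])
  show ?case
    unfolding intF[OF \<mu>] intF[OF \<nu>]
  proof (rule LIMSEQ_I)
    fix r :: real assume r: "0 < r"
    \<comment> \<open>\<open>N\<close> is fixed through the limit law before \<open>n\<close> grows;
      the induction hypothesis then carries the smallness of the integral of \<open>G N\<close> over
      to the measures of index \<open>n\<close>.\<close>
    obtain N where N: "(\<integral>x. G N x \<partial>PiM {..<m} \<nu>) < r / 3"
      using eventually_happens'[OF sequentially_bot order_tendstoD(2)[OF GN, of "r / 3"]] r by auto
    have "\<forall>\<^sub>F n in sequentially. (\<integral>x. G N x \<partial>PiM {..<m} (\<mu> n)) < r / 3"
      using N by (rule order_tendstoD(2)[OF IH2])
    moreover have "\<forall>\<^sub>F n in sequentially.
        norm ((\<integral>x. S (\<nu> m) x \<partial>PiM {..<m} (\<mu> n)) - (\<integral>x. S (\<nu> m) x \<partial>PiM {..<m} \<nu>)) < r / 3"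
      using tendstoD[OF IH1, of "r / 3"] r by (simp add: dist_norm)
    ultimately have "\<forall>\<^sub>F n in sequentially.
        norm ((\<integral>x. S (\<mu> n m) x \<partial>PiM {..<m} (\<mu> n)) - (\<integral>x. S (\<nu> m) x \<partial>PiM {..<m} \<nu>)) < r"
      using eventually_ge_at_top[of N]
    proof eventually_elim
      case (elim n)
      have i: "integrable (PiM {..<m} (\<mu> n)) (S (\<mu> n m))" "integrable (PiM {..<m} (\<mu> n)) (S (\<nu> m))"
        "integrable (PiM {..<m} (\<mu> n)) (G N)"
        using integrable_PiM_bounded[OF cont[OF S\<mu>(1)] S\<mu>(2) \<mu>] integrable_PiM_bounded[OF cont[OF S\<nu>(1)] S\<nu>(2) \<mu>]
          integrable_PiM_bounded[OF cont[OF Glip] G_abs \<mu>] by auto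
      have "\<bar>(\<integral>x. S (\<mu> n m) x \<partial>PiM {..<m} (\<mu> n)) - (\<integral>x. S (\<nu> m) x \<partial>PiM {..<m} (\<mu> n))\<bar> =
          \<bar>\<integral>x. S (\<mu> n m) x - S (\<nu> m) x \<partial>PiM {..<m} (\<mu> n)\<bar>" using i by simp
      also have "\<dots> \<le> (\<integral>x. D n x \<partial>PiM {..<m} (\<mu> n))" unfolding D_def by (rule integral_abs_bound)
      also have "\<dots> \<le> (\<integral>x. G N x \<partial>PiM {..<m} (\<mu> n))"
        using i D_le_G[OF elim(3)] unfolding D_def by (intro integral_mono) auto
      finally show ?case using elim(1,2) unfolding real_norm_def by linarith
    qed
    then show "\<exists>no. \<forall>n\<ge>no. norm ((\<integral>x. S (\<mu> n m) x \<partial>PiM {..<m} (\<mu> n)) - (\<integral>x. S (\<nu> m) x \<partial>PiM {..<m} \<nu>)) < r"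
      by (simp add: eventually_sequentially)
  qed
qed


text \<open>Inf-convolution with \<open>k\<close> times the distance. The choice
  \<open>y = x\<close> gives the bound by \<open>F x\<close>. Conversely, once
  \<open>real k * \<delta>\<close> exceeds \<open>2 * B\<close>, points at distance
  \<open>\<delta>\<close> or more cannot lower the infimum below \<open>F x\<close>, and nearer
  points change \<open>F\<close> only a little.\<close>

lemma coord_lipschitz_approx:
  fixes F :: "(nat \<Rightarrow> 'a::metric_space) \<Rightarrow> real"
  assumes F: "coord_continuous m F" and B: "\<And>x. \<bar>F x\<bar> \<le> B"
  obtains H where "\<And>k. coord_lipschitz m (real k) (H k)" "\<And>k x. \<bar>H k x\<bar> \<le> B" "\<And>k x. H k x \<le> F x"
    "\<And>x. (\<lambda>k. H k x) \<longlonglongrightarrow> F x"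
proof -
  define H where "H k x = (INF y. F y + real k * coord_dist m x y)" for k x
  have lb: "- B \<le> F y + real k * coord_dist m x y" for k x y
  proof -
    have "- B \<le> F y" using B[of y] by (simp add: abs_le_iff)
    moreover have "0 \<le> real k * coord_dist m x y" by (simp add: coord_dist_nonneg)
    ultimately show ?thesis by linarith
  qed
  have bdd: "bdd_below (range (\<lambda>y. F y + real k * coord_dist m x y))" for k x
    using lb by (intro bdd_belowI[of _ "- B"]) auto
  have upper: "H k x \<le> F y + real k * coord_dist m x y" for k x y
    unfolding H_def by (rule cINF_lower[OF bdd]) simp
  have H_le: "H k x \<le> F x" for k x using upper[of k x x] by simp
  have H_ge: "- B \<le> H k x" for k x unfolding H_def by (rule cINF_greatest) (auto simp: lb)
  show ?thesis
  proof (rule that[of H])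
    show "H k x \<le> F x" for k x by (rule H_le)
    show "\<bar>H k x\<bar> \<le> B" for k x using H_le[of k x] H_ge[of k x] B[of x] by (simp add: abs_le_iff)
    show "coord_lipschitz m (real k) (H k)" for k
      unfolding coord_lipschitz_def
    proof (intro conjI allI)
      fix x y
      have "H k x - real k * coord_dist m x y \<le> H k y"
        unfolding H_def[of k y]
      proof (rule cINF_greatest)
        fix z
        have "H k x \<le> F z + real k * coord_dist m x z" by (rule upper)
        also have "\<dots> \<le> F z + real k * (coord_dist m x y + coord_dist m y z)"
          by (intro add_left_mono mult_left_mono coord_dist_triangle) simp
        finally show "H k x - real k * coord_dist m x y \<le> F z + real k * coord_dist m y z"
          by (simp add: distrib_left)
      qed simp
      then show "H k x \<le> H k y + real k * coord_dist m x y" by simp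
    qed simp
    show "(\<lambda>k. H k x) \<longlonglongrightarrow> F x" for x
    proof (rule LIMSEQ_I)
      fix r :: real assume r: "0 < r"
      then obtain \<delta> where \<delta>: "\<delta> > 0" "\<And>y. coord_dist m x y < \<delta> \<Longrightarrow> \<bar>F y - F x\<bar> < r / 2"
        using F half_gt_zero[OF r] unfolding coord_continuous_def by blast
      obtain N where N: "real N * \<delta> > 2 * B" using ex_less_of_nat_mult[OF \<delta>(1)] by blast
      have "norm (H k x - F x) < r" if k: "k \<ge> N" for k
      proof -
        have "F x - r / 2 \<le> H k x"
          unfolding H_def
        proof (rule cINF_greatest)
          fix y
          show "F x - r / 2 \<le> F y + real k * coord_dist m x y"
          proof (cases "coord_dist m x y < \<delta>")
            case True
            then show ?thesis using \<delta>(2)[OF True] mult_nonneg_nonneg[OF of_nat_0_le_iff[of k] coord_dist_nonneg[of m x y]]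
              by linarith
          next
            case False
            then have "real N * \<delta> \<le> real k * coord_dist m x y" using k \<delta>(1) by (intro mult_mono) auto
            then show ?thesis using N B[of x] B[of y] r by linarith
          qed
        qed simp
        then show ?thesis using H_le[of k x] r by simp
      qed
      then show "\<exists>no. \<forall>n\<ge>no. norm (H n x - F x) < r" by blast
    qed
  qed
qed

text \<open>A Lipschitz minorant whose integral under the limit law almost attains that of
  \<open>F\<close> bounds the integrals from below for large \<open>n\<close>; the bound from above
  is the same statement for the negative of \<open>F\<close>.\<close>

theorem tendsto_integral_PiM_continuous:
  fixes F :: "(nat \<Rightarrow> 'a::euclidean_space) \<Rightarrow> real"
  assumes \<mu>: "\<And>n j. prob_space (\<mu> n j)" "\<And>n j. sets (\<mu> n j) = sets borel"
    and \<nu>: "\<And>j. prob_space (\<nu> j)" "\<And>j. sets (\<nu> j) = sets borel"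
    and conv: "\<And>j. weak_lipschitz (\<lambda>n. \<mu> n j) (\<nu> j)"
    and F: "coord_continuous m F" "\<And>x. \<bar>F x\<bar> \<le> B"
  shows "(\<lambda>n. \<integral>x. F x \<partial>PiM {..<m} (\<mu> n)) \<longlonglongrightarrow> (\<integral>x. F x \<partial>PiM {..<m} \<nu>)"
proof -
  note cont = coord_continuous_imp_continuous_on
  have lower: "\<forall>\<^sub>F n in sequentially. (\<integral>x. F x \<partial>PiM {..<m} \<nu>) - r < (\<integral>x. F x \<partial>PiM {..<m} (\<mu> n))"
    if F: "coord_continuous m F" "\<And>x. \<bar>F x\<bar> \<le> B" and r: "0 < r" for F and r :: real
  proof -
    interpret \<nu>: prob_space "PiM {..<m} \<nu>" using \<nu>(1) by (rule prob_space_PiM)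
    obtain H where H: "\<And>k. coord_lipschitz m (real k) (H k)" "\<And>k x. \<bar>H k x\<bar> \<le> B" "\<And>k x. H k x \<le> F x"
      "\<And>x. (\<lambda>k. H k x) \<longlonglongrightarrow> F x"
      using coord_lipschitz_approx[OF F] by blast
    note contH = cont[OF coord_lipschitz_imp_continuous[OF H(1)]]
    have "(\<lambda>k. \<integral>x. H k x \<partial>PiM {..<m} \<nu>) \<longlonglongrightarrow> (\<integral>x. F x \<partial>PiM {..<m} \<nu>)"
      by (rule integral_dominated_convergence[where w = "\<lambda>_. B"])
         (use H in \<open>auto intro!: borel_measurable_continuous_PiM contH cont[OF F(1)] \<nu>\<close>)
    then have "\<forall>\<^sub>F k in sequentially. (\<integral>x. F x \<partial>PiM {..<m} \<nu>) - r < (\<integral>x. H k x \<partial>PiM {..<m} \<nu>)"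
      by (rule order_tendstoD(1)) (use r in simp)
    then obtain k where k: "(\<integral>x. F x \<partial>PiM {..<m} \<nu>) - r < (\<integral>x. H k x \<partial>PiM {..<m} \<nu>)"
      using eventually_happens'[OF sequentially_bot] by blast
    have "(\<lambda>n. \<integral>x. H k x \<partial>PiM {..<m} (\<mu> n)) \<longlonglongrightarrow> (\<integral>x. H k x \<partial>PiM {..<m} \<nu>)"
      by (rule tendsto_integral_PiM_lipschitz[OF \<mu> \<nu> conv H(1) H(2)])
    from order_tendstoD(1)[OF this k] show ?thesis
    proof eventually_elim
      case (elim n)
      have "(\<integral>x. H k x \<partial>PiM {..<m} (\<mu> n)) \<le> (\<integral>x. F x \<partial>PiM {..<m} (\<mu> n))"
        by (intro integral_mono integrable_PiM_bounded[where B = B] contH cont[OF F(1)] H F \<mu>)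
      then show ?case using elim by linarith
    qed
  qed
  have F': "coord_continuous m (\<lambda>x. - F x)"
    using F(1) unfolding coord_continuous_def by (simp add: abs_minus_commute)
  have F'_le: "\<bar>- F x\<bar> \<le> B" for x using F(2) by simp
  show ?thesis
  proof (rule LIMSEQ_I)
    fix r :: real assume r: "0 < r"
    have "\<forall>\<^sub>F n in sequentially. norm ((\<integral>x. F x \<partial>PiM {..<m} (\<mu> n)) - (\<integral>x. F x \<partial>PiM {..<m} \<nu>)) < r"
      using lower[OF F r] lower[OF F' F'_le r]
      by eventually_elim (use F(2) in \<open>auto simp: abs_less_iff\<close>)
    then show "\<exists>no. \<forall>n\<ge>no. norm ((\<integral>x. F x \<partial>PiM {..<m} (\<mu> n)) - (\<integral>x. F x \<partial>PiM {..<m} \<nu>)) < r"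
      by (simp add: eventually_sequentially)
  qed
qed

subsection \<open>The random walk\<close>

lemma borel_measurable_vec_nth [measurable]: "(\<lambda>x::real^'n. x $ i) \<in> borel_measurable borel"
  by (intro borel_measurable_continuous_onI continuous_intros)

locale centred_walk = prob_space M for M :: "'a measure" +
  fixes \<xi> :: "nat \<Rightarrow> 'a \<Rightarrow> real^'n"
  assumes indep: "indep_vars (\<lambda>_. borel) \<xi> UNIV"
    and ident: "\<And>i. distr M borel (\<xi> i) = distr M borel (\<xi> 0)"
    and mean_zero: "(\<integral>\<omega>. \<xi> 0 \<omega> \<partial>M) = 0"
    and square_integrable: "integrable M (\<lambda>\<omega>. (norm (\<xi> 0 \<omega>))\<^sup>2)"
begin

abbreviation "S \<equiv> partial_sum \<xi>"
abbreviation "C \<equiv> expectation (\<lambda>\<omega>. (norm (\<xi> 0 \<omega>))\<^sup>2)"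

lemma measurable_xi [measurable]: "\<xi> i \<in> borel_measurable M"
  using indep unfolding indep_vars_def by auto

lemma S_0 [simp]: "S 0 \<omega> = 0"
  by (simp add: partial_sum_def)

lemma S_Suc: "S (Suc k) \<omega> = S k \<omega> + \<xi> (Suc k) \<omega>"
  by (simp add: partial_sum_def)

lemma measurable_S [measurable]: "S k \<in> borel_measurable M"
  unfolding partial_sum_def by measurable

lemma xi_transfer:
  fixes g :: "real^'n \<Rightarrow> 'c::{banach, second_countable_topology}"
  assumes [measurable]: "g \<in> borel_measurable borel"
  shows "(\<integral>\<omega>. g (\<xi> i \<omega>) \<partial>M) = (\<integral>\<omega>. g (\<xi> 0 \<omega>) \<partial>M)"
    and "integrable M (\<lambda>\<omega>. g (\<xi> i \<omega>)) \<longleftrightarrow> integrable M (\<lambda>\<omega>. g (\<xi> 0 \<omega>))"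
proof -
  show "(\<integral>\<omega>. g (\<xi> i \<omega>) \<partial>M) = (\<integral>\<omega>. g (\<xi> 0 \<omega>) \<partial>M)"
    using integral_distr[of "\<xi> i" M borel g] integral_distr[of "\<xi> 0" M borel g] ident[of i] by simp
  show "integrable M (\<lambda>\<omega>. g (\<xi> i \<omega>)) \<longleftrightarrow> integrable M (\<lambda>\<omega>. g (\<xi> 0 \<omega>))"
    using integrable_distr_eq[of "\<xi> i" M borel g] integrable_distr_eq[of "\<xi> 0" M borel g] ident[of i] by simp
qed

lemma square_integrable_xi: "integrable M (\<lambda>\<omega>. (norm (\<xi> i \<omega>))\<^sup>2)"
  using xi_transfer(2)[of "\<lambda>x. (norm x)\<^sup>2" i] square_integrable by simp

lemma integrable_xi: "integrable M (\<xi> i)"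
proof -
  have "integrable M (\<lambda>\<omega>. norm (\<xi> i \<omega>))"
    using square_integrable_xi by (intro square_integrable_imp_integrable[where f = "\<lambda>\<omega>. norm (\<xi> i \<omega>)"]) auto
  then show ?thesis by (simp add: integrable_norm_iff)
qed

lemma mean_zero_xi: "(\<integral>\<omega>. \<xi> i \<omega> \<partial>M) = 0"
  using xi_transfer(1)[of "\<lambda>x. x" i] mean_zero by simp

text \<open>Restriction to \<open>A\<close> and \<open>B\<close> turns functions of past and of
  future steps into functions on two separate product spaces, the form in which disjoint blocks are
  independent.\<close>

lemma indep_functions:
  assumes "A \<inter> B = {}" "f \<in> measurable (PiM A (\<lambda>_. borel)) N1" "g \<in> measurable (PiM B (\<lambda>_. borel)) N2"
  shows "indep_var N1 (\<lambda>\<omega>. f (\<lambda>i\<in>A. \<xi> i \<omega>)) N2 (\<lambda>\<omega>. g (\<lambda>i\<in>B. \<xi> i \<omega>))"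
  using indep_var_compose[OF indep_var_restrict[OF indep assms(1)] assms(2,3)] by (simp add: o_def)

lemma
  shows integrable_S_sq: "integrable M (\<lambda>\<omega>. (norm (S k \<omega>))\<^sup>2)"
    and second_moment_S: "expectation (\<lambda>\<omega>. (norm (S k \<omega>))\<^sup>2) = real k * C"
proof -
  have "integrable M (\<lambda>\<omega>. (norm (S k \<omega>))\<^sup>2) \<and> expectation (\<lambda>\<omega>. (norm (S k \<omega>))\<^sup>2) = real k * C"
  proof (induction k)
    case (Suc k)
    have ixi: "integrable M (\<lambda>\<omega>. \<xi> j \<omega> $ i)" for i j
      by (rule integrable_bounded_linear[OF bounded_linear_vec_nth integrable_xi])
    have mxi: "expectation (\<lambda>\<omega>. \<xi> j \<omega> $ i) = 0" for i j
      using integral_bounded_linear[OF bounded_linear_vec_nth[of i] integrable_xi[of j]] mean_zero_xi[of j] by simp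
    have iS: "integrable M (\<lambda>\<omega>. S k \<omega> $ i)" for i
      unfolding partial_sum_def sum_component using ixi by (intro Bochner_Integration.integrable_sum)
    have ind: "indep_var borel (\<lambda>\<omega>. S k \<omega> $ i) borel (\<lambda>\<omega>. \<xi> (Suc k) \<omega> $ i)" for i
    proof -
      have 1: "(\<lambda>x::nat \<Rightarrow> real^'n. \<Sum>j\<in>{1..k}. x j $ i) \<in> borel_measurable (PiM {1..k} (\<lambda>_. borel))"
        by (rule borel_measurable_sum, rule measurable_compose[OF _ borel_measurable_vec_nth], rule measurable_component_singleton)
      have 2: "(\<lambda>x::nat \<Rightarrow> real^'n. x (Suc k) $ i) \<in> borel_measurable (PiM {Suc k} (\<lambda>_. borel))"
        by (rule measurable_compose[OF _ borel_measurable_vec_nth], rule measurable_component_singleton) simp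
      show ?thesis using indep_functions[OF _ 1 2] by (simp add: partial_sum_def)
    qed
    \<comment> \<open>Coordinate by coordinate, a product of independent factors with a centred
      second factor has mean 0, so second moments add up.\<close>
    have cross: "integrable M (\<lambda>\<omega>. S k \<omega> \<bullet> \<xi> (Suc k) \<omega>)" "expectation (\<lambda>\<omega>. S k \<omega> \<bullet> \<xi> (Suc k) \<omega>) = 0"
      unfolding inner_vec_def
      using indep_var_integrable[OF ind iS ixi] indep_var_lebesgue_integral[OF ind iS ixi] mxi
      by (auto simp: Bochner_Integration.integral_sum)
    have sq: "(norm (S (Suc k) \<omega>))\<^sup>2 = (norm (S k \<omega>))\<^sup>2 + (2 * (S k \<omega> \<bullet> \<xi> (Suc k) \<omega>) + (norm (\<xi> (Suc k) \<omega>))\<^sup>2)" for \<omega>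
      by (simp add: S_Suc power2_norm_eq_inner inner_add_left inner_add_right inner_commute)
    have "expectation (\<lambda>\<omega>. (norm (\<xi> (Suc k) \<omega>))\<^sup>2) = C"
      using xi_transfer(1)[of "\<lambda>x. (norm x)\<^sup>2" "Suc k"] by simp
    then show ?case
      unfolding sq using Suc cross square_integrable_xi[of "Suc k"] by (simp add: distrib_right)
  qed simp
  then show "integrable M (\<lambda>\<omega>. (norm (S k \<omega>))\<^sup>2)" "expectation (\<lambda>\<omega>. (norm (S k \<omega>))\<^sup>2) = real k * C"
    by auto
qed

lemma C_nonneg: "0 \<le> C"
  by (intro Bochner_Integration.integral_nonneg) simp

lemma chebyshev_S:
  assumes a: "0 < a"
  shows "prob {\<omega>\<in>space M. a \<le> norm (S k \<omega>)} \<le> real k * C / a\<^sup>2"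
proof -
  have "{\<omega>\<in>space M. a \<le> norm (S k \<omega>)} = {\<omega>\<in>space M. a\<^sup>2 \<le> (norm (S k \<omega>))\<^sup>2}"
    using a by (auto intro: power_mono power2_le_imp_le)
  moreover have "prob {\<omega>\<in>space M. a\<^sup>2 \<le> (norm (S k \<omega>))\<^sup>2} \<le> expectation (\<lambda>\<omega>. (norm (S k \<omega>))\<^sup>2) / a\<^sup>2"
    using a integrable_S_sq[of k] by (intro integral_Markov_inequality_measure[where A = "{}"]) auto
  ultimately show ?thesis using second_moment_S[of k] by simp
qed

lemma indep_shift: "indep_vars (\<lambda>_. borel) (\<lambda>i. \<xi> (a + i)) UNIV"
proof -
  have "indep_vars (\<lambda>j. PiM {a + j} (\<lambda>_. borel)) (\<lambda>j \<omega>. restrict (\<lambda>i. \<xi> i \<omega>) {a + j}) UNIV"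
    by (rule indep_vars_restrict[OF indep]) (auto simp: disjoint_family_on_def)
  from indep_vars_compose2[OF this, of "\<lambda>j x. x (a + j)" "\<lambda>_. borel"] show ?thesis by simp
qed

text \<open>Both sides are the law of the sum of a vector of \<open>k\<close> steps, and every such
  vector has the same product law, wherever it starts.\<close>

lemma distr_increment:
  "distr M borel (\<lambda>\<omega>. S (a + k) \<omega> - S a \<omega>) = distr M borel (S k)"
proof (cases "k = 0")
  \<comment> \<open>The description of independence by product laws asks for a nonempty index set,
    so the empty block is treated apart.\<close>
  case True then show ?thesis by (simp add: S_0[abs_def])
next
  case False
  have shift: "distr M (PiM {1..k} (\<lambda>_. borel)) (\<lambda>\<omega>. \<lambda>i\<in>{1..k}. \<xi> (a + i) \<omega>) = PiM {1..k} (\<lambda>i. distr M borel (\<xi> 0))" for a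
  proof -
    have "indep_vars (\<lambda>_. borel) (\<lambda>i. \<xi> (a + i)) {1..k}"
      using indep_shift by (rule indep_vars_subset) simp
    then have "distr M (PiM {1..k} (\<lambda>_. borel)) (\<lambda>\<omega>. \<lambda>i\<in>{1..k}. \<xi> (a + i) \<omega>) = PiM {1..k} (\<lambda>i. distr M borel (\<xi> (a + i)))"
      using False by (subst (asm) indep_vars_iff_distr_eq_PiM') auto
    then show ?thesis by (simp add: ident[of "a + _"])
  qed
  have sum: "distr M borel (\<lambda>\<omega>. \<Sum>i\<in>{1..k}. \<xi> (a + i) \<omega>) =
      distr (distr M (PiM {1..k} (\<lambda>_. borel)) (\<lambda>\<omega>. \<lambda>i\<in>{1..k}. \<xi> (a + i) \<omega>)) borel (\<lambda>x. \<Sum>i\<in>{1..k}. x i)" for a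
    by (subst distr_distr) (auto simp: o_def)
  have "S (a + k) \<omega> - S a \<omega> = (\<Sum>i\<in>{1..k}. \<xi> (a + i) \<omega>)" for \<omega>
    by (induction k) (simp_all add: S_Suc algebra_simps)
  then have "distr M borel (\<lambda>\<omega>. S (a + k) \<omega> - S a \<omega>) = distr M borel (\<lambda>\<omega>. \<Sum>i\<in>{1..k}. \<xi> (a + i) \<omega>)" by simp
  also have "\<dots> = distr M borel (\<lambda>\<omega>. \<Sum>i\<in>{1..k}. \<xi> (0 + i) \<omega>)"
    unfolding sum shift ..
  finally show ?thesis by (simp add: partial_sum_def[abs_def])
qed

lemma prob_increment:
  assumes "A \<in> sets borel"
  shows "prob {\<omega>\<in>space M. S (a + k) \<omega> - S a \<omega> \<in> A} = prob {\<omega>\<in>space M. S k \<omega> \<in> A}"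
proof -
  have "measure (distr M borel (\<lambda>\<omega>. S (a + k) \<omega> - S a \<omega>)) A = measure (distr M borel (S k)) A"
    by (simp add: distr_increment)
  then show ?thesis using assms by (simp add: measure_distr vimage_def Int_def conj_commute)
qed

text \<open>Ottaviani's inequality: decompose according to the first passage time.\<close>

lemma ottaviani:
  assumes half: "\<And>k. k \<le> n \<Longrightarrow> prob {\<omega>\<in>space M. a \<le> norm (S n \<omega> - S k \<omega>)} \<le> 1 / 2"
  shows "prob {\<omega>\<in>space M. \<exists>k\<le>n. 2 * a \<le> norm (S k \<omega>)} \<le> 2 * prob {\<omega>\<in>space M. a \<le> norm (S n \<omega>)}"
proof -
  \<comment> \<open>\<open>T k\<close>: the level \<open>2 * a\<close> is first reached at time
    \<open>k\<close>. \<open>U k\<close>: the steps after \<open>k\<close> move the walk by less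
    than \<open>a\<close>. On both events the walk ends at distance at least
    \<open>a\<close>.\<close>
  define T where "T k = {\<omega>\<in>space M. 2 * a \<le> norm (S k \<omega>) \<and> (\<forall>j<k. norm (S j \<omega>) < 2 * a)}" for k
  define U where "U k = {\<omega>\<in>space M. norm (S n \<omega> - S k \<omega>) < a}" for k
  have sets[measurable]: "T k \<in> events" "U k \<in> events" for k
    unfolding T_def U_def by measurable
  have disj: "disjoint_family_on T {..n}"
    by (auto simp: disjoint_family_on_def T_def) (metis linorder_neqE_nat not_less)
  have E: "{\<omega>\<in>space M. \<exists>k\<le>n. 2 * a \<le> norm (S k \<omega>)} = (\<Union>k\<in>{..n}. T k)"
  proof (intro set_eqI iffI)
    fix \<omega> assume "\<omega> \<in> {\<omega>\<in>space M. \<exists>k\<le>n. 2 * a \<le> norm (S k \<omega>)}"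
    then obtain k where k: "\<omega> \<in> space M" "k \<le> n" "2 * a \<le> norm (S k \<omega>)" by blast
    define l where "l = (LEAST l. 2 * a \<le> norm (S l \<omega>))"
    have "2 * a \<le> norm (S l \<omega>)" "l \<le> k" using k(3) unfolding l_def by (rule LeastI, rule Least_le)
    moreover have "norm (S j \<omega>) < 2 * a" if "j < l" for j
      using not_less_Least[OF that[unfolded l_def]] by simp
    ultimately have "\<omega> \<in> T l" "l \<in> {..n}" using k by (auto simp: T_def)
    then show "\<omega> \<in> (\<Union>k\<in>{..n}. T k)" by blast
  qed (auto simp: T_def)
  have TU: "prob (T k \<inter> U k) = prob (T k) * prob (U k)" if k: "k \<le> n" for k
  proof -
    \<comment> \<open>\<open>f\<close> and \<open>g\<close> express the two events through the steps
      up to \<open>k\<close> and after \<open>k\<close>, so that independence of disjoint blocks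
      applies.\<close>
    define f where "f x = (if 2 * a \<le> norm (\<Sum>i\<in>{1..k}. x i) \<and> (\<forall>j<k. norm (\<Sum>i\<in>{1..j}. x i) < 2 * a) then 1 else 0 :: real)"
      for x :: "nat \<Rightarrow> real^'n"
    define g where "g x = (if norm (\<Sum>i\<in>{Suc k..n}. x i) < a then 1 else 0 :: real)" for x :: "nat \<Rightarrow> real^'n"
    have fm: "f \<in> borel_measurable (PiM {1..k} (\<lambda>_. borel))"
    proof -
      have [measurable]: "(\<lambda>x::nat \<Rightarrow> real^'n. \<Sum>i\<in>{1..j}. x i) \<in> borel_measurable (PiM {1..k} (\<lambda>_. borel))" if "j \<le> k" for j
        using that by (intro borel_measurable_sum) auto
      show ?thesis unfolding f_def by measurable
    qed
    have gm: "g \<in> borel_measurable (PiM {Suc k..n} (\<lambda>_. borel))"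
      unfolding g_def by measurable
    have f: "f (\<lambda>i\<in>{1..k}. \<xi> i \<omega>) = indicator (T k) \<omega>" if "\<omega> \<in> space M" for \<omega>
    proof -
      have "(\<Sum>i\<in>{1..j}. (\<lambda>i\<in>{1..k}. \<xi> i \<omega>) i) = S j \<omega>" if "j \<le> k" for j
        unfolding partial_sum_def using that by (intro sum.cong) auto
      then show ?thesis using that unfolding f_def T_def by (auto simp: indicator_def)
    qed
    have g: "g (\<lambda>i\<in>{Suc k..n}. \<xi> i \<omega>) = indicator (U k) \<omega>" if "\<omega> \<in> space M" for \<omega>
    proof -
      have "S n \<omega> - S k \<omega> = (\<Sum>i\<in>{Suc k..n}. \<xi> i \<omega>)"
        unfolding partial_sum_def using k sum.ub_add_nat[of 1 k "\<lambda>i. \<xi> i \<omega>" "n - k"] by simp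
      then show ?thesis using that unfolding g_def U_def by (simp add: indicator_def)
    qed
    have ind: "indep_var borel (\<lambda>\<omega>. f (\<lambda>i\<in>{1..k}. \<xi> i \<omega>)) borel (\<lambda>\<omega>. g (\<lambda>i\<in>{Suc k..n}. \<xi> i \<omega>))"
      by (rule indep_functions[OF _ fm gm]) auto
    have int: "integrable M (\<lambda>\<omega>. f (\<lambda>i\<in>{1..k}. \<xi> i \<omega>))" "integrable M (\<lambda>\<omega>. g (\<lambda>i\<in>{Suc k..n}. \<xi> i \<omega>))"
      using indep_var_rv1[OF ind] indep_var_rv2[OF ind]
      by (auto intro!: integrable_const_bound[where B = 1] simp: f_def g_def)
    have "prob (T k \<inter> U k) = expectation (\<lambda>\<omega>. f (\<lambda>i\<in>{1..k}. \<xi> i \<omega>) * g (\<lambda>i\<in>{Suc k..n}. \<xi> i \<omega>))"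
    proof -
      have "prob (T k \<inter> U k) = expectation (indicator (T k \<inter> U k))" by simp
      also have "\<dots> = expectation (\<lambda>\<omega>. f (\<lambda>i\<in>{1..k}. \<xi> i \<omega>) * g (\<lambda>i\<in>{Suc k..n}. \<xi> i \<omega>))"
        by (intro Bochner_Integration.integral_cong refl) (simp add: f g indicator_inter_arith del: One_nat_def)
      finally show ?thesis .
    qed
    also have "\<dots> = expectation (\<lambda>\<omega>. f (\<lambda>i\<in>{1..k}. \<xi> i \<omega>)) * expectation (\<lambda>\<omega>. g (\<lambda>i\<in>{Suc k..n}. \<xi> i \<omega>))"
      by (rule indep_var_lebesgue_integral[OF ind int])
    also have "expectation (\<lambda>\<omega>. f (\<lambda>i\<in>{1..k}. \<xi> i \<omega>)) = prob (T k)"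
    proof -
      have "expectation (\<lambda>\<omega>. f (\<lambda>i\<in>{1..k}. \<xi> i \<omega>)) = expectation (indicator (T k))"
        by (intro Bochner_Integration.integral_cong refl f)
      then show ?thesis by simp
    qed
    also have "expectation (\<lambda>\<omega>. g (\<lambda>i\<in>{Suc k..n}. \<xi> i \<omega>)) = prob (U k)"
    proof -
      have "expectation (\<lambda>\<omega>. g (\<lambda>i\<in>{Suc k..n}. \<xi> i \<omega>)) = expectation (indicator (U k))"
        by (intro Bochner_Integration.integral_cong refl g)
      then show ?thesis by simp
    qed
    finally show ?thesis .
  qed
  have U: "1 / 2 \<le> prob (U k)" if "k \<le> n" for k
  proof -
    have "U k = space M - {\<omega>\<in>space M. a \<le> norm (S n \<omega> - S k \<omega>)}" by (auto simp: U_def)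
    then have "prob (U k) = 1 - prob {\<omega>\<in>space M. a \<le> norm (S n \<omega> - S k \<omega>)}" by (simp add: prob_compl)
    then show ?thesis using half[OF that] by simp
  qed
  have "(1 / 2) * prob {\<omega>\<in>space M. \<exists>k\<le>n. 2 * a \<le> norm (S k \<omega>)} = (\<Sum>k\<le>n. prob (T k) * (1 / 2))"
    unfolding E by (subst finite_measure_finite_Union) (use disj in \<open>auto simp: sum_distrib_left\<close>)
  also have "\<dots> \<le> (\<Sum>k\<le>n. prob (T k \<inter> U k))"
  proof (rule sum_mono)
    fix k assume "k \<in> {..n}"
    then show "prob (T k) * (1 / 2) \<le> prob (T k \<inter> U k)"
      using mult_left_mono[OF U[of k], of "prob (T k)"] by (simp add: TU)
  qed
  also have "\<dots> = prob (\<Union>k\<in>{..n}. T k \<inter> U k)"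
    using disj by (subst finite_measure_finite_Union) (auto simp: disjoint_family_on_def)
  also have "\<dots> \<le> prob {\<omega>\<in>space M. a \<le> norm (S n \<omega>)}"
  proof (rule finite_measure_mono)
    show "(\<Union>k\<in>{..n}. T k \<inter> U k) \<subseteq> {\<omega>\<in>space M. a \<le> norm (S n \<omega>)}"
    proof
      fix \<omega> assume "\<omega> \<in> (\<Union>k\<in>{..n}. T k \<inter> U k)"
      then obtain k where "\<omega> \<in> space M" "2 * a \<le> norm (S k \<omega>)" "norm (S n \<omega> - S k \<omega>) < a"
        by (auto simp: T_def U_def)
      then show "\<omega> \<in> {\<omega>\<in>space M. a \<le> norm (S n \<omega>)}"
        using norm_triangle_ineq2[of "S k \<omega>" "S n \<omega>"] by (simp add: norm_minus_commute)
    qed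
  qed measurable
  finally show ?thesis by simp
qed

text \<open>The last \<open>n - k\<close> steps have the law of \<open>S (n - k)\<close>, so
  Chebyshev's inequality supplies the hypothesis of \<open>ottaviani\<close>.\<close>

lemma maximal_inequality:
  assumes a: "0 < a" and small: "real n * C / a\<^sup>2 \<le> 1 / 2"
  shows "prob {\<omega>\<in>space M. \<exists>k\<le>n. 2 * a \<le> norm (S k \<omega>)} \<le> 2 * prob {\<omega>\<in>space M. a \<le> norm (S n \<omega>)}"
proof (rule ottaviani)
  fix k assume k: "k \<le> n"
  have "prob {\<omega>\<in>space M. a \<le> norm (S n \<omega> - S k \<omega>)} = prob {\<omega>\<in>space M. a \<le> norm (S (n - k) \<omega>)}"
    using prob_increment[of "{x. a \<le> norm x}" k "n - k"] k by simp
  also have "\<dots> \<le> real (n - k) * C / a\<^sup>2" by (rule chebyshev_S[OF a])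
  also have "\<dots> \<le> real n * C / a\<^sup>2"
    using C_nonneg by (intro divide_right_mono mult_right_mono) auto
  finally show "prob {\<omega>\<in>space M. a \<le> norm (S n \<omega> - S k \<omega>)} \<le> 1 / 2" using small by (rule order_trans)
qed

end

text \<open>At distance 0 the values differ by less than every positive number. This allows a
  sequence to be cut off to \<open>undefined\<close> beyond the first \<open>m\<close> coordinates,
  as product measures require.\<close>

lemma coord_continuous_cong:
  assumes F: "coord_continuous m F" and eq: "\<And>j. j < m \<Longrightarrow> x j = y j"
  shows "F x = F y"
proof -
  have cd: "coord_dist m x y = 0" using eq by (simp add: coord_dist_def)
  have "\<bar>F y - F x\<bar> < e" if "0 < e" for e
    using F that cd unfolding coord_continuous_def by metis
  from this[of "\<bar>F y - F x\<bar>"] show ?thesis by (cases "F x = F y") auto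
qed

subsection \<open>Central limit theorem and oscillation of the walk\<close>

lemma norm_iexp_diff_le: "norm (iexp x - iexp y) \<le> \<bar>x - y\<bar>"
proof -
  have "iexp x - iexp y = iexp y * (iexp (x - y) - 1)"
    by (simp add: algebra_simps flip: exp_add)
  then have "norm (iexp x - iexp y) = norm (iexp (x - y) - 1)" by (simp add: norm_mult)
  also have "\<dots> \<le> \<bar>x - y\<bar>" using iexp_approx1[of "x - y" 0] by simp
  finally show ?thesis .
qed

context centred_walk
begin

abbreviation "\<Sigma> \<equiv> second_moment_matrix M (\<xi> 0)"

lemma second_moment_inner:
  "u \<bullet> (\<Sigma> *v w) = expectation (\<lambda>\<omega>. (u \<bullet> \<xi> 0 \<omega>) * (w \<bullet> \<xi> 0 \<omega>))"
  "integrable M (\<lambda>\<omega>. (u \<bullet> \<xi> 0 \<omega>) * (w \<bullet> \<xi> 0 \<omega>))"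
proof -
  have int: "integrable M (\<lambda>\<omega>. \<xi> 0 \<omega> $ i * \<xi> 0 \<omega> $ j)" for i j
  proof (rule Bochner_Integration.integrable_bound[OF square_integrable])
    show "AE \<omega> in M. norm (\<xi> 0 \<omega> $ i * \<xi> 0 \<omega> $ j) \<le> norm ((norm (\<xi> 0 \<omega>))\<^sup>2)"
      by (rule AE_I2) (simp add: abs_mult power2_eq_square mult_mono component_le_norm_cart)
  qed measurable
  have eq: "(u \<bullet> x) * (w \<bullet> x) = (\<Sum>i\<in>UNIV. \<Sum>j\<in>UNIV. u $ i * (w $ j * (x $ i * x $ j)))" for x :: "real^'n"
    by (simp add: inner_vec_def sum_product mult_ac)
  show "integrable M (\<lambda>\<omega>. (u \<bullet> \<xi> 0 \<omega>) * (w \<bullet> \<xi> 0 \<omega>))"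
    unfolding eq using int by (intro Bochner_Integration.integrable_sum integrable_mult_right)
  have "expectation (\<lambda>\<omega>. (u \<bullet> \<xi> 0 \<omega>) * (w \<bullet> \<xi> 0 \<omega>)) =
      (\<Sum>i\<in>UNIV. \<Sum>j\<in>UNIV. u $ i * (w $ j * expectation (\<lambda>\<omega>. \<xi> 0 \<omega> $ i * \<xi> 0 \<omega> $ j)))"
    unfolding eq using int by (simp add: Bochner_Integration.integral_sum)
  also have "\<dots> = u \<bullet> (\<Sigma> *v w)"
    by (simp add: inner_vec_def second_moment_matrix_def matrix_vector_mult_def sum_distrib_left mult_ac)
  finally show "u \<bullet> (\<Sigma> *v w) = expectation (\<lambda>\<omega>. (u \<bullet> \<xi> 0 \<omega>) * (w \<bullet> \<xi> 0 \<omega>))" ..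
qed

lemma transpose_second_moment: "transpose \<Sigma> = \<Sigma>"
  by (simp add: transpose_def second_moment_matrix_def vec_eq_iff mult.commute)

lemma second_moment_psd: "0 \<le> u \<bullet> (\<Sigma> *v u)"
  unfolding second_moment_inner by (intro Bochner_Integration.integral_nonneg) simp

text \<open>Projection on \<open>u\<close> reduces to the central limit theorem on the line, which
  asks for positive variance. If \<open>u \<bullet> (\<Sigma> *v u) = 0\<close>, the projected walk
  vanishes almost surely and both sides are 1.\<close>

lemma clt_char:
  "(\<lambda>k. \<integral>\<omega>. iexp (u \<bullet> (S k \<omega> /\<^sub>R sqrt (real k))) \<partial>M) \<longlonglongrightarrow> complex_of_real (exp (- (u \<bullet> (\<Sigma> *v u)) / 2))"
proof -
  define v where "v = u \<bullet> (\<Sigma> *v u)"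
  have v: "v = expectation (\<lambda>\<omega>. (u \<bullet> \<xi> 0 \<omega>)\<^sup>2)" by (simp add: v_def second_moment_inner power2_eq_square)
  have isq: "integrable M (\<lambda>\<omega>. (u \<bullet> \<xi> i \<omega>)\<^sup>2)" for i
    using second_moment_inner(2)[of u u] xi_transfer(2)[of "\<lambda>x. (u \<bullet> x)\<^sup>2" i] by (simp add: power2_eq_square)
  have esq: "expectation (\<lambda>\<omega>. (u \<bullet> \<xi> i \<omega>)\<^sup>2) = v" for i
    using xi_transfer(1)[of "\<lambda>x. (u \<bullet> x)\<^sup>2" i] v by simp
  define Y where "Y i \<omega> = u \<bullet> \<xi> (Suc i) \<omega>" for i \<omega>
  have sumY: "(\<Sum>i<k. Y i \<omega>) = u \<bullet> S k \<omega>" for k \<omega>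
    by (induction k) (simp_all add: Y_def S_Suc inner_add_right)
  show ?thesis
  proof (cases "v = 0")
    case False
    then have vpos: "v > 0" using second_moment_psd[of u] by (simp add: v_def)
    have EY: "expectation (Y i) = 0" for i
    proof -
      have "expectation (\<lambda>\<omega>. u \<bullet> \<xi> (Suc i) \<omega>) = u \<bullet> expectation (\<xi> (Suc i))"
        by (rule integral_inner_right) (rule integrable_xi)
      then show ?thesis by (simp add: Y_def[abs_def] mean_zero_xi)
    qed
    have "weak_conv_m (\<lambda>n. distr M borel (\<lambda>\<omega>. (\<Sum>i<n. Y i \<omega>) / sqrt (real n * (sqrt v)\<^sup>2))) std_normal_distribution"
    proof (rule central_limit_theorem_zero_mean[where \<mu> = "distr M borel (\<lambda>\<omega>. u \<bullet> \<xi> 0 \<omega>)"])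
      show "indep_vars (\<lambda>i. borel) Y UNIV"
        unfolding Y_def using indep_vars_compose2[OF indep_shift[of 1], of "\<lambda>_ x. u \<bullet> x" "\<lambda>_. borel"] by simp
      show "distr M borel (Y n) = distr M borel (\<lambda>\<omega>. u \<bullet> \<xi> 0 \<omega>)" for n
      proof -
        have "distr M borel (\<lambda>\<omega>. u \<bullet> \<xi> i \<omega>) = distr (distr M borel (\<xi> i)) borel (\<lambda>x. u \<bullet> x)" for i
          by (subst distr_distr) (auto simp: o_def)
        then show ?thesis unfolding Y_def using ident[of "Suc n"] by metis
      qed
      show "integrable M (\<lambda>\<omega>. (Y n \<omega>)\<^sup>2)" for n unfolding Y_def by (rule isq)
      show "variance (Y n) = (sqrt v)\<^sup>2" for n
        using EY[of n] esq[of "Suc n"] vpos by (simp add: Y_def)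
    qed (use EY vpos in auto)
    \<comment> \<open>The one-dimensional theorem normalises to variance 1; evaluating at
      \<open>sqrt v\<close> undoes this.\<close>
    from levy_continuity1[OF _ _ this, of "sqrt v"]
    have "(\<lambda>n. char (distr M borel (\<lambda>\<omega>. (\<Sum>i<n. Y i \<omega>) / sqrt (real n * (sqrt v)\<^sup>2))) (sqrt v)) \<longlonglongrightarrow> char std_normal_distribution (sqrt v)"
      by (simp add: sumY real_distribution_distr real_dist_normal_dist)
    moreover have "char (distr M borel (\<lambda>\<omega>. (\<Sum>i<n. Y i \<omega>) / sqrt (real n * (sqrt v)\<^sup>2))) (sqrt v)
        = (\<integral>\<omega>. iexp (u \<bullet> (S n \<omega> /\<^sub>R sqrt (real n))) \<partial>M)" for n
      unfolding char_def sumY using vpos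
      by (subst integral_distr) (auto simp: real_sqrt_mult field_simps intro!: Bochner_Integration.integral_cong)
    ultimately show ?thesis using vpos by (simp add: char_std_normal_distribution v_def)
  next
    case True
    have "AE \<omega> in M. u \<bullet> \<xi> i \<omega> = 0" for i
      using integral_nonneg_eq_0_iff_AE[OF isq[of i]] esq[of i] True by simp
    then have "AE \<omega> in M. \<forall>i. u \<bullet> \<xi> i \<omega> = 0" by (simp add: AE_all_countable)
    then have "AE \<omega> in M. iexp (u \<bullet> (S k \<omega> /\<^sub>R sqrt (real k))) = 1" for k
      by eventually_elim (simp add: sumY[symmetric] Y_def)
    then have "(\<integral>\<omega>. iexp (u \<bullet> (S k \<omega> /\<^sub>R sqrt (real k))) \<partial>M) = (\<integral>\<omega>. 1 \<partial>M)" for k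
      by (intro integral_cong_AE) auto
    then show ?thesis using True by (simp add: prob_space v_def)
  qed
qed

lemma expectation_norm_S_le: "expectation (\<lambda>\<omega>. norm (S k \<omega>)) \<le> sqrt (real k * C)"
proof -
  have "integrable M (\<lambda>\<omega>. norm (S k \<omega>))"
    using integrable_S_sq by (intro square_integrable_imp_integrable[where f = "\<lambda>\<omega>. norm (S k \<omega>)"]) auto
  then have "(expectation (\<lambda>\<omega>. norm (S k \<omega>)))\<^sup>2 \<le> expectation (\<lambda>\<omega>. (norm (S k \<omega>))\<^sup>2)"
    using variance_eq[of "\<lambda>\<omega>. norm (S k \<omega>)"] integrable_S_sq[of k] variance_positive[of "\<lambda>\<omega>. norm (S k \<omega>)"] by simp
  then show ?thesis unfolding second_moment_S by (rule real_le_rsqrt)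
qed

lemma div_tendsto:
  assumes m: "0 < m"
  shows "filterlim (\<lambda>n. n div m) at_top sequentially"
    and "(\<lambda>n. real (n div m) / real n) \<longlonglongrightarrow> 1 / real m"
proof -
  show "filterlim (\<lambda>n. n div m) at_top sequentially"
    unfolding filterlim_at_top
  proof
    fix Z
    show "\<forall>\<^sub>F n in sequentially. Z \<le> n div m"
      using eventually_ge_at_top[of "Z * m"]
      by eventually_elim (use m in \<open>simp add: less_eq_div_iff_mult_less_eq\<close>)
  qed
  have lim0: "(\<lambda>n. 1 / real n) \<longlonglongrightarrow> 0" by (rule lim_1_over_n)
  have "(\<lambda>n. 1 / real m - 1 / real n) \<longlonglongrightarrow> 1 / real m - 0" by (intro tendsto_intros lim0)
  then have lim1: "(\<lambda>n. 1 / real m - 1 / real n) \<longlonglongrightarrow> 1 / real m" by simp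
  show "(\<lambda>n. real (n div m) / real n) \<longlonglongrightarrow> 1 / real m"
  proof (rule real_tendsto_sandwich[OF _ _ lim1 tendsto_const])
    have *: "real n / real m - 1 \<le> real (n div m)" "real (n div m) \<le> real n / real m" for n
    proof -
      have "real n / real m = real (n div m) + real (n mod m) / real m"
      proof -
        have "real n = real (n div m) * real m + real (n mod m)"
          by (metis div_mult_mod_eq of_nat_add of_nat_mult)
        then show ?thesis using m by (simp add: field_simps)
      qed
      moreover have "real (n mod m) / real m \<le> 1" "0 \<le> real (n mod m) / real m" using m by (auto simp: less_imp_le)
      ultimately show "real n / real m - 1 \<le> real (n div m)" "real (n div m) \<le> real n / real m" by linarith+
    qed
    show "\<forall>\<^sub>F n in sequentially. 1 / real m - 1 / real n \<le> real (n div m) / real n"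
      using eventually_gt_at_top[of 0]
    proof eventually_elim
      case (elim n)
      have "1 / real m - 1 / real n = (real n / real m - 1) / real n" using elim by (simp add: diff_divide_distrib)
      also have "\<dots> \<le> real (n div m) / real n" using *(1) by (rule divide_right_mono) simp
      finally show ?case .
    qed
    show "\<forall>\<^sub>F n in sequentially. real (n div m) / real n \<le> 1 / real m"
      using eventually_gt_at_top[of 0]
    proof eventually_elim
      case (elim n)
      have "real (n div m) / real n \<le> (real n / real m) / real n" using *(2) by (rule divide_right_mono) simp
      then show ?case using elim by simp
    qed
  qed
qed

text \<open>A block has \<open>n div m\<close> steps but is normalised by \<open>sqrt n\<close>.
  Exchanging this for the normalisation of the central limit theorem changes the characteristic
  function by at most a constant times the mean of \<open>norm (S (n div m))\<close> times the
  difference of the two factors, which tends to 0.\<close>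

lemma block_char:
  assumes m: "0 < m"
  shows "(\<lambda>n. \<integral>\<omega>. iexp (u \<bullet> (S (n div m) \<omega> /\<^sub>R sqrt (real n))) \<partial>M)
    \<longlonglongrightarrow> complex_of_real (exp (- (u \<bullet> (\<Sigma> *v u)) / (2 * real m)))"
proof -
  \<comment> \<open>Absorbs the ratio of the two normalisations in the limit and produces the
    covariance \<open>\<Sigma>\<close> divided by \<open>m\<close>.\<close>
  define w where "w = u /\<^sub>R sqrt (real m)"
  have w: "w \<bullet> (\<Sigma> *v w) = (u \<bullet> (\<Sigma> *v u)) / real m"
    using m by (simp add: w_def matrix_vector_mult_scaleR field_simps flip: real_sqrt_mult)
  have lim: "(\<lambda>n. \<integral>\<omega>. iexp (w \<bullet> (S (n div m) \<omega> /\<^sub>R sqrt (real (n div m)))) \<partial>M)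
      \<longlonglongrightarrow> complex_of_real (exp (- (u \<bullet> (\<Sigma> *v u)) / (2 * real m)))"
    using filterlim_compose[OF clt_char[of w] div_tendsto(1)[OF m]] by (simp add: w mult.commute)
  define d where "d n = norm u * sqrt C * \<bar>sqrt (real (n div m) / real n) - 1 / sqrt (real m)\<bar>" for n
  have "d \<longlonglongrightarrow> norm u * sqrt C * \<bar>sqrt (1 / real m) - 1 / sqrt (real m)\<bar>"
    unfolding d_def by (intro tendsto_intros div_tendsto(2) m)
  then have d0: "d \<longlonglongrightarrow> 0" by (simp add: real_sqrt_divide)
  have "(\<lambda>n. (\<integral>\<omega>. iexp (u \<bullet> (S (n div m) \<omega> /\<^sub>R sqrt (real n))) \<partial>M) -
      (\<integral>\<omega>. iexp (w \<bullet> (S (n div m) \<omega> /\<^sub>R sqrt (real (n div m)))) \<partial>M)) \<longlonglongrightarrow> 0"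
  proof (rule Lim_null_comparison[OF _ d0])
    show "\<forall>\<^sub>F n in sequentially. norm ((\<integral>\<omega>. iexp (u \<bullet> (S (n div m) \<omega> /\<^sub>R sqrt (real n))) \<partial>M) -
      (\<integral>\<omega>. iexp (w \<bullet> (S (n div m) \<omega> /\<^sub>R sqrt (real (n div m)))) \<partial>M)) \<le> d n"
      using eventually_ge_at_top[of m]
    proof eventually_elim
      case (elim n)
      define q where "q = n div m"
      have q: "0 < q" "0 < n" using elim m by (auto simp: q_def div_greater_zero_iff)
      define r where "r = \<bar>1 / sqrt (real n) - 1 / (sqrt (real m) * sqrt (real q))\<bar>"
      have i: "integrable M (\<lambda>\<omega>. norm (S q \<omega>))"
        using integrable_S_sq by (intro square_integrable_imp_integrable[where f = "\<lambda>\<omega>. norm (S q \<omega>)"]) auto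
      have ie: "integrable M (\<lambda>\<omega>. iexp (a \<bullet> (S q \<omega> /\<^sub>R c)))" for a c
        by (rule integrable_const_bound[where B = 1]) auto
      have "norm ((\<integral>\<omega>. iexp (u \<bullet> (S q \<omega> /\<^sub>R sqrt (real n))) \<partial>M) - (\<integral>\<omega>. iexp (w \<bullet> (S q \<omega> /\<^sub>R sqrt (real q))) \<partial>M))
          = norm (\<integral>\<omega>. iexp (u \<bullet> (S q \<omega> /\<^sub>R sqrt (real n))) - iexp (w \<bullet> (S q \<omega> /\<^sub>R sqrt (real q))) \<partial>M)"
        by (subst Bochner_Integration.integral_diff[OF ie ie]) simp
      also have "\<dots> \<le> (\<integral>\<omega>. norm (iexp (u \<bullet> (S q \<omega> /\<^sub>R sqrt (real n))) - iexp (w \<bullet> (S q \<omega> /\<^sub>R sqrt (real q)))) \<partial>M)"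
        by (rule integral_norm_bound)
      also have "\<dots> \<le> (\<integral>\<omega>. norm u * r * norm (S q \<omega>) \<partial>M)"
      proof (rule integral_mono)
        fix \<omega>
        have "norm (iexp (u \<bullet> (S q \<omega> /\<^sub>R sqrt (real n))) - iexp (w \<bullet> (S q \<omega> /\<^sub>R sqrt (real q)))) \<le>
            \<bar>u \<bullet> (S q \<omega> /\<^sub>R sqrt (real n)) - w \<bullet> (S q \<omega> /\<^sub>R sqrt (real q))\<bar>"
          by (rule norm_iexp_diff_le)
        also have "\<dots> = r * \<bar>u \<bullet> S q \<omega>\<bar>"
          unfolding r_def w_def by (simp add: divide_inverse algebra_simps flip: abs_mult)
        also have "\<dots> \<le> r * (norm u * norm (S q \<omega>))"
          unfolding r_def by (intro mult_left_mono Cauchy_Schwarz_ineq2) auto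
        finally show "norm (iexp (u \<bullet> (S q \<omega> /\<^sub>R sqrt (real n))) - iexp (w \<bullet> (S q \<omega> /\<^sub>R sqrt (real q)))) \<le> norm u * r * norm (S q \<omega>)"
          by (simp add: mult_ac)
      qed (use i ie in auto)
      also have "\<dots> = norm u * r * expectation (\<lambda>\<omega>. norm (S q \<omega>))" by simp
      also have "\<dots> \<le> norm u * r * sqrt (real q * C)"
        using expectation_norm_S_le by (intro mult_left_mono) (auto simp: r_def)
      also have "\<dots> = norm u * sqrt C * (r * sqrt (real q))" by (simp add: real_sqrt_mult mult_ac)
      also have "r * sqrt (real q) = \<bar>sqrt (real q / real n) - 1 / sqrt (real m)\<bar>"
      proof -
        have "r * sqrt (real q) = \<bar>(1 / sqrt (real n) - 1 / (sqrt (real m) * sqrt (real q))) * sqrt (real q)\<bar>"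
          by (simp add: r_def abs_mult)
        also have "(1 / sqrt (real n) - 1 / (sqrt (real m) * sqrt (real q))) * sqrt (real q) = sqrt (real q / real n) - 1 / sqrt (real m)"
          using q by (simp add: left_diff_distrib real_sqrt_divide)
        finally show ?thesis .
      qed
      finally show ?case unfolding d_def q_def .
    qed
  qed
  from tendsto_add[OF this lim] show ?thesis by simp
qed

text \<open>The limit law is given by its characteristic function alone, so that the law of a
  transformed Brownian increment can be inserted later.\<close>

lemma block_weak:
  assumes m: "0 < m" and \<nu>: "prob_space \<nu>" "sets \<nu> = sets borel"
    and char: "\<And>u. (\<integral>x. iexp (u \<bullet> x) \<partial>\<nu>) = complex_of_real (exp (- (u \<bullet> (\<Sigma> *v u)) / (2 * real m)))"
  shows "weak_lipschitz (\<lambda>n. distr M borel (\<lambda>\<omega>. S (n div m) \<omega> /\<^sub>R sqrt (real n))) \<nu>"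
proof (rule levy_continuity_lipschitz)
  show "(\<lambda>n. \<integral>x. iexp (u \<bullet> x) \<partial>distr M borel (\<lambda>\<omega>. S (n div m) \<omega> /\<^sub>R sqrt (real n))) \<longlonglongrightarrow> (\<integral>x. iexp (u \<bullet> x) \<partial>\<nu>)" for u
    unfolding char using block_char[OF m, of u] by (subst integral_distr) auto
qed (use \<nu> in \<open>auto intro: prob_space_distr\<close>)

lemma indep_blocks: "indep_vars (\<lambda>_. borel) (\<lambda>j \<omega>. (S (Suc j * q) \<omega> - S (j * q) \<omega>) /\<^sub>R c) UNIV"
proof -
  have "disjoint_family_on (\<lambda>j. {j * q + 1..Suc j * q}) UNIV"
  proof -
    have "False" if "i < j" "x \<le> Suc i * q" "j * q + 1 \<le> x" for i j x
    proof -
      have "Suc i * q \<le> j * q" using that(1) by (intro mult_right_mono) auto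
      then show False using that by linarith
    qed
    then show ?thesis unfolding disjoint_family_on_def
      by (auto simp: neq_iff)
  qed
  then have "indep_vars (\<lambda>j. PiM {j * q + 1..Suc j * q} (\<lambda>_. borel)) (\<lambda>j \<omega>. restrict (\<lambda>i. \<xi> i \<omega>) {j * q + 1..Suc j * q}) UNIV"
    by (intro indep_vars_restrict[OF indep]) auto
  then have "indep_vars (\<lambda>_. borel) (\<lambda>j \<omega>. (\<Sum>i\<in>{j * q + 1..Suc j * q}. restrict (\<lambda>i. \<xi> i \<omega>) {j * q + 1..Suc j * q} i) /\<^sub>R c) UNIV"
    by (rule indep_vars_compose2[where Y = "\<lambda>j x. (\<Sum>i\<in>{j * q + 1..Suc j * q}. x i) /\<^sub>R c"]) measurable
  moreover have "(\<Sum>i\<in>{j * q + 1..Suc j * q}. restrict (\<lambda>i. \<xi> i \<omega>) {j * q + 1..Suc j * q} i) = S (Suc j * q) \<omega> - S (j * q) \<omega>" for j \<omega>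
  proof -
    have "(\<Sum>i\<in>{1..j * q + q}. \<xi> i \<omega>) = (\<Sum>i\<in>{1..j * q}. \<xi> i \<omega>) + (\<Sum>i\<in>{j * q + 1..j * q + q}. \<xi> i \<omega>)"
      by (rule sum.ub_add_nat) simp
    then show ?thesis by (simp add: partial_sum_def add.commute[of q])
  qed
  ultimately show ?thesis by simp
qed

text \<open>\<open>F\<close> sees the first \<open>m\<close> coordinates only, so the blocks may be
  restricted to \<open>{..<m}\<close>, where independence identifies their joint law as a product.
  Stationarity replaces each factor by the law of the first block.\<close>

lemma expectation_blocks:
  fixes F :: "(nat \<Rightarrow> real^'n) \<Rightarrow> real"
  assumes F: "coord_continuous m F" and m: "0 < m"
  shows "expectation (\<lambda>\<omega>. F (\<lambda>j. (S (Suc j * q) \<omega> - S (j * q) \<omega>) /\<^sub>R c)) =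
    (\<integral>x. F x \<partial>PiM {..<m} (\<lambda>j. distr M borel (\<lambda>\<omega>. S q \<omega> /\<^sub>R c)))"
proof -
  define X where "X j \<omega> = (S (Suc j * q) \<omega> - S (j * q) \<omega>) /\<^sub>R c" for j \<omega>
  have X[measurable]: "X j \<in> borel_measurable M" for j unfolding X_def by measurable
  have law: "distr M borel (X j) = distr M borel (\<lambda>\<omega>. S q \<omega> /\<^sub>R c)" for j
  proof -
    have "distr M borel (X j) = distr (distr M borel (\<lambda>\<omega>. S (j * q + q) \<omega> - S (j * q) \<omega>)) borel (\<lambda>x. x /\<^sub>R c)"
      by (subst distr_distr) (auto simp: o_def X_def[abs_def] add.commute)
    also have "\<dots> = distr M borel (\<lambda>\<omega>. S q \<omega> /\<^sub>R c)"
      unfolding distr_increment by (subst distr_distr) (auto simp: o_def)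
    finally show ?thesis .
  qed
  have "indep_vars (\<lambda>_. borel) X {..<m}"
    using indep_blocks[where q = q and c = c] unfolding X_def[abs_def] by (rule indep_vars_subset) simp
  then have joint: "distr M (PiM {..<m} (\<lambda>_. borel)) (\<lambda>\<omega>. \<lambda>j\<in>{..<m}. X j \<omega>) = PiM {..<m} (\<lambda>j. distr M borel (X j))"
    using m by (subst (asm) indep_vars_iff_distr_eq_PiM') auto
  have Fm: "F \<in> borel_measurable (PiM {..<m} (\<lambda>_. borel))"
    by (rule borel_measurable_continuous_PiM[OF coord_continuous_imp_continuous_on[OF F]]) simp
  have "expectation (\<lambda>\<omega>. F (\<lambda>j. X j \<omega>)) = expectation (\<lambda>\<omega>. F (\<lambda>j\<in>{..<m}. X j \<omega>))"
    by (intro Bochner_Integration.integral_cong refl coord_continuous_cong[OF F]) simp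
  also have "\<dots> = (\<integral>x. F x \<partial>distr M (PiM {..<m} (\<lambda>_. borel)) (\<lambda>\<omega>. \<lambda>j\<in>{..<m}. X j \<omega>))"
    by (rule integral_distr[symmetric, OF _ Fm]) measurable
  also have "\<dots> = (\<integral>x. F x \<partial>PiM {..<m} (\<lambda>j. distr M borel (\<lambda>\<omega>. S q \<omega> /\<^sub>R c)))"
    unfolding joint law ..
  finally show ?thesis unfolding X_def .
qed

text \<open>The truncations \<open>h K\<close> are bounded and Lipschitz, and their means along the
  normalised walk are at most \<open>C\<close>. Weak convergence hands this bound to
  \<open>\<nu>\<close>, and Fatou's lemma removes the truncation.\<close>

lemma integrable_norm_sq_limit:
  assumes \<nu>: "prob_space \<nu>" "sets \<nu> = sets borel"
    and char: "\<And>u. (\<integral>x. iexp (u \<bullet> x) \<partial>\<nu>) = complex_of_real (exp (- (u \<bullet> (\<Sigma> *v u)) / 2))"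
  shows "integrable \<nu> (\<lambda>x. (norm x)\<^sup>2)"
proof -
  interpret \<nu>: prob_space \<nu> by (rule \<nu>)
  note [measurable_cong] = \<nu>(2)
  have w: "weak_lipschitz (\<lambda>n. distr M borel (\<lambda>\<omega>. S n \<omega> /\<^sub>R sqrt (real n))) \<nu>"
    using block_weak[of 1 \<nu>] \<nu> char by simp
  define h where "h K x = (min (real K) (norm x))\<^sup>2" for K and x :: "real^'n"
  have hm[measurable]: "h K \<in> borel_measurable borel" for K unfolding h_def by measurable
  have hb: "\<bar>h K x\<bar> \<le> (real K)\<^sup>2" for K x unfolding h_def by (simp add: power_mono)
  have hlip: "(2 * real K)-lipschitz_on UNIV (h K)" for K
  proof (rule lipschitz_onI)
    fix x y :: "real^'n"
    let ?a = "min (real K) (norm x)" and ?b = "min (real K) (norm y)"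
    have "\<bar>?a - ?b\<bar> \<le> norm (x - y)" using norm_triangle_ineq3[of x y] by linarith
    moreover have "\<bar>?a + ?b\<bar> \<le> 2 * real K" by simp
    ultimately have "\<bar>?a + ?b\<bar> * \<bar>?a - ?b\<bar> \<le> (2 * real K) * norm (x - y)" by (intro mult_mono) auto
    moreover have "h K x - h K y = (?a + ?b) * (?a - ?b)" by (simp add: h_def power2_eq_square algebra_simps)
    ultimately show "dist (h K x) (h K y) \<le> 2 * real K * dist x y" by (simp add: dist_norm abs_mult)
  qed simp
  have le: "integral\<^sup>L \<nu> (h K) \<le> C" for K
  proof (rule LIMSEQ_le_const2)
    show "(\<lambda>n. integral\<^sup>L (distr M borel (\<lambda>\<omega>. S n \<omega> /\<^sub>R sqrt (real n))) (h K)) \<longlonglongrightarrow> integral\<^sup>L \<nu> (h K)"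
      using w hb hlip unfolding weak_lipschitz_def by blast
    show "\<exists>N. \<forall>n\<ge>N. integral\<^sup>L (distr M borel (\<lambda>\<omega>. S n \<omega> /\<^sub>R sqrt (real n))) (h K) \<le> C"
    proof (intro exI[of _ 1] allI impI)
      fix n :: nat assume n: "1 \<le> n"
      have "integral\<^sup>L (distr M borel (\<lambda>\<omega>. S n \<omega> /\<^sub>R sqrt (real n))) (h K) = expectation (\<lambda>\<omega>. h K (S n \<omega> /\<^sub>R sqrt (real n)))"
        by (rule integral_distr) auto
      also have "\<dots> \<le> expectation (\<lambda>\<omega>. (norm (S n \<omega>))\<^sup>2 / real n)"
      proof (rule integral_mono)
        show "integrable M (\<lambda>\<omega>. h K (S n \<omega> /\<^sub>R sqrt (real n)))"
          using hb by (intro integrable_const_bound[where B = "(real K)\<^sup>2"]) auto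
        show "h K (S n \<omega> /\<^sub>R sqrt (real n)) \<le> (norm (S n \<omega>))\<^sup>2 / real n" for \<omega>
        proof -
          have "h K (S n \<omega> /\<^sub>R sqrt (real n)) \<le> (norm (S n \<omega> /\<^sub>R sqrt (real n)))\<^sup>2"
            unfolding h_def by (intro power_mono) auto
          also have "\<dots> = (norm (S n \<omega>))\<^sup>2 / real n"
            using n by (simp add: power_mult_distrib power_inverse divide_inverse)
          finally show ?thesis .
        qed
      qed (use integrable_S_sq in auto)
      also have "\<dots> = C" using n second_moment_S[of n] by simp
      finally show "integral\<^sup>L (distr M borel (\<lambda>\<omega>. S n \<omega> /\<^sub>R sqrt (real n))) (h K) \<le> C" .
    qed
  qed
  have "(\<integral>\<^sup>+x. ennreal ((norm x)\<^sup>2) \<partial>\<nu>) \<le> liminf (\<lambda>K. \<integral>\<^sup>+x. ennreal (h K x) \<partial>\<nu>)"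
  proof -
    have "ennreal ((norm x)\<^sup>2) = liminf (\<lambda>K. ennreal (h K x))" for x
    proof (rule lim_imp_Liminf[symmetric])
      have "\<forall>\<^sub>F K in sequentially. ennreal (h K x) = ennreal ((norm x)\<^sup>2)"
        using eventually_ge_at_top[of "nat \<lceil>norm x\<rceil>"]
      proof eventually_elim
        case (elim K)
        then have "norm x \<le> real K" by linarith
        then show ?case by (simp add: h_def min_absorb2)
      qed
      then show "(\<lambda>K. ennreal (h K x)) \<longlonglongrightarrow> ennreal ((norm x)\<^sup>2)" by (rule tendsto_eventually)
    qed simp
    then show ?thesis using nn_integral_liminf[of "\<lambda>K x. ennreal (h K x)" \<nu>] by simp
  qed
  also have "\<dots> \<le> limsup (\<lambda>K. \<integral>\<^sup>+x. ennreal (h K x) \<partial>\<nu>)" by (rule Liminf_le_Limsup) simp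
  also have "\<dots> \<le> ennreal C"
  proof (rule Limsup_bounded, intro always_eventually allI)
    fix K
    have "(\<integral>\<^sup>+x. ennreal (h K x) \<partial>\<nu>) = ennreal (integral\<^sup>L \<nu> (h K))"
      using hb by (intro nn_integral_eq_integral \<nu>.integrable_const_bound[where B = "(real K)\<^sup>2"]) (auto simp: h_def)
    then show "(\<integral>\<^sup>+x. ennreal (h K x) \<partial>\<nu>) \<le> ennreal C" using le by (simp add: ennreal_leI)
  qed
  finally have "(\<integral>\<^sup>+x. ennreal ((norm x)\<^sup>2) \<partial>\<nu>) < \<infinity>" by (rule le_less_trans) simp
  then show ?thesis by (intro integrableI_nonneg) auto
qed

lemma shifted_walk: "centred_walk M (\<lambda>i. \<xi> (a + i))"
proof
  show "distr M borel (\<xi> (a + i)) = distr M borel (\<xi> (a + 0))" for i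
    using ident[of "a + i"] ident[of a] by simp
qed (use indep_shift mean_zero_xi square_integrable_xi in auto)

lemma maximal_inequality_shift:
  assumes a: "0 < a" and small: "real n * C / a\<^sup>2 \<le> 1 / 2"
  shows "prob {\<omega>\<in>space M. \<exists>k\<le>n. 2 * a \<le> norm (S (b + k) \<omega> - S b \<omega>)} \<le> 2 * prob {\<omega>\<in>space M. a \<le> norm (S n \<omega>)}"
proof -
  interpret sh: centred_walk M "\<lambda>i. \<xi> (b + i)" by (rule shifted_walk)
  have ps: "partial_sum (\<lambda>i. \<xi> (b + i)) k \<omega> = S (b + k) \<omega> - S b \<omega>" for k \<omega>
    by (induction k) (simp_all add: S_Suc sh.S_Suc)
  have "expectation (\<lambda>\<omega>. (norm (\<xi> (b + 0) \<omega>))\<^sup>2) = C"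
    using xi_transfer(1)[of "\<lambda>x. (norm x)\<^sup>2" b] by simp
  then have "prob {\<omega>\<in>space M. \<exists>k\<le>n. 2 * a \<le> norm (S (b + k) \<omega> - S b \<omega>)}
      \<le> 2 * prob {\<omega>\<in>space M. a \<le> norm (S (b + n) \<omega> - S b \<omega>)}"
    using sh.maximal_inequality[OF a, of n] small unfolding ps by simp
  also have "prob {\<omega>\<in>space M. a \<le> norm (S (b + n) \<omega> - S b \<omega>)} = prob {\<omega>\<in>space M. a \<le> norm (S n \<omega>)}"
    using prob_increment[of "{x. a \<le> norm x}" b n] by simp
  finally show ?thesis .
qed

text \<open>By the central limit theorem and the moments of its limit, the tail of one block is \<open>o(1/m)\<close>,
  which beats the union bound over the \<open>m + 1\<close> blocks.\<close>

lemma oscillation: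
  assumes \<nu>: "prob_space \<nu>" "sets \<nu> = sets borel"
    and char: "\<And>u. (\<integral>x. iexp (u \<bullet> x) \<partial>\<nu>) = complex_of_real (exp (- (u \<bullet> (\<Sigma> *v u)) / 2))"
    and \<delta>: "0 < \<delta>" and \<eta>: "0 < \<eta>"
  shows "\<forall>\<^sub>F m in sequentially. \<forall>\<^sub>F n in sequentially.
    prob {\<omega>\<in>space M. \<exists>j\<le>m. \<exists>i\<le>n div m. 2 * (\<delta> * sqrt (real n)) \<le> norm (S (j * (n div m) + i) \<omega> - S (j * (n div m)) \<omega>)} < \<eta>"
proof -
  interpret \<nu>: prob_space \<nu> by (rule \<nu>)
  note [measurable_cong] = \<nu>(2)
  have space_\<nu>: "space \<nu> = UNIV" using sets_eq_imp_space_eq[OF \<nu>(2)] by simp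
  have w: "weak_lipschitz (\<lambda>n. distr M borel (\<lambda>\<omega>. S n \<omega> /\<^sub>R sqrt (real n))) \<nu>"
    using block_weak[of 1 \<nu>] \<nu> char by simp
  have sq: "integrable \<nu> (\<lambda>x. (norm x)\<^sup>2)" by (rule integrable_norm_sq_limit[OF \<nu> char])
  \<comment> \<open>The tail is taken at half the level, which leaves room for a Lipschitz
    cut-off.\<close>
  define p where "p m = \<nu>.prob {x\<in>space \<nu>. \<delta> * sqrt (real m) \<le> 2 * norm x}" for m
  have "(\<lambda>m. \<integral>x. real m * indicator {x. \<delta> * sqrt (real m) \<le> 2 * norm x} x \<partial>\<nu>) \<longlonglongrightarrow> (\<integral>x. 0 \<partial>\<nu>)"
  \<comment> \<open>On the event, squaring gives
    \<open>\<delta>\<^sup>2 * real m \<le> 4 * (norm x)\<^sup>2\<close>; this is the origin of the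
    majorant.\<close>
  proof (rule integral_dominated_convergence[where w = "\<lambda>x. 4 * (norm x)\<^sup>2 / \<delta>\<^sup>2"])
    show "AE x in \<nu>. (\<lambda>m. real m * indicator {x. \<delta> * sqrt (real m) \<le> 2 * norm x} x) \<longlonglongrightarrow> 0"
    proof (rule AE_I2)
      fix x :: "real^'n"
      have "\<forall>\<^sub>F m in sequentially. real m * indicat_real {x. \<delta> * sqrt (real m) \<le> 2 * norm x} x = 0"
      proof -
        have "filterlim (\<lambda>m. \<delta> * sqrt (real m)) at_top sequentially"
          using \<delta> by (intro filterlim_tendsto_pos_mult_at_top[OF tendsto_const] filterlim_compose[OF sqrt_at_top filterlim_real_sequentially])
        then have "\<forall>\<^sub>F m in sequentially. 2 * norm x < \<delta> * sqrt (real m)" by (simp add: filterlim_at_top_dense)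
        then show ?thesis by eventually_elim simp
      qed
      then show "(\<lambda>m. real m * indicator {x. \<delta> * sqrt (real m) \<le> 2 * norm x} x) \<longlonglongrightarrow> (0::real)"
        by (rule tendsto_eventually)
    qed
    show "AE x in \<nu>. norm (real m * indicator {x. \<delta> * sqrt (real m) \<le> 2 * norm x} x :: real) \<le> 4 * (norm x)\<^sup>2 / \<delta>\<^sup>2" for m
    proof (rule AE_I2)
      fix x :: "real^'n"
      show "norm (real m * indicator {x. \<delta> * sqrt (real m) \<le> 2 * norm x} x :: real) \<le> 4 * (norm x)\<^sup>2 / \<delta>\<^sup>2"
      proof (cases "\<delta> * sqrt (real m) \<le> 2 * norm x")
        case True
        then have "(\<delta> * sqrt (real m))\<^sup>2 \<le> (2 * norm x)\<^sup>2" using \<delta> by (intro power_mono) auto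
        then show ?thesis using True \<delta> by (simp add: power_mult_distrib field_simps)
      qed (use \<delta> in simp)
    qed
    show "integrable \<nu> (\<lambda>x. 4 * (norm x)\<^sup>2 / \<delta>\<^sup>2)" using sq by simp
  qed measurable
  moreover have "(\<integral>x. real m * indicator {x. \<delta> * sqrt (real m) \<le> 2 * norm x} x \<partial>\<nu>) = real m * p m" for m
  proof -
    show ?thesis by (simp add: p_def space_\<nu>)
  qed
  ultimately have mp: "(\<lambda>m. real m * p m) \<longlonglongrightarrow> 0" by (simp only: Bochner_Integration.integral_zero)
  have "\<forall>\<^sub>F m in sequentially. 8 * (real m * p m) < \<eta>"
  proof -
    have "(\<lambda>m. 8 * (real m * p m)) \<longlonglongrightarrow> 0" using tendsto_mult_left[OF mp, of 8] by simp
    then show ?thesis using \<eta> by (rule order_tendstoD(2))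
  qed
  \<comment> \<open>Then one unit below the level \<open>\<delta> * sqrt (real m)\<close> is still
    at least half of it, so the cut-off \<open>h\<close> below is supported in the event of
    \<open>p m\<close>.\<close>
  moreover have "\<forall>\<^sub>F m in sequentially. 2 \<le> \<delta> * sqrt (real m)"
  proof -
    have "filterlim (\<lambda>m. \<delta> * sqrt (real m)) at_top sequentially"
          using \<delta> by (intro filterlim_tendsto_pos_mult_at_top[OF tendsto_const] filterlim_compose[OF sqrt_at_top filterlim_real_sequentially])
    then show ?thesis by (simp add: filterlim_at_top)
  qed
  moreover have "\<forall>\<^sub>F m in sequentially. C / \<delta>\<^sup>2 / real m < 1 / 2"
  proof -
    have "(\<lambda>m. C / \<delta>\<^sup>2 / real m) \<longlonglongrightarrow> 0" by (rule lim_const_over_n)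
    then show ?thesis by (rule order_tendstoD(2)) simp
  qed
  ultimately show ?thesis
    using eventually_gt_at_top[of 0]
  proof eventually_elim
    case (elim m)
    note em = elim
    \<comment> \<open>Equals 1 from the level \<open>\<delta> * sqrt (real m)\<close> on and
      vanishes one unit below it.\<close>
    define h where "h x = max 0 (min 1 (norm x - \<delta> * sqrt (real m) + 1))" for x :: "real^'n"
    have hm[measurable]: "h \<in> borel_measurable borel" unfolding h_def by measurable
    have hb: "\<bar>h x\<bar> \<le> 1" for x by (simp add: h_def)
    have hlip: "1-lipschitz_on UNIV h"
    proof (rule lipschitz_onI)
      fix x y :: "real^'n"
      show "dist (h x) (h y) \<le> 1 * dist x y"
        using norm_triangle_ineq3[of x y] unfolding h_def dist_norm real_norm_def by linarith
    qed simp
    have "integral\<^sup>L \<nu> h \<le> p m"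
    proof -
      have "integral\<^sup>L \<nu> h \<le> (\<integral>x. indicator {x\<in>space \<nu>. \<delta> * sqrt (real m) \<le> 2 * norm x} x \<partial>\<nu>)"
      proof (rule integral_mono)
        show "integrable \<nu> h" using hb by (intro \<nu>.integrable_const_bound[where B = 1]) auto
        show "h x \<le> indicator {x\<in>space \<nu>. \<delta> * sqrt (real m) \<le> 2 * norm x} x" if "x \<in> space \<nu>" for x
          using elim(2) that unfolding h_def by (auto simp: indicator_def)
      qed (auto intro!: \<nu>.integrable_const_bound[where B = 1])
      then show ?thesis by (simp add: p_def)
    qed
    \<comment> \<open>The union bound will cost the factor \<open>2 * (m + 1)\<close>, where 2 comes
      from the maximal inequality and \<open>m + 1\<close> from the blocks; this constant leaves
      \<open>\<eta> / 2\<close>.\<close>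
    then have h_small: "integral\<^sup>L \<nu> h < \<eta> / (4 * real (m + 1))"
    proof -
      have "4 * real (m + 1) * integral\<^sup>L \<nu> h \<le> 8 * real m * p m"
      proof -
        have "0 \<le> p m" by (simp add: p_def)
        have "4 * real (m + 1) * integral\<^sup>L \<nu> h \<le> 4 * real (m + 1) * p m"
          using \<open>integral\<^sup>L \<nu> h \<le> p m\<close> by (intro mult_left_mono) auto
        also have "\<dots> \<le> 8 * real m * p m"
          using elim(4) \<open>0 \<le> p m\<close> by (intro mult_right_mono) auto
        finally show ?thesis .
      qed
      then have "4 * real (m + 1) * integral\<^sup>L \<nu> h < \<eta>" using elim(1) by simp
      then show ?thesis by (simp add: field_simps)
    qed
    have "(\<lambda>n. integral\<^sup>L (distr M borel (\<lambda>\<omega>. S n \<omega> /\<^sub>R sqrt (real n))) h) \<longlonglongrightarrow> integral\<^sup>L \<nu> h"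
      using w hb hlip unfolding weak_lipschitz_def by blast
    from filterlim_compose[OF this div_tendsto(1)[OF elim(4)]]
    have "\<forall>\<^sub>F n in sequentially. integral\<^sup>L (distr M borel (\<lambda>\<omega>. S (n div m) \<omega> /\<^sub>R sqrt (real (n div m)))) h < \<eta> / (4 * real (m + 1))"
      using h_small by (rule order_tendstoD(2))
    then show ?case
      using eventually_ge_at_top[of m]
    proof eventually_elim
      case (elim n)
      define q where "q = n div m"
      define a where "a = \<delta> * sqrt (real n)"
      have q: "0 < q" "0 < n" using elim(2) em(4) by (auto simp: q_def div_greater_zero_iff)
      have a: "0 < a" using \<delta> q by (simp add: a_def)
      have mq: "real m * real q \<le> real n" unfolding q_def by (metis mult.commute of_nat_le_iff of_nat_mult div_times_less_eq_dividend)
      have small: "real q * C / a\<^sup>2 \<le> 1 / 2"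
      proof -
        have "real q / real n \<le> 1 / real m" using mq q em(4) by (simp add: field_simps)
        then have "(C / \<delta>\<^sup>2) * (real q / real n) \<le> (C / \<delta>\<^sup>2) * (1 / real m)"
          using C_nonneg by (intro mult_left_mono) auto
        moreover have "real q * C / a\<^sup>2 = (C / \<delta>\<^sup>2) * (real q / real n)"
          using q by (simp add: a_def power_mult_distrib)
        moreover have "(C / \<delta>\<^sup>2) * (1 / real m) < 1 / 2" using em(3) by simp
        ultimately show ?thesis by linarith
      qed
      have tail: "prob {\<omega>\<in>space M. a \<le> norm (S q \<omega>)} < \<eta> / (4 * real (m + 1))"
      proof -
        have "prob {\<omega>\<in>space M. a \<le> norm (S q \<omega>)} = expectation (indicator {\<omega>\<in>space M. a \<le> norm (S q \<omega>)})" by simp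
        also have "\<dots> \<le> expectation (\<lambda>\<omega>. h (S q \<omega> /\<^sub>R sqrt (real q)))"
        proof (rule integral_mono)
          show "integrable M (\<lambda>\<omega>. h (S q \<omega> /\<^sub>R sqrt (real q)))" using hb by (intro integrable_const_bound[where B = 1]) auto
          fix \<omega> assume "\<omega> \<in> space M"
          show "indicator {\<omega>\<in>space M. a \<le> norm (S q \<omega>)} \<omega> \<le> h (S q \<omega> /\<^sub>R sqrt (real q))"
          proof (cases "a \<le> norm (S q \<omega>)")
            case True
            have "\<delta> * sqrt (real m) * sqrt (real q) \<le> a"
              unfolding a_def mult.assoc real_sqrt_mult[symmetric] using mq \<delta> by simp
            then have "\<delta> * sqrt (real m) * sqrt (real q) \<le> norm (S q \<omega>)" using True by linarith
            then have "\<delta> * sqrt (real m) \<le> norm (S q \<omega> /\<^sub>R sqrt (real q))" using q by (simp add: field_simps)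
            then show ?thesis using \<open>\<omega> \<in> space M\<close> True by (simp add: h_def)
          qed (simp add: h_def)
        qed (auto intro!: integrable_const_bound[where B = 1])
        also have "\<dots> = integral\<^sup>L (distr M borel (\<lambda>\<omega>. S q \<omega> /\<^sub>R sqrt (real q))) h"
          by (rule integral_distr[symmetric]) auto
        finally show ?thesis using elim(1) unfolding q_def by simp
      qed
      \<comment> \<open>The block with \<open>j = m\<close> is included to cover the steps left over
        by the division of \<open>n\<close> by \<open>m\<close>.\<close>
      have "prob {\<omega>\<in>space M. \<exists>j\<le>m. \<exists>i\<le>q. 2 * a \<le> norm (S (j * q + i) \<omega> - S (j * q) \<omega>)}
          = prob (\<Union>j\<in>{..m}. {\<omega>\<in>space M. \<exists>i\<le>q. 2 * a \<le> norm (S (j * q + i) \<omega> - S (j * q) \<omega>)})"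
        by (rule arg_cong[where f = prob]) auto
      also have "\<dots> \<le> (\<Sum>j\<in>{..m}. prob {\<omega>\<in>space M. \<exists>i\<le>q. 2 * a \<le> norm (S (j * q + i) \<omega> - S (j * q) \<omega>)})"
        by (rule finite_measure_subadditive_finite) auto
      also have "\<dots> \<le> (\<Sum>j\<in>{..m}. 2 * prob {\<omega>\<in>space M. a \<le> norm (S q \<omega>)})"
        by (intro sum_mono maximal_inequality_shift a small)
      also have "\<dots> = 2 * real (m + 1) * prob {\<omega>\<in>space M. a \<le> norm (S q \<omega>)}" by simp
      also have "\<dots> < 2 * real (m + 1) * (\<eta> / (4 * real (m + 1)))" using tail by (intro mult_strict_left_mono) auto
      also have "\<dots> = \<eta> / 2" by (simp add: field_simps)
      finally show ?case unfolding q_def a_def using \<eta> by simp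
    qed
  qed
qed

end

subsection \<open>Hull functionals of finite sequences\<close>

text \<open>Indices start at 0, so that \<open>m\<close> increments produce the \<open>m + 1\<close>
  vertices from \<open>path_sum x 0 = 0\<close> to \<open>path_sum x m\<close>.\<close>

definition path_sum :: "(nat \<Rightarrow> 'a::comm_monoid_add) \<Rightarrow> nat \<Rightarrow> 'a" where
  "path_sum x k = (\<Sum>j<k. x j)"

lemma coord_continuous_hull:
  fixes \<Phi> :: "'a::euclidean_space set \<Rightarrow> real"
  assumes \<Phi>: "hausdorff_uniform \<Phi>"
  shows "coord_continuous (Suc m) (\<lambda>x. \<Phi> (convex hull (x ` {0..m})))"
  unfolding coord_continuous_def
proof (intro allI impI)
  fix x :: "nat \<Rightarrow> 'a" and \<epsilon> :: real assume e: "0 < \<epsilon>"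
  \<comment> \<open>Vertices within distance 1 of those of \<open>x\<close> stay in the ball of
    radius \<open>R\<close>; hence the final radius \<open>min 1 \<delta>\<close>.\<close>
  define R where "R = (\<Sum>j<Suc m. norm (x j)) + 1"
  have R: "R > 0" unfolding R_def by (intro add_nonneg_pos sum_nonneg) auto
  have e2: "\<epsilon> / 2 > 0" using e by simp
  obtain \<delta> where \<delta>: "\<delta> > 0" and close: "\<And>X Y. compact X \<Longrightarrow> X \<noteq> {} \<Longrightarrow> compact Y \<Longrightarrow> Y \<noteq> {} \<Longrightarrow>
      X \<subseteq> cball 0 R \<Longrightarrow> Y \<subseteq> cball 0 R \<Longrightarrow> (\<And>x. x \<in> X \<Longrightarrow> \<exists>y\<in>Y. dist x y \<le> \<delta>) \<Longrightarrow>
      (\<And>y. y \<in> Y \<Longrightarrow> \<exists>x\<in>X. dist x y \<le> \<delta>) \<Longrightarrow> \<bar>\<Phi> (convex hull X) - \<Phi> (convex hull Y)\<bar> \<le> \<epsilon> / 2"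
    using hausdorff_uniform_hull[OF \<Phi> R e2] by metis
  have "\<bar>\<Phi> (convex hull (y ` {0..m})) - \<Phi> (convex hull (x ` {0..m}))\<bar> < \<epsilon>"
    if y: "coord_dist (Suc m) x y < min 1 \<delta>" for y
  proof -
    have d: "dist (x j) (y j) < min 1 \<delta>" if "j \<le> m" for j
    proof -
      have "dist (x j) (y j) \<le> coord_dist (Suc m) x y"
        unfolding coord_dist_def using that by (intro member_le_sum) auto
      then show ?thesis using y by linarith
    qed
    have xR: "norm (x j) \<le> R - 1" if "j \<le> m" for j
    proof -
      have "norm (x j) \<le> (\<Sum>j<Suc m. norm (x j))" using that by (intro member_le_sum) auto
      then show ?thesis by (simp add: R_def)
    qed
    have yR: "norm (y j) \<le> R" if "j \<le> m" for j
      using xR[OF that] d[OF that] norm_triangle_ineq2[of "y j" "x j"] by (simp add: dist_norm norm_minus_commute)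
    have "\<bar>\<Phi> (convex hull (y ` {0..m})) - \<Phi> (convex hull (x ` {0..m}))\<bar> \<le> \<epsilon> / 2"
    proof (rule close)
      show "y ` {0..m} \<subseteq> cball 0 R" using yR by auto
      show "x ` {0..m} \<subseteq> cball 0 R" using xR by fastforce
      show "\<exists>v\<in>x ` {0..m}. dist u v \<le> \<delta>" if u: "u \<in> y ` {0..m}" for u
      proof -
        obtain j where j: "j \<le> m" "u = y j" using u by auto
        then show ?thesis using d[OF j(1)] by (intro bexI[of _ "x j"]) (auto simp: dist_commute)
      qed
      show "\<exists>u\<in>y ` {0..m}. dist u v \<le> \<delta>" if v: "v \<in> x ` {0..m}" for v
      proof -
        obtain j where j: "j \<le> m" "v = x j" using v by auto
        then show ?thesis using d[OF j(1)] by (intro bexI[of _ "y j"]) (auto simp: dist_commute)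
      qed
    qed (auto intro: finite_imp_compact)
    then show ?thesis using e by linarith
  qed
  then show "\<exists>\<delta>>0. \<forall>y. coord_dist (Suc m) x y < \<delta> \<longrightarrow>
      \<bar>\<Phi> (convex hull (y ` {0..m})) - \<Phi> (convex hull (x ` {0..m}))\<bar> < \<epsilon>"
    using \<delta> by (intro exI[of _ "min 1 \<delta>"]) auto
qed

lemma coord_continuous_path_sum:
  fixes F :: "(nat \<Rightarrow> 'a::real_normed_vector) \<Rightarrow> real"
  assumes F: "coord_continuous (Suc m) F"
  shows "coord_continuous m (\<lambda>x. F (path_sum x))"
  unfolding coord_continuous_def
proof (intro allI impI)
  fix x :: "nat \<Rightarrow> 'a" and \<epsilon> :: real assume "0 < \<epsilon>"
  then obtain \<delta> where \<delta>: "\<delta> > 0" "\<And>y. coord_dist (Suc m) (path_sum x) y < \<delta> \<Longrightarrow> \<bar>F y - F (path_sum x)\<bar> < \<epsilon>"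
    using F unfolding coord_continuous_def by meson
  have "coord_dist (Suc m) (path_sum x) (path_sum y) \<le> real (Suc m) * coord_dist m x y" for y
  proof -
    have "dist (path_sum x k) (path_sum y k) \<le> coord_dist m x y" if "k \<in> {..<Suc m}" for k
    proof -
      have "dist (path_sum x k) (path_sum y k) = norm (\<Sum>j<k. x j - y j)"
        by (simp add: path_sum_def dist_norm sum_subtractf)
      also have "\<dots> \<le> (\<Sum>j<k. dist (x j) (y j))" unfolding dist_norm by (rule norm_sum)
      also have "\<dots> \<le> coord_dist m x y"
        unfolding coord_dist_def using that by (intro sum_mono2) auto
      finally show ?thesis .
    qed
    then have "coord_dist (Suc m) (path_sum x) (path_sum y) \<le> (\<Sum>k<Suc m. coord_dist m x y)"
      unfolding coord_dist_def[of "Suc m"] by (rule sum_mono)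
    then show ?thesis by simp
  qed
  then have "\<bar>F (path_sum y) - F (path_sum x)\<bar> < \<epsilon>" if "coord_dist m x y < \<delta> / real (Suc m)" for y
    using that by (intro \<delta>(2)) (smt (verit) mult.commute pos_less_divide_eq of_nat_0_less_iff zero_less_Suc)
  then show "\<exists>\<delta>>0. \<forall>y. coord_dist m x y < \<delta> \<longrightarrow> \<bar>F (path_sum y) - F (path_sum x)\<bar> < \<epsilon>"
    using \<delta>(1) by (intro exI[of _ "\<delta> / real (Suc m)"]) auto
qed

lemma coord_continuous_compose:
  assumes g: "\<And>t. isCont g t" and F: "coord_continuous m F"
  shows "coord_continuous m (\<lambda>x. g (F x) :: real)"
  unfolding coord_continuous_def
proof (intro allI impI)
  fix x and \<epsilon> :: real assume "0 < \<epsilon>"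
  then obtain d where d: "d > 0" "\<And>t. \<bar>t - F x\<bar> < d \<Longrightarrow> \<bar>g t - g (F x)\<bar> < \<epsilon>"
    using g[of "F x"] unfolding continuous_at_eps_delta dist_real_def by blast
  then obtain \<delta> where "\<delta> > 0" "\<And>y. coord_dist m x y < \<delta> \<Longrightarrow> \<bar>F y - F x\<bar> < d"
    using F unfolding coord_continuous_def by meson
  then show "\<exists>\<delta>>0. \<forall>y. coord_dist m x y < \<delta> \<longrightarrow> \<bar>g (F y) - g (F x)\<bar> < \<epsilon>"
    using d(2) by blast
qed

text \<open>The source of measurability for hull functionals: they are continuous in finitely many
  random vertices.\<close>

lemma measurable_coord_continuous:
  fixes F :: "(nat \<Rightarrow> 'a::second_countable_topology) \<Rightarrow> real"
  assumes F: "continuous_on UNIV F" and X: "\<And>k. X k \<in> borel_measurable M"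
  shows "(\<lambda>\<omega>. F (\<lambda>k. X k \<omega>)) \<in> borel_measurable M"
proof -
  have "(\<lambda>\<omega> k. X k \<omega>) \<in> borel_measurable M"
    using X by (intro measurable_coordinatewise_then_product)
  from measurable_compose[OF this borel_measurable_continuous_onI[OF F]] show ?thesis .
qed

subsection \<open>Brownian motion\<close>

lemma gauss_density_cart: "gauss_density s (x :: real^'n) = (\<Prod>i\<in>UNIV. normal_density 0 s (x $ i))"
proof -
  have B: "(Basis :: (real^'n) set) = range (\<lambda>i. axis i 1)" by (auto simp: Basis_vec_def)
  have "inj (\<lambda>i::'n. axis i (1::real))" by (auto simp: inj_on_def axis_eq_axis)
  then show ?thesis unfolding gauss_density_def B by (simp add: prod.reindex inner_axis)
qed

context
  fixes N :: "'b measure" and b :: "real \<Rightarrow> 'b \<Rightarrow> real^'n"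
  assumes bm: "standard_brownian_motion N b"
begin

lemma bm_prob_space: "prob_space N"
  and bm_measurable: "0 \<le> t \<Longrightarrow> b t \<in> borel_measurable N"
  and bm_0: "\<omega> \<in> space N \<Longrightarrow> b 0 \<omega> = 0"
  and bm_continuous: "\<omega> \<in> space N \<Longrightarrow> continuous_on {0..} (\<lambda>t. b t \<omega>)"
  using bm unfolding standard_brownian_motion_def by auto

lemma bm_measurable_increment:
  assumes st: "0 \<le> s" "s < t"
  shows "(\<lambda>\<omega>. b t \<omega> - b s \<omega>) \<in> borel_measurable N"
proof -
  have "0 \<le> t" using st by simp
  from borel_measurable_diff[OF bm_measurable[OF this] bm_measurable[OF st(1)]]
  show ?thesis by this
qed

lemma bm_char:
  assumes st: "0 \<le> s" "s < t"
  shows "(\<integral>\<omega>. iexp (u \<bullet> (b t \<omega> - b s \<omega>)) \<partial>N) = complex_of_real (exp (- ((t - s) * (u \<bullet> u)) / 2))"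
proof -
  have "distributed N lborel (\<lambda>\<omega>. b t \<omega> - b s \<omega>) (\<lambda>x. ennreal (gauss_density (sqrt (t - s)) x))"
    using bm st unfolding standard_brownian_motion_def gauss_density_cart by blast
  then have law: "distr N lborel (\<lambda>\<omega>. b t \<omega> - b s \<omega>) = density lborel (\<lambda>x. ennreal (gauss_density (sqrt (t - s)) x))"
    by (rule distributed_distr_eq_density)
  have "(\<integral>\<omega>. iexp (u \<bullet> (b t \<omega> - b s \<omega>)) \<partial>N) = (\<integral>x. iexp (u \<bullet> x) \<partial>distr N lborel (\<lambda>\<omega>. b t \<omega> - b s \<omega>))"
    using bm_measurable_increment[OF st] by (subst integral_distr) simp_all
  also have "\<dots> = (\<integral>x. iexp (u \<bullet> x) * complex_of_real (gauss_density (sqrt (t - s)) x) \<partial>lborel)"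
    unfolding law by (subst integral_density) (auto simp: gauss_density_nonneg scaleR_conv_of_real mult.commute)
  also have "\<dots> = complex_of_real (exp (- ((t - s) * (u \<bullet> u)) / 2))"
    using st by (subst iexp_gauss_density) auto
  finally show ?thesis .
qed

lemma bm_indep:
  assumes "0 < m"
  shows "prob_space.indep_vars N (\<lambda>_. borel) (\<lambda>i \<omega>. b (real (Suc i) / real m) \<omega> - b (real i / real m) \<omega>) {..<m}"
proof -
  have "\<forall>(t :: nat \<Rightarrow> real) k. 0 \<le> t 0 \<and> (\<forall>i<k. t i \<le> t (Suc i)) \<longrightarrow>
        prob_space.indep_vars N (\<lambda>_. borel) (\<lambda>i \<omega>. b (t (Suc i)) \<omega> - b (t i) \<omega>) {..<k}"
    using bm unfolding standard_brownian_motion_def by blast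
  from this[rule_format, of "\<lambda>i. real i / real m" m] show ?thesis by (simp add: divide_right_mono)
qed

lemma bm_compact: "\<omega> \<in> space N \<Longrightarrow> compact ((\<lambda>t. b t \<omega>) ` {0..1})"
  by (intro compact_continuous_image continuous_on_subset[OF bm_continuous]) auto

end

subsection \<open>Convergence of hull functionals\<close>

locale walk_and_bm = centred_walk M \<xi> for M :: "'a measure" and \<xi> :: "nat \<Rightarrow> 'a \<Rightarrow> real^'n" +
  fixes N :: "'b measure" and b :: "real \<Rightarrow> 'b \<Rightarrow> real^'n" and \<Phi> :: "(real^'n) set \<Rightarrow> real"
  assumes bm: "standard_brownian_motion N b" and \<Phi>: "hausdorff_uniform \<Phi>"
begin

abbreviation "B \<equiv> psd_sqrt \<Sigma>"

interpretation N: prob_space N by (rule bm_prob_space[OF bm])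

lemma B_inner: "(B *v u) \<bullet> (B *v u) = u \<bullet> (\<Sigma> *v u)"
  using symmetric_matrix_inner[OF transpose_psd_sqrt[OF transpose_second_moment second_moment_psd], of u "B *v u"]
    psd_sqrt_square[OF transpose_second_moment second_moment_psd]
  by (simp add: matrix_vector_mul_assoc)

definition increment :: "nat \<Rightarrow> nat \<Rightarrow> 'b \<Rightarrow> real^'n" where
  "increment m j \<omega> = B *v (b (real (Suc j) / real m) \<omega> - b (real j / real m) \<omega>)"

lemma measurable_matrix_mult [measurable]: "(\<lambda>x. A *v x) \<in> borel_measurable borel" for A :: "real^'n^'n"
  by (intro borel_measurable_continuous_onI linear_continuous_on matrix_vector_mul_bounded_linear)

lemma measurable_increment [measurable]: "increment m j \<in> borel_measurable N"
proof -
  have [measurable]: "b (real i / real m) \<in> borel_measurable N" for i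
    by (rule bm_measurable[OF bm]) simp
  show ?thesis unfolding increment_def[abs_def] by measurable
qed

text \<open>Symmetry moves the matrix \<open>B\<close> from the increment to \<open>u\<close>, and
  \<open>B_inner\<close> turns the Gaussian exponent into
  \<open>u \<bullet> (\<Sigma> *v u)\<close>: exactly the limit found for one block of the
  walk.\<close>

lemma increment_law:
  assumes m: "0 < m"
  shows "prob_space (distr N borel (increment m j))"
    and "(\<integral>x. iexp (u \<bullet> x) \<partial>distr N borel (increment m j)) = complex_of_real (exp (- (u \<bullet> (\<Sigma> *v u)) / (2 * real m)))"
proof -
  show "prob_space (distr N borel (increment m j))" by (rule N.prob_space_distr) measurable
  have sym: "transpose B = B" by (rule transpose_psd_sqrt[OF transpose_second_moment second_moment_psd])
  have "(\<integral>x. iexp (u \<bullet> x) \<partial>distr N borel (increment m j)) = (\<integral>\<omega>. iexp (u \<bullet> increment m j \<omega>) \<partial>N)"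
    by (subst integral_distr) auto
  also have "\<dots> = (\<integral>\<omega>. iexp ((B *v u) \<bullet> (b (real (Suc j) / real m) \<omega> - b (real j / real m) \<omega>)) \<partial>N)"
    unfolding increment_def symmetric_matrix_inner[OF sym] ..
  also have "\<dots> = complex_of_real (exp (- ((real (Suc j) / real m - real j / real m) * ((B *v u) \<bullet> (B *v u))) / 2))"
    using m by (intro bm_char[OF bm]) (auto simp: divide_strict_right_mono)
  also have "real (Suc j) / real m - real j / real m = 1 / real m"
    by (simp flip: diff_divide_distrib)
  finally show "(\<integral>x. iexp (u \<bullet> x) \<partial>distr N borel (increment m j)) = complex_of_real (exp (- (u \<bullet> (\<Sigma> *v u)) / (2 * real m)))"
    by (simp add: B_inner mult.commute)
qed

lemma expectation_increments:
  fixes F :: "(nat \<Rightarrow> real^'n) \<Rightarrow> real"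
  assumes F: "coord_continuous m F" and m: "0 < m"
  shows "(\<integral>\<omega>. F (\<lambda>j. increment m j \<omega>) \<partial>N) = (\<integral>x. F x \<partial>PiM {..<m} (\<lambda>j. distr N borel (increment m j)))"
proof -
  have "N.indep_vars (\<lambda>_. borel) (increment m) {..<m}"
    unfolding increment_def[abs_def]
    using N.indep_vars_compose2[OF bm_indep[OF bm m], of "\<lambda>_ x. B *v x" "\<lambda>_. borel"] by simp
  then have joint: "distr N (PiM {..<m} (\<lambda>_. borel)) (\<lambda>\<omega>. \<lambda>j\<in>{..<m}. increment m j \<omega>) = PiM {..<m} (\<lambda>j. distr N borel (increment m j))"
    using m by (subst (asm) N.indep_vars_iff_distr_eq_PiM') auto
  have Fm: "F \<in> borel_measurable (PiM {..<m} (\<lambda>_. borel))"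
    by (rule borel_measurable_continuous_PiM[OF coord_continuous_imp_continuous_on[OF F]]) simp
  have "(\<integral>\<omega>. F (\<lambda>j. increment m j \<omega>) \<partial>N) = (\<integral>\<omega>. F (\<lambda>j\<in>{..<m}. increment m j \<omega>) \<partial>N)"
    by (intro Bochner_Integration.integral_cong refl coord_continuous_cong[OF F]) simp
  also have "\<dots> = (\<integral>x. F x \<partial>distr N (PiM {..<m} (\<lambda>_. borel)) (\<lambda>\<omega>. \<lambda>j\<in>{..<m}. increment m j \<omega>))"
    by (rule integral_distr[symmetric, OF _ Fm]) measurable
  finally show ?thesis unfolding joint .
qed

definition Yn :: "nat \<Rightarrow> 'a \<Rightarrow> real" where
  "Yn n \<omega> = \<Phi> (convex hull ((\<lambda>k. S k \<omega> /\<^sub>R sqrt (real n)) ` {0..n}))"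

text \<open>Sampling at multiples of \<open>n div m\<close> gives blocks of equal length and hence
  of equal law, at the price of leaving out the last \<open>n mod m\<close> steps.\<close>

definition Ynm :: "nat \<Rightarrow> nat \<Rightarrow> 'a \<Rightarrow> real" where
  "Ynm m n \<omega> = \<Phi> (convex hull ((\<lambda>k. S (k * (n div m)) \<omega> /\<^sub>R sqrt (real n)) ` {0..m}))"

definition Ym :: "nat \<Rightarrow> 'b \<Rightarrow> real" where
  "Ym m \<omega> = \<Phi> (convex hull ((\<lambda>k. B *v b (real k / real m) \<omega>) ` {0..m}))"

definition Y :: "'b \<Rightarrow> real" where
  "Y \<omega> = \<Phi> ((*v) B ` brownian_hull b \<omega>)"

lemma Y_eq: "Y \<omega> = \<Phi> (convex hull ((\<lambda>t. B *v b t \<omega>) ` {0..1}))"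
  unfolding Y_def brownian_hull_def
  by (simp add: convex_hull_linear_image[OF matrix_vector_mul_linear] image_image)

lemma measurable_Yn [measurable]: "Yn n \<in> borel_measurable M"
  unfolding Yn_def[abs_def]
  by (rule measurable_coord_continuous[OF coord_continuous_imp_continuous_on[OF coord_continuous_hull[OF \<Phi>]]]) measurable

lemma measurable_Ynm [measurable]: "Ynm m n \<in> borel_measurable M"
  unfolding Ynm_def[abs_def]
  by (rule measurable_coord_continuous[OF coord_continuous_imp_continuous_on[OF coord_continuous_hull[OF \<Phi>]]]) measurable

lemma measurable_Ym [measurable]: "Ym m \<in> borel_measurable N"
proof -
  have [measurable]: "b (real i / real m) \<in> borel_measurable N" for i
    by (rule bm_measurable[OF bm]) simp
  show ?thesis
    unfolding Ym_def[abs_def]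
    by (rule measurable_coord_continuous[OF coord_continuous_imp_continuous_on[OF coord_continuous_hull[OF \<Phi>]]]) measurable
qed

text \<open>Uniform continuity of the path on \<open>{0..1}\<close> makes the sampled points
  Hausdorff close to the whole path. Convergence for every path also yields the measurability of
  \<open>Y\<close>.\<close>

lemma Ym_tendsto:
  assumes \<omega>: "\<omega> \<in> space N"
  shows "(\<lambda>m. Ym m \<omega>) \<longlonglongrightarrow> Y \<omega>"
proof (rule LIMSEQ_I)
  fix r :: real assume r: "0 < r"
  define p where "p t = B *v b t \<omega>" for t
  have cont: "continuous_on {0..1} p"
    unfolding p_def
    by (intro bounded_linear.continuous_on[OF matrix_vector_mul_bounded_linear]
        continuous_on_subset[OF bm_continuous[OF bm \<omega>]]) auto
  then have comp: "compact (p ` {0..1})" by (intro compact_continuous_image) auto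
  obtain R where R: "R > 0" "\<And>x. x \<in> p ` {0..1} \<Longrightarrow> norm x \<le> R"
    using compact_imp_bounded[OF comp] unfolding bounded_pos by blast
  have r2: "r / 2 > 0" using r by simp
  obtain \<delta> where \<delta>: "\<delta> > 0" and close: "\<And>X Y. compact X \<Longrightarrow> X \<noteq> {} \<Longrightarrow> compact Y \<Longrightarrow> Y \<noteq> {} \<Longrightarrow>
      X \<subseteq> cball 0 R \<Longrightarrow> Y \<subseteq> cball 0 R \<Longrightarrow> (\<And>x. x \<in> X \<Longrightarrow> \<exists>y\<in>Y. dist x y \<le> \<delta>) \<Longrightarrow>
      (\<And>y. y \<in> Y \<Longrightarrow> \<exists>x\<in>X. dist x y \<le> \<delta>) \<Longrightarrow> \<bar>\<Phi> (convex hull X) - \<Phi> (convex hull Y)\<bar> \<le> r / 2"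
    using hausdorff_uniform_hull[OF \<Phi> R(1) r2] by metis
  have "uniformly_continuous_on {0..1} p" using cont by (rule compact_uniformly_continuous) auto
  then obtain d where d: "d > 0" "\<And>s t. s \<in> {0..1} \<Longrightarrow> t \<in> {0..1} \<Longrightarrow> dist t s < d \<Longrightarrow> dist (p t) (p s) < \<delta>"
    using \<delta> unfolding uniformly_continuous_on_def by meson
  obtain m0 where m0: "real m0 * d > 1" using ex_less_of_nat_mult[OF d(1)] by blast
  have "norm (Ym m \<omega> - Y \<omega>) < r" if m: "m \<ge> m0 + 1" for m
  proof -
    have mpos: "0 < m" using m by simp
    have md: "1 / real m < d"
    proof -
      have "1 < real m * d" using m0 m d(1) by (smt (verit) mult_right_mono of_nat_mono add_leD1)
      then show ?thesis using mpos by (simp add: field_simps)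
    qed
    have grid: "real k / real m \<in> {0..1}" if "k \<in> {0..m}" for k using that mpos by simp
    have sub: "(\<lambda>k. p (real k / real m)) ` {0..m} \<subseteq> p ` {0..1}" using grid by auto
    have "\<bar>\<Phi> (convex hull ((\<lambda>k. p (real k / real m)) ` {0..m})) - \<Phi> (convex hull (p ` {0..1}))\<bar> \<le> r / 2"
    proof (rule close)
      show "\<exists>y\<in>p ` {0..1}. dist x y \<le> \<delta>" if "x \<in> (\<lambda>k. p (real k / real m)) ` {0..m}" for x
        using that sub \<delta> by (intro bexI[of _ x]) auto
      show "\<exists>x\<in>(\<lambda>k. p (real k / real m)) ` {0..m}. dist x y \<le> \<delta>" if "y \<in> p ` {0..1}" for y
      proof -
        obtain t where t: "t \<in> {0..1}" "y = p t" using \<open>y \<in> p ` {0..1}\<close> by blast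
        \<comment> \<open>The last grid point not after \<open>t\<close>, at distance less than
          \<open>1 / real m\<close>.\<close>
        define k where "k = nat \<lfloor>t * real m\<rfloor>"
        have k1: "real k \<le> t * real m" "t * real m < real k + 1" using t by (auto simp: k_def)
        have "t * real m \<le> real m" using t by (simp add: mult_left_le_one_le)
        then have "real k \<le> real m" using k1 by linarith
        then have k: "k \<in> {0..m}" by simp
        have "dist (real k / real m) t = (t * real m - real k) / real m"
          using mpos k1 by (simp add: dist_real_def abs_if field_simps)
        also have "\<dots> < 1 / real m" using k1 mpos by (intro divide_strict_right_mono) auto
        finally have "dist (p (real k / real m)) (p t) < \<delta>" using md grid[OF k] t(1) by (intro d(2)) auto
        then show ?thesis using k t by (intro bexI[of _ "p (real k / real m)"]) auto
      qed
      show "p ` {0..1} \<subseteq> cball 0 R" using R by auto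
      then show "(\<lambda>k. p (real k / real m)) ` {0..m} \<subseteq> cball 0 R" using sub by blast
    qed (use comp in \<open>auto intro: finite_imp_compact\<close>)
    then show ?thesis unfolding Ym_def Y_eq p_def using r by simp
  qed
  then show "\<exists>no. \<forall>m\<ge>no. norm (Ym m \<omega> - Y \<omega>) < r" by blast
qed

lemma measurable_Y [measurable]: "Y \<in> borel_measurable N"
  by (rule borel_measurable_LIMSEQ_real[OF Ym_tendsto]) measurable

text \<open>Composed with \<open>path_sum\<close>, both sides become means of one continuous
  function \<open>F\<close> of \<open>m\<close> independent increments, so the convergence of
  product laws applies.\<close>

lemma fidi_convergence:
  fixes g :: "real \<Rightarrow> real"
  assumes m: "0 < m" and g: "\<And>t. isCont g t" "\<And>t. \<bar>g t\<bar> \<le> K"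
  shows "(\<lambda>n. expectation (\<lambda>\<omega>. g (Ynm m n \<omega>))) \<longlonglongrightarrow> (\<integral>\<omega>. g (Ym m \<omega>) \<partial>N)"
proof -
  define F where "F x = g (\<Phi> (convex hull (path_sum x ` {0..m})))" for x
  have F: "coord_continuous m F"
    unfolding F_def
    using coord_continuous_path_sum[OF coord_continuous_compose[OF g(1) coord_continuous_hull[OF \<Phi>, of m]]] .
  have "(\<lambda>n. \<integral>x. F x \<partial>PiM {..<m} (\<lambda>j. distr M borel (\<lambda>\<omega>. S (n div m) \<omega> /\<^sub>R sqrt (real n))))
      \<longlonglongrightarrow> (\<integral>x. F x \<partial>PiM {..<m} (\<lambda>j. distr N borel (increment m j)))"
  proof (rule tendsto_integral_PiM_continuous[OF _ _ _ _ _ F])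
    show "\<bar>F x\<bar> \<le> K" for x unfolding F_def by (rule g(2))
    show "weak_lipschitz (\<lambda>n. distr M borel (\<lambda>\<omega>. S (n div m) \<omega> /\<^sub>R sqrt (real n))) (distr N borel (increment m j))" for j
      by (rule block_weak[OF m]) (auto simp: increment_law[OF m])
  qed (auto intro: prob_space_distr increment_law(1)[OF m])
  moreover have "(\<integral>x. F x \<partial>PiM {..<m} (\<lambda>j. distr M borel (\<lambda>\<omega>. S (n div m) \<omega> /\<^sub>R sqrt (real n)))) = expectation (\<lambda>\<omega>. g (Ynm m n \<omega>))" for n
  proof -
    \<comment> \<open>The block increments telescope, and the walk starts at 0.\<close>
    have "path_sum (\<lambda>j. (S (Suc j * (n div m)) \<omega> - S (j * (n div m)) \<omega>) /\<^sub>R sqrt (real n)) =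
        (\<lambda>k. S (k * (n div m)) \<omega> /\<^sub>R sqrt (real n))" for \<omega>
    proof
      fix k
      show "path_sum (\<lambda>j. (S (Suc j * (n div m)) \<omega> - S (j * (n div m)) \<omega>) /\<^sub>R sqrt (real n)) k =
          S (k * (n div m)) \<omega> /\<^sub>R sqrt (real n)"
        unfolding path_sum_def by (induction k) (simp_all add: scaleR_diff_right)
    qed
    then have "F (\<lambda>j. (S (Suc j * (n div m)) \<omega> - S (j * (n div m)) \<omega>) /\<^sub>R sqrt (real n)) = g (Ynm m n \<omega>)" for \<omega>
      unfolding F_def Ynm_def by (simp only:)
    then show ?thesis
      unfolding expectation_blocks[OF F m, symmetric] by (simp only:)
  qed
  moreover have "(\<integral>x. F x \<partial>PiM {..<m} (\<lambda>j. distr N borel (increment m j))) = (\<integral>\<omega>. g (Ym m \<omega>) \<partial>N)"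
  proof -
    have "F (\<lambda>j. increment m j \<omega>) = g (Ym m \<omega>)" if "\<omega> \<in> space N" for \<omega>
    proof -
      have "path_sum (\<lambda>j. increment m j \<omega>) = (\<lambda>k. B *v b (real k / real m) \<omega>)"
      proof
        fix k
        have "path_sum (\<lambda>j. increment m j \<omega>) k = B *v b (real k / real m) \<omega> - B *v b 0 \<omega>"
          unfolding path_sum_def by (induction k) (simp_all add: increment_def matrix_vector_mult_diff_distrib)
        then show "path_sum (\<lambda>j. increment m j \<omega>) k = B *v b (real k / real m) \<omega>" using bm_0[OF bm that] by simp
      qed
      then show ?thesis unfolding F_def Ym_def by (simp only:)
    qed
    then show ?thesis
      unfolding expectation_increments[OF F m, symmetric] by (intro Bochner_Integration.integral_cong refl)
  qed
  ultimately show ?thesis by simp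
qed

lemma max_walk_bound:
  assumes \<eta>: "0 < \<eta>"
  obtains R where "R > 0" "\<And>n. 0 < n \<Longrightarrow> prob {\<omega>\<in>space M. \<exists>k\<le>n. R * sqrt (real n) \<le> norm (S k \<omega>)} \<le> \<eta>"
proof -
  \<comment> \<open>The first summand makes the final bound at most \<open>\<eta>\<close>, the
    second gives the variance condition \<open>4 * C / D \<le> 1 / 2\<close> of
    \<open>maximal_inequality\<close>, and the last keeps \<open>D\<close> positive.\<close>
  define D where "D = 16 * C / \<eta> + 16 * C + 1"
  have D: "0 < D" "16 * C / \<eta> \<le> D" "16 * C \<le> D" using C_nonneg \<eta> by (auto simp: D_def intro!: add_nonneg_pos)
  have "prob {\<omega>\<in>space M. \<exists>k\<le>n. sqrt D * sqrt (real n) \<le> norm (S k \<omega>)} \<le> \<eta>" if n: "0 < n" for n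
  proof -
    define a where "a = sqrt D * sqrt (real n) / 2"
    have a: "0 < a" using D n by (simp add: a_def)
    have a2: "a\<^sup>2 = D * real n / 4" using D by (simp add: a_def power_divide power_mult_distrib)
    have eq: "real n * C / a\<^sup>2 = 4 * C / D" using n by (simp add: a2)
    have "prob {\<omega>\<in>space M. \<exists>k\<le>n. 2 * a \<le> norm (S k \<omega>)} \<le> 2 * prob {\<omega>\<in>space M. a \<le> norm (S n \<omega>)}"
      using D by (intro maximal_inequality a) (simp add: eq field_simps)
    also have "\<dots> \<le> 2 * (4 * C / D)" using chebyshev_S[OF a, of n] unfolding eq by simp
    also have "\<dots> \<le> \<eta>"
    proof -
      have "16 * C \<le> D * \<eta>" using D(2) \<eta> by (simp add: field_simps)
      then have "8 * C \<le> D * \<eta>" using C_nonneg by linarith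
      then show ?thesis using D(1) by (simp add: field_simps)
    qed
    finally show ?thesis by (simp add: a_def)
  qed
  then show ?thesis using that[of "sqrt D"] D by simp
qed

text \<open>The chain runs from \<open>Yn n\<close> through \<open>Ynm m n\<close> and
  \<open>Ym m\<close> to \<open>Y\<close>. First \<open>m\<close> is fixed, large enough for the
  last link and for a small oscillation within blocks; then \<open>n\<close> tends to infinity.
  Uniform continuity of \<open>cts_step\<close> turns closeness of the functionals outside a small
  event into closeness of means.\<close>

theorem hull_functional_convergence:
  assumes xy: "x < y"
  shows "(\<lambda>n. expectation (\<lambda>\<omega>. cts_step x y (Yn n \<omega>))) \<longlonglongrightarrow> (\<integral>\<omega>. cts_step x y (Y \<omega>) \<partial>N)"
proof (rule LIMSEQ_I)
  fix r :: real assume r: "0 < r"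
  define g where "g = cts_step x y"
  have uc: "uniformly_continuous_on UNIV g" unfolding g_def using xy by (rule cts_step_uniformly_continuous)
  then have contg: "isCont g t" for t
    using uniformly_continuous_imp_continuous continuous_on_eq_continuous_at[OF open_UNIV] by blast
  have [measurable]: "g \<in> borel_measurable borel"
    using uc by (intro borel_measurable_continuous_onI uniformly_continuous_imp_continuous)
  have g01: "0 \<le> g t" "g t \<le> 1" for t using xy by (auto simp: g_def cts_step_def field_simps)
  have gabs: "\<bar>g t\<bar> \<le> 1" for t using g01[of t] by simp
  have r8: "r / 8 > 0" using r by simp
  obtain \<kappa> where \<kappa>: "\<kappa> > 0" "\<And>s t. dist s t < \<kappa> \<Longrightarrow> dist (g s) (g t) < r / 8"
    using uc r8 unfolding uniformly_continuous_on_def by (metis UNIV_I)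
  have \<kappa>2: "\<kappa> / 2 > 0" using \<kappa> by simp
  obtain R where R: "R > 0" "\<And>n. 0 < n \<Longrightarrow> prob {\<omega>\<in>space M. \<exists>k\<le>n. R * sqrt (real n) \<le> norm (S k \<omega>)} \<le> r / 8"
    using max_walk_bound[OF r8] by blast
  obtain \<delta> where \<delta>: "\<delta> > 0" and close: "\<And>X Y. compact X \<Longrightarrow> X \<noteq> {} \<Longrightarrow> compact Y \<Longrightarrow> Y \<noteq> {} \<Longrightarrow>
      X \<subseteq> cball 0 R \<Longrightarrow> Y \<subseteq> cball 0 R \<Longrightarrow> (\<And>x. x \<in> X \<Longrightarrow> \<exists>y\<in>Y. dist x y \<le> \<delta>) \<Longrightarrow>
      (\<And>y. y \<in> Y \<Longrightarrow> \<exists>x\<in>X. dist x y \<le> \<delta>) \<Longrightarrow> \<bar>\<Phi> (convex hull X) - \<Phi> (convex hull Y)\<bar> \<le> \<kappa> / 2"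
    using hausdorff_uniform_hull[OF \<Phi> R(1) \<kappa>2] by metis
  have "(\<lambda>m. \<integral>\<omega>. g (Ym m \<omega>) \<partial>N) \<longlonglongrightarrow> (\<integral>\<omega>. g (Y \<omega>) \<partial>N)"
  proof (rule integral_dominated_convergence[where w = "\<lambda>_. 1"])
    show "AE \<omega> in N. (\<lambda>m. g (Ym m \<omega>)) \<longlonglongrightarrow> g (Y \<omega>)"
      by (intro AE_I2 isCont_tendsto_compose[OF contg] Ym_tendsto)
  qed (use gabs in auto)
  from tendstoD[OF this r8]
  have "\<forall>\<^sub>F m in sequentially. norm ((\<integral>\<omega>. g (Ym m \<omega>) \<partial>N) - (\<integral>\<omega>. g (Y \<omega>) \<partial>N)) < r / 8"
    unfolding dist_norm .
  moreover define osc where "osc m n = prob {\<omega>\<in>space M. \<exists>j\<le>m. \<exists>i\<le>n div m.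
      2 * (\<delta> / 2 * sqrt (real n)) \<le> norm (S (j * (n div m) + i) \<omega> - S (j * (n div m)) \<omega>)}" for m n
  have "\<forall>\<^sub>F m in sequentially. \<forall>\<^sub>F n in sequentially. osc m n < r / 8"
    unfolding osc_def
  proof (rule oscillation[OF increment_law(1)[of 1 0]])
    show "(\<integral>x. iexp (u \<bullet> x) \<partial>distr N borel (increment 1 0)) = complex_of_real (exp (- (u \<bullet> (\<Sigma> *v u)) / 2))" for u
      using increment_law(2)[where m = 1 and u = u and j = 0] by simp
  qed (use \<delta> r8 in auto)
  ultimately have "\<forall>\<^sub>F m in sequentially. 0 < m \<and> norm ((\<integral>\<omega>. g (Ym m \<omega>) \<partial>N) - (\<integral>\<omega>. g (Y \<omega>) \<partial>N)) < r / 8 \<and>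
     (\<forall>\<^sub>F n in sequentially. osc m n < r / 8)"
    using eventually_gt_at_top[of 0] by eventually_elim simp
  from eventually_happens'[OF sequentially_bot this]
  obtain m where m: "0 < m" and m1: "norm ((\<integral>\<omega>. g (Ym m \<omega>) \<partial>N) - (\<integral>\<omega>. g (Y \<omega>) \<partial>N)) < r / 8"
    and m2: "\<forall>\<^sub>F n in sequentially. osc m n < r / 8"
    by blast
  have "\<forall>\<^sub>F n in sequentially. norm (expectation (\<lambda>\<omega>. g (Ynm m n \<omega>)) - (\<integral>\<omega>. g (Ym m \<omega>) \<partial>N)) < r / 8"
    using tendstoD[OF fidi_convergence[OF m contg gabs] r8] unfolding dist_norm .
  with m2 have "\<forall>\<^sub>F n in sequentially. norm (expectation (\<lambda>\<omega>. g (Yn n \<omega>)) - (\<integral>\<omega>. g (Y \<omega>) \<partial>N)) < r"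
    \<comment> \<open>This forces \<open>m \<le> n div m\<close>, so the remainder
      \<open>n mod m\<close> is shorter than a block and fits after the last sampling time.\<close>
    using eventually_ge_at_top[of "m * m"]
  proof eventually_elim
    case (elim n)
    define q where "q = n div m"
    have n: "0 < n" using elim(3) m by (metis gr0I mult_is_0 not_le nat_0_less_mult_iff)
    have qm: "m \<le> q" using elim(3) m by (simp add: q_def less_eq_div_iff_mult_less_eq)
    then have q: "0 < q" using m by simp
    have sn: "0 < sqrt (real n)" using n by simp
    \<comment> \<open>On \<open>E1\<close> the scaled walk reaches distance \<open>R\<close>, on
      \<open>E2\<close> some block oscillates too much. Outside both, the uniform continuity of
      \<open>\<Phi>\<close> compares the hulls; on them the values of \<open>g\<close> differ by at
      most 1 and the small probability does the rest.\<close>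
    define E1 where "E1 = {\<omega>\<in>space M. \<exists>k\<le>n. R * sqrt (real n) \<le> norm (S k \<omega>)}"
    define E2 where "E2 = {\<omega>\<in>space M. \<exists>j\<le>m. \<exists>i\<le>q. \<delta> * sqrt (real n) \<le> norm (S (j * q + i) \<omega> - S (j * q) \<omega>)}"
    have [measurable]: "E1 \<in> events" "E2 \<in> events" unfolding E1_def E2_def by measurable
    have p1: "prob E1 \<le> r / 8" unfolding E1_def by (rule R(2)[OF n])
    have p2: "prob E2 \<le> r / 8" using elim(1) unfolding E2_def q_def osc_def by simp
    have split: "\<exists>j\<le>m. \<exists>i\<le>q. k = j * q + i" if "k \<le> n" for k
    proof (cases "k < m * q")
      case True
      then have "k div q \<le> m" by (metis less_imp_le less_mult_imp_div_less)
      moreover have "k = k div q * q + k mod q" by simp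
      moreover have "k mod q \<le> q" using q by (simp add: less_imp_le)
      ultimately show ?thesis by blast
    next
      case False
      have "n = m * q + n mod m" by (simp add: q_def)
      then have "k - m * q \<le> n mod m" using that by linarith
      also have "\<dots> \<le> q" using m qm by (meson le_trans less_imp_le mod_less_divisor)
      finally show ?thesis using False by (intro exI[of _ m] exI[of _ "k - m * q"] conjI) auto
    qed
    have diff: "\<bar>g (Yn n \<omega>) - g (Ynm m n \<omega>)\<bar> \<le> r / 8 + indicator E1 \<omega> + indicator E2 \<omega>" if \<omega>: "\<omega> \<in> space M" for \<omega>
    proof (cases "\<omega> \<in> E1 \<or> \<omega> \<in> E2")
      case True
      have "\<bar>g (Yn n \<omega>) - g (Ynm m n \<omega>)\<bar> \<le> 1"
        using g01[of "Yn n \<omega>"] g01[of "Ynm m n \<omega>"] by linarith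
      then show ?thesis using True r by (auto simp: indicator_def)
    next
      case False
      have b1: "norm (S k \<omega> /\<^sub>R sqrt (real n)) \<le> R" if "k \<le> n" for k
      proof -
        have "norm (S k \<omega>) \<le> R * sqrt (real n)" using False \<omega> that unfolding E1_def by force
        then show ?thesis using sn by (simp add: field_simps)
      qed
      have b2: "dist (S (j * q + i) \<omega> /\<^sub>R sqrt (real n)) (S (j * q) \<omega> /\<^sub>R sqrt (real n)) \<le> \<delta>" if "j \<le> m" "i \<le> q" for i j
      proof -
        have "\<not> (\<exists>j\<le>m. \<exists>i\<le>q. \<delta> * sqrt (real n) \<le> norm (S (j * q + i) \<omega> - S (j * q) \<omega>))"
          using False \<omega> by (simp add: E2_def)
        then have "\<not> \<delta> * sqrt (real n) \<le> norm (S (j * q + i) \<omega> - S (j * q) \<omega>)" using that by blast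
        then have "norm (S (j * q + i) \<omega> - S (j * q) \<omega>) \<le> \<delta> * sqrt (real n)" by simp
        moreover have "dist (S (j * q + i) \<omega> /\<^sub>R sqrt (real n)) (S (j * q) \<omega> /\<^sub>R sqrt (real n)) =
            norm (S (j * q + i) \<omega> - S (j * q) \<omega>) / sqrt (real n)"
          by (simp add: dist_norm divide_inverse mult.commute flip: scaleR_diff_right)
        ultimately show ?thesis using sn by (simp add: pos_divide_le_eq)
      qed
      have le_n: "k * q \<le> n" if "k \<le> m" for k
      proof -
        have "k * q \<le> m * q" using that by simp
        also have "\<dots> \<le> n" unfolding q_def by simp
        finally show ?thesis .
      qed
      have "\<bar>Yn n \<omega> - Ynm m n \<omega>\<bar> \<le> \<kappa> / 2"
        unfolding Yn_def Ynm_def q_def[symmetric]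
      proof (rule close)
        show "(\<lambda>k. S k \<omega> /\<^sub>R sqrt (real n)) ` {0..n} \<subseteq> cball 0 R" using b1 by auto
        show "(\<lambda>k. S (k * q) \<omega> /\<^sub>R sqrt (real n)) ` {0..m} \<subseteq> cball 0 R" using b1 le_n by auto
        show "\<exists>y\<in>(\<lambda>k. S (k * q) \<omega> /\<^sub>R sqrt (real n)) ` {0..m}. dist x y \<le> \<delta>"
          if x: "x \<in> (\<lambda>k. S k \<omega> /\<^sub>R sqrt (real n)) ` {0..n}" for x
        proof -
          obtain k where k: "k \<le> n" "x = S k \<omega> /\<^sub>R sqrt (real n)" using x by auto
          obtain j i where ji: "j \<le> m" "i \<le> q" "k = j * q + i" using split[OF k(1)] by blast
          have "dist x (S (j * q) \<omega> /\<^sub>R sqrt (real n)) \<le> \<delta>" unfolding k(2) ji(3) using ji by (intro b2)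
          then show ?thesis using ji(1) by (intro bexI[of _ "S (j * q) \<omega> /\<^sub>R sqrt (real n)"]) auto
        qed
        show "\<exists>x\<in>(\<lambda>k. S k \<omega> /\<^sub>R sqrt (real n)) ` {0..n}. dist x y \<le> \<delta>"
          if y: "y \<in> (\<lambda>k. S (k * q) \<omega> /\<^sub>R sqrt (real n)) ` {0..m}" for y
          using y le_n \<delta> by (intro bexI[of _ y]) auto
      qed (auto intro: finite_imp_compact)
      then have "dist (Yn n \<omega>) (Ynm m n \<omega>) < \<kappa>" using \<kappa>(1) by (simp add: dist_real_def)
      then have "\<bar>g (Yn n \<omega>) - g (Ynm m n \<omega>)\<bar> < r / 8" using \<kappa>(2) by (simp add: dist_real_def)
      then show ?thesis using False by simp
    qed
    have i1: "integrable M (\<lambda>\<omega>. g (Yn n \<omega>))" "integrable M (\<lambda>\<omega>. g (Ynm m n \<omega>))"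
      using gabs by (auto intro!: integrable_const_bound[where B = 1])
    have i2: "integrable M (indicat_real E1)" "integrable M (indicat_real E2)"
      by (auto intro!: integrable_const_bound[where B = 1])
    have "\<bar>expectation (\<lambda>\<omega>. g (Yn n \<omega>)) - expectation (\<lambda>\<omega>. g (Ynm m n \<omega>))\<bar> = \<bar>expectation (\<lambda>\<omega>. g (Yn n \<omega>) - g (Ynm m n \<omega>))\<bar>"
      using i1 by simp
    also have "\<dots> \<le> expectation (\<lambda>\<omega>. \<bar>g (Yn n \<omega>) - g (Ynm m n \<omega>)\<bar>)" by (rule integral_abs_bound)
    also have "\<dots> \<le> expectation (\<lambda>\<omega>. r / 8 + indicator E1 \<omega> + indicator E2 \<omega>)"
      using i1 i2 diff by (intro integral_mono) auto
    also have "\<dots> = r / 8 + prob E1 + prob E2" using i2 by (simp add: prob_space)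
    finally have "\<bar>expectation (\<lambda>\<omega>. g (Yn n \<omega>)) - expectation (\<lambda>\<omega>. g (Ynm m n \<omega>))\<bar> \<le> r / 8 + r / 8 + r / 8"
      using p1 p2 by linarith
    \<comment> \<open>Five errors of at most \<open>r / 8\<close>: three from the comparison with
      \<open>Ynm\<close>, one from \<open>elim(2)\<close> and one from \<open>m1\<close>.\<close>
    then show ?case using elim(2) m1 r unfolding real_norm_def by linarith
  qed
  then show "\<exists>no. \<forall>n\<ge>no. norm (expectation (\<lambda>\<omega>. cts_step x y (Yn n \<omega>)) - (\<integral>\<omega>. cts_step x y (Y \<omega>) \<partial>N)) < r"
    by (simp add: eventually_sequentially g_def)
qed

text \<open>The scaled hull makes sense for positive \<open>n\<close>, whereas convergence in
  distribution demands measurability at every index; a constant \<open>X 0\<close> satisfies it and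
  leaves the limit unchanged.\<close>

theorem converges_in_distribution_hull_functional:
  assumes X: "\<And>n \<omega>. 0 < n \<Longrightarrow> X n \<omega> = \<Phi> ((*\<^sub>R) (1 / sqrt (real n)) ` walk_hull \<xi> n \<omega>)" and X0: "X 0 = (\<lambda>_. c)"
  shows "converges_in_distribution M X N (\<lambda>\<omega>. \<Phi> ((*v) B ` brownian_hull b \<omega>))"
proof -
  have XY: "X n = Yn n" if "0 < n" for n
  proof
    fix \<omega>
    have "convex hull ((\<lambda>k. S k \<omega> /\<^sub>R sqrt (real n)) ` {0..n}) = (*\<^sub>R) (1 / sqrt (real n)) ` walk_hull \<xi> n \<omega>"
      unfolding walk_hull_def by (simp add: convex_hull_scaling[symmetric] image_image inverse_eq_divide)
    then show "X n \<omega> = Yn n \<omega>" using X[OF that] by (simp add: Yn_def)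
  qed
  have Xm[measurable]: "X n \<in> borel_measurable M" for n
    using XY[of n] X0 by (cases "n = 0") auto
  have "weak_conv_m (\<lambda>n. distr M borel (X n)) (distr N borel Y)"
  proof (rule integral_cts_step_conv_imp_weak_conv)
    show "real_distribution (distr M borel (X n))" for n by (rule real_distribution_distr) measurable
    show "real_distribution (distr N borel Y)" by (rule N.real_distribution_distr) measurable
    fix x y :: real assume xy: "x < y"
    have [measurable]: "cts_step x y \<in> borel_measurable borel"
      using cts_step_uniformly_continuous[OF xy] by (intro borel_measurable_continuous_onI uniformly_continuous_imp_continuous)
    have "\<forall>\<^sub>F n in sequentially. expectation (\<lambda>\<omega>. cts_step x y (Yn n \<omega>)) = integral\<^sup>L (distr M borel (X n)) (cts_step x y)"
      using eventually_gt_at_top[of 0] by eventually_elim (subst integral_distr, auto simp: XY)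
    from Lim_transform_eventually[OF hull_functional_convergence[OF xy] this]
    show "(\<lambda>n. integral\<^sup>L (distr M borel (X n)) (cts_step x y)) \<longlonglongrightarrow> integral\<^sup>L (distr N borel Y) (cts_step x y)"
      by (subst (2) integral_distr) auto
  qed
  then show ?thesis
    unfolding converges_in_distribution_def using measurable_Y Xm by (simp add: Y_def[abs_def])
qed

end

section \<open>Scaling exponents and the three functionals\<close>

lemma powr_neg_half_eq:
  assumes "0 < n"
  shows "real n powr (- real k / 2) = (1 / sqrt (real n)) ^ k"
proof -
  have "(1 / sqrt (real n)) ^ k = (real n powr (- 1 / 2)) powr real k"
    using assms by (subst powr_realpow) (auto simp: powr_minus powr_half_sqrt inverse_eq_divide)
  then show ?thesis by (simp add: powr_powr)
qed

lemma compact_convex_walk_hull: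
  "compact (walk_hull \<xi> n \<omega>)" "convex (walk_hull \<xi> n \<omega>)" "walk_hull \<xi> n \<omega> \<noteq> {}"
  unfolding walk_hull_def by (auto intro: finite_imp_compact_convex_hull)

theorem theorem6p10:
  fixes M :: "'a measure" and N :: "'b measure"
    and \<xi> :: "nat \<Rightarrow> 'a \<Rightarrow> real^'n"
    and b :: "real \<Rightarrow> 'b \<Rightarrow> real^'n"
    and \<Sigma> :: "real^'n^'n"
  assumes prob: "prob_space M"
    and indep: "prob_space.indep_vars M (\<lambda>_. borel) \<xi> UNIV"
    and ident: "\<And>i. distr M borel (\<xi> i) = distr M borel (\<xi> 0)"
    and mean_zero: "(\<integral>\<omega>. \<xi> 0 \<omega> \<partial>M) = 0"
    and square_integrable: "integrable M (\<lambda>\<omega>. (norm (\<xi> 0 \<omega>))\<^sup>2)"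
    and Sigma: "\<Sigma> = second_moment_matrix M (\<xi> 0)"
    and bm: "standard_brownian_motion N b"
  shows "converges_in_distribution
           M (\<lambda>n \<omega>. real n powr (- 1 / 2) * mean_width (walk_hull \<xi> n \<omega>))
           N (\<lambda>\<omega>. mean_width ((*v) (psd_sqrt \<Sigma>) ` brownian_hull b \<omega>)) \<and>
         converges_in_distribution
           M (\<lambda>n \<omega>. real n powr (- (real CARD('n) - 1) / 2) * surface_area (walk_hull \<xi> n \<omega>))
           N (\<lambda>\<omega>. surface_area ((*v) (psd_sqrt \<Sigma>) ` brownian_hull b \<omega>)) \<and>
         converges_in_distribution
           M (\<lambda>n \<omega>. real n powr (- real CARD('n) / 2) * vol (walk_hull \<xi> n \<omega>))
           N (\<lambda>\<omega>. vol ((*v) (psd_sqrt \<Sigma>) ` brownian_hull b \<omega>)) \<and>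
         (\<forall>\<omega>\<in>space N. vol ((*v) (psd_sqrt \<Sigma>) ` brownian_hull b \<omega>) =
            vol (brownian_hull b \<omega>) * sqrt (det \<Sigma>))"
proof -
  interpret w: centred_walk M \<xi>
    using prob by (rule centred_walk.intro) (use indep ident mean_zero square_integrable in \<open>unfold_locales, auto\<close>)
  \<comment> \<open>The condition on \<open>X 0\<close> holds in each instance because
    \<open>0 powr a = 0\<close> for all \<open>a\<close>, even for \<open>a = 0\<close>, which
    occurs for the surface area in dimension 1.\<close>
  have conv: "converges_in_distribution M X N (\<lambda>\<omega>. \<Phi> ((*v) (psd_sqrt \<Sigma>) ` brownian_hull b \<omega>))"
    if \<Phi>: "hausdorff_uniform \<Phi>" and X0: "X 0 = (\<lambda>_. 0)"
      and X: "\<And>n \<omega>. 0 < n \<Longrightarrow> X n \<omega> = \<Phi> ((*\<^sub>R) (1 / sqrt (real n)) ` walk_hull \<xi> n \<omega>)" for X \<Phi>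
  proof -
    interpret walk_and_bm M \<xi> N b \<Phi> by unfold_locales (use bm \<Phi> in auto)
    show ?thesis unfolding Sigma by (rule converges_in_distribution_hull_functional[OF X X0])
  qed
  note hull = compact_convex_walk_hull[of \<xi>]
  have "converges_in_distribution
           M (\<lambda>n \<omega>. real n powr (- 1 / 2) * mean_width (walk_hull \<xi> n \<omega>))
           N (\<lambda>\<omega>. mean_width ((*v) (psd_sqrt \<Sigma>) ` brownian_hull b \<omega>))"
    using powr_neg_half_eq[where k = 1]
    by (intro conv hausdorff_uniform_mean_width) (simp_all add: mean_width_scaleR hull)
  moreover have "converges_in_distribution
           M (\<lambda>n \<omega>. real n powr (- (real CARD('n) - 1) / 2) * surface_area (walk_hull \<xi> n \<omega>))
           N (\<lambda>\<omega>. surface_area ((*v) (psd_sqrt \<Sigma>) ` brownian_hull b \<omega>))"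
  proof (rule conv[OF hausdorff_uniform_surface_area])
    fix n :: nat and \<omega> assume n: "0 < n"
    \<comment> \<open>A finite type is nonempty, so the subtraction on natural numbers is exact and
      the exponent takes the form that \<open>powr_neg_half_eq\<close> expects.\<close>
    have "real CARD('n) - 1 = real (CARD('n) - 1)" by (simp add: of_nat_diff Suc_leI)
    then show "real n powr (- (real CARD('n) - 1) / 2) * surface_area (walk_hull \<xi> n \<omega>) =
        surface_area ((*\<^sub>R) (1 / sqrt (real n)) ` walk_hull \<xi> n \<omega>)"
      using n by (simp only: powr_neg_half_eq) (simp add: surface_area_scaleR hull)
  qed simp
  moreover have "converges_in_distribution
           M (\<lambda>n \<omega>. real n powr (- real CARD('n) / 2) * vol (walk_hull \<xi> n \<omega>))
           N (\<lambda>\<omega>. vol ((*v) (psd_sqrt \<Sigma>) ` brownian_hull b \<omega>))"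
  proof (rule conv[OF hausdorff_uniform_vol])
    fix n :: nat and \<omega> assume "0 < n"
    then show "real n powr (- real CARD('n) / 2) * vol (walk_hull \<xi> n \<omega>) =
        vol ((*\<^sub>R) (1 / sqrt (real n)) ` walk_hull \<xi> n \<omega>)"
      by (simp only: powr_neg_half_eq) (simp add: vol_scaleR)
  qed simp
  moreover have "vol ((*v) (psd_sqrt \<Sigma>) ` brownian_hull b \<omega>) = vol (brownian_hull b \<omega>) * sqrt (det \<Sigma>)"
    if "\<omega> \<in> space N" for \<omega>
    unfolding Sigma brownian_hull_def
    by (intro vol_psd_sqrt_image w.transpose_second_moment w.second_moment_psd compact_convex_hull bm_compact[OF bm that])
  ultimately show ?thesis by blast
qed

end
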